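(* Let $k\ge 1$ be an integer, let $\chi_1$ and $\chi_2$ be primitive Dirichlet characters modulo $N_1$ and $N_2$ respectively with $\chi_1\chi_2(-1)=(-1)^k$, and assume that it is not the case that $k=2$ and $\chi_1$, $\chi_2$ are both trivial. Let $e\ge1$ be an integer and set $N=eN_1N_2$. Let $\gamma=\begin{pmatrix}A&B\\C&D\end{pmatrix}\in \mathrm{SL}_2(\mathbb{Z})$ be such that $C\mid N$, $C>0$, and $N\mid B$. Set $g=\gcd(e,C)$, $g_1=\gcd(N_1g,C)$, and $g_2=\gcd(N_2g,C)$. Then, with $F_k(\chi_1,\chi_2,e)(\tau)=F_k(\chi_1,\chi_2)(e\tau)$, $$F_k(\chi_1,\chi_2,e)|_k\gamma=\frac{1}{z_k(\chi_1,\chi_2,C)}\sum_{n\ge0}a_{\gamma}(n)q^{g_1g_2n/N}\;,$$ where: (1) $$z_k(\chi_1,\chi_2,C)=2(N_2e/g_2)^{k-1}(e/g)\,\mathfrak{g}(\overline{\chi_1})\,\mathfrak{g}(\overline{\chi_2})\;.$$ (2) For $n\ge1$, $$a_{\gamma}(n)=\zeta_N^{A^{-1}(g_1g_2/C)n}\sum_{m\mid n,\ m\in\mathbb{Z}}\operatorname{sign}(m)\,m^{k-1}c(n,m)\;,$$ where the sum is over all positive and negative divisors $m$ of $n$, $A^{-1}$ is an inverse of $A$ modulo $N$, and $$c(n,m)=\sum_{\substack{s_1\bmod C/g\\(N_1g/g_1)s_1\equiv n/m\pmod{C/g_1}}}\overline{\chi_1}\left(\frac{n/m-(N_1g/g_1)s_1}{C/g_1}\right)\sum_{\substack{s_2\bmod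 C/g\\(N_2g/g_2)s_2\equiv m\pmod{C/g_2}}}\overline{\chi_2}\left(\frac{m-(N_2g/g_2)s_2}{C/g_2}\right)\zeta_{C/g}^{-(Ae/g)^{-1}s_1s_2}\;,$$ with $(Ae/g)^{-1}$ an inverse of $Ae/g$ modulo $C/g$. (3) Set $$T_k(\chi_1,\chi_2)=\begin{cases}(-1)^{k-1}\dfrac{\mathfrak{g}(\overline{\chi_2})}{N_2(g_2/g)^{k-1}}\,\overline{\chi_1}(-Ae/g)\,S_k(\overline{\chi_1}\chi_2)&\text{if } C/g=N_1\;,\\ 0&\text{if } C/g\ne N_1\;,\end{cases}$$ and let $T_k(\chi_2,\chi_1)$ be the quantity obtained by exchanging the roles of the indices $1$ and $2$ (so that the condition becomes $C/g=N_2$). Then $$a_{\gamma}(0)=\begin{cases}T_k(\chi_1,\chi_2)&\text{if } k>1\;,\\ T_1(\chi_1,\chi_2)+T_1(\chi_2,\chi_1)&\text{if } k=1\;.\end{cases}$$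
   Context: For $\tau$ in the upper half-plane and $x\in\mathbb{Q}$, $q^x=e^{2\pi i\tau x}$; $\zeta_n=e^{2\pi i/n}$. For $\gamma=\begin{pmatrix}a&b\\c&d\end{pmatrix}\in\mathrm{SL}_2(\mathbb{Z})$, $(f|_k\gamma)(\tau)=(c\tau+d)^{-k}f\left(\frac{a\tau+b}{c\tau+d}\right)$. The trivial primitive character modulo $1$ takes the value $1$ at every integer. For a primitive character $\chi$ modulo $f$, $\mathfrak{g}(\chi)=\sum_{a\bmod f}\chi(a)e^{2\pi i a/f}$ is the standard Gauss sum. For $\chi_1,\chi_2$ primitive modulo $N_1,N_2$ with $\chi_1\chi_2(-1)=(-1)^k$, define $$F_k(\chi_1,\chi_2)(\tau)=c_0+\sum_{n\ge1}\sigma_{k-1}(\chi_1,\chi_2,n)q^n,\qquad \sigma_{k-1}(\chi_1,\chi_2,n)=\sum_{d\mid n,\ d>0}d^{k-1}\chi_1(d)\chi_2(n/d),$$ where $c_0=\delta_{N_2,1}L(\chi_1,1-k)/2$ if $k\ge2$, and $c_0=\left(\delta_{N_2,1}L(\chi_1,0)+\delta_{N_1,1}L(\chi_2,0)\right)/2$ if $k=1$; here $\delta$ is the Kronecker delta. For a Dirichlet character $\chi$ modulo $M$, let $f$ be its conductor and $\chi_f$ the primitive character modulo $f$ equivalent to $\chi$. Define $$S_k(\chi)=(M/f)^k\,\mathfrak{g}(\chi_f)\,\frac{\overline{B_k(\chi_f)}}{k}\prod_{p\mid M}\left(1-\frac{\chi_f(p)}{p^k}\right),$$ where $B_k(\chi_f)$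 is the generalized ($\chi_f$-)Bernoulli number and $p$ runs over primes. When $\chi(-1)=(-1)^k$ (and $L(\chi,k)$ is finite) this equals $-\frac{2(k-1)!\,M^k}{(-2\pi i)^k}L(\chi,k)$. In the claim, $\overline{\chi_1}\chi_2$ and $\overline{\chi_2}\chi_1$ are regarded as characters modulo $M=N_1N_2$. *)

theory Defs
  imports "HOL-Complex_Analysis.Complex_Analysis" "HOL-Number_Theory.Cong"
begin

subsection \<open>Dirichlet characters\<close>

text \<open>
  A Dirichlet character modulo \<open>M\<close> is represented by the \<open>M\<close>-periodic function on the integers
  that vanishes exactly at the integers not coprime to \<open>M\<close>. The only one modulo \<open>1\<close> is the
  constant \<open>1\<close> (also at \<open>0\<close>).
\<close>

definition dirichlet_character :: "nat \<Rightarrow> (int \<Rightarrow> complex) \<Rightarrow> bool" where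
  "dirichlet_character M \<psi> \<longleftrightarrow> M > 0 \<and>
     (\<forall>a b. [a = b] (mod int M) \<longrightarrow> \<psi> a = \<psi> b) \<and>
     \<psi> 1 = 1 \<and> (\<forall>a b. \<psi> (a * b) = \<psi> a * \<psi> b) \<and>
     (\<forall>a. \<psi> a = 0 \<longleftrightarrow> \<not> coprime a (int M))"

definition induced_by :: "nat \<Rightarrow> (int \<Rightarrow> complex) \<Rightarrow> nat \<Rightarrow> (int \<Rightarrow> complex) \<Rightarrow> bool" where
  "induced_by M \<psi> f \<phi> \<longleftrightarrow> f dvd M \<and> dirichlet_character f \<phi> \<and>
     (\<forall>a. coprime a (int M) \<longrightarrow> \<psi> a = \<phi> a)"

definition conductor :: "nat \<Rightarrow> (int \<Rightarrow> complex) \<Rightarrow> nat" where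
  "conductor M \<psi> = (LEAST f. \<exists>\<phi>. induced_by M \<psi> f \<phi>)"

definition primitive_character :: "nat \<Rightarrow> (int \<Rightarrow> complex) \<Rightarrow> bool" where
  "primitive_character M \<psi> \<longleftrightarrow> dirichlet_character M \<psi> \<and> conductor M \<psi> = M"

definition associated_primitive :: "nat \<Rightarrow> (int \<Rightarrow> complex) \<Rightarrow> (int \<Rightarrow> complex)" where
  "associated_primitive M \<psi> = (THE \<phi>. induced_by M \<psi> (conductor M \<psi>) \<phi>)"

definition conj_char :: "(int \<Rightarrow> complex) \<Rightarrow> int \<Rightarrow> complex" where
  "conj_char \<psi> = (\<lambda>a. cnj (\<psi> a))"

definition zeta_root :: "nat \<Rightarrow> complex" where
  "zeta_root n = exp (2 * complex_of_real pi * \<i> / of_nat n)"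

definition gauss_sum :: "nat \<Rightarrow> (int \<Rightarrow> complex) \<Rightarrow> complex" where
  "gauss_sum f \<psi> = (\<Sum>a<f. \<psi> (int a) * exp (2 * complex_of_real pi * \<i> * of_nat a / of_nat f))"

text \<open>
  Generating function: \<open>t (\<Sum>r<f. \<psi>(r) exp(r t)) / (exp(f t) - 1) = (\<Sum>k. B\<^sub>k(\<psi>) t^k / k!)\<close>.
\<close>

definition gen_bernoulli :: "nat \<Rightarrow> nat \<Rightarrow> (int \<Rightarrow> complex) \<Rightarrow> complex" where
  "gen_bernoulli k f \<psi> = fact k *
     fps_nth (fps_X * (\<Sum>r<f. fps_const (\<psi> (int r)) * fps_exp (of_nat r)) / (fps_exp (of_nat f) - 1)) k"

text \<open>
  The value at \<open>s\<close> of the analytic continuation of the Dirichlet series \<open>\<Sum>n\<ge>1. \<psi>(n) n^(-s)\<close>.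
  For a Dirichlet character it continues holomorphically at least to the complement of \<open>{1}\<close>, so by
  the identity theorem the value does not depend on the connected domain \<open>U\<close>.
\<close>

definition dirichlet_L :: "(int \<Rightarrow> complex) \<Rightarrow> complex \<Rightarrow> complex" where
  "dirichlet_L \<psi> s = (THE v. \<exists>U L. open U \<and> connected U \<and> {z. Re z > 1} \<subseteq> U \<and> s \<in> U \<and>
     L holomorphic_on U \<and>
     (\<forall>z. Re z > 1 \<longrightarrow> L z = (\<Sum>n. \<psi> (int (Suc n)) / of_nat (Suc n) powr z)) \<and> v = L s)"


subsection \<open>Eisenstein series\<close>

definition qpow :: "complex \<Rightarrow> real \<Rightarrow> complex" where
  "qpow \<tau> x = exp (2 * complex_of_real pi * \<i> * \<tau> * complex_of_real x)"

text \<open>Weight \<open>k\<close> slash action of the matrix with rows \<open>(a, b)\<close> and \<open>(c, d)\<close>.\<close>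

definition slash :: "nat \<Rightarrow> (complex \<Rightarrow> complex) \<Rightarrow> int \<Rightarrow> int \<Rightarrow> int \<Rightarrow> int \<Rightarrow> complex \<Rightarrow> complex" where
  "slash k f a b c d \<tau> =
     (of_int c * \<tau> + of_int d) powi (- int k) * f ((of_int a * \<tau> + of_int b) / (of_int c * \<tau> + of_int d))"

definition sigma_char :: "nat \<Rightarrow> (int \<Rightarrow> complex) \<Rightarrow> (int \<Rightarrow> complex) \<Rightarrow> nat \<Rightarrow> complex" where
  "sigma_char j \<chi>1 \<chi>2 n = (\<Sum>d | d dvd n. of_nat d ^ j * \<chi>1 (int d) * \<chi>2 (int (n div d)))"

definition eisenstein_const ::
    "nat \<Rightarrow> (int \<Rightarrow> complex) \<Rightarrow> nat \<Rightarrow> (int \<Rightarrow> complex) \<Rightarrow> nat \<Rightarrow> complex" where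
  "eisenstein_const k \<chi>1 N1 \<chi>2 N2 =
     (if k = 1 then ((if N2 = 1 then dirichlet_L \<chi>1 0 else 0) + (if N1 = 1 then dirichlet_L \<chi>2 0 else 0)) / 2
      else (if N2 = 1 then dirichlet_L \<chi>1 (1 - of_nat k) else 0) / 2)"

definition eisenstein_F ::
    "nat \<Rightarrow> (int \<Rightarrow> complex) \<Rightarrow> nat \<Rightarrow> (int \<Rightarrow> complex) \<Rightarrow> nat \<Rightarrow> complex \<Rightarrow> complex" where
  "eisenstein_F k \<chi>1 N1 \<chi>2 N2 \<tau> =
     eisenstein_const k \<chi>1 N1 \<chi>2 N2 +
     (\<Sum>\<^sub>\<infinity>n\<in>{1..}. sigma_char (k - 1) \<chi>1 \<chi>2 n * qpow \<tau> (real n))"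

definition eisenstein_Fe ::
    "nat \<Rightarrow> (int \<Rightarrow> complex) \<Rightarrow> nat \<Rightarrow> (int \<Rightarrow> complex) \<Rightarrow> nat \<Rightarrow> nat \<Rightarrow> complex \<Rightarrow> complex" where
  "eisenstein_Fe k \<chi>1 N1 \<chi>2 N2 e \<tau> = eisenstein_F k \<chi>1 N1 \<chi>2 N2 (of_nat e * \<tau>)"


subsection \<open>The expansion at a cusp\<close>

definition S_const :: "nat \<Rightarrow> nat \<Rightarrow> (int \<Rightarrow> complex) \<Rightarrow> complex" where
  "S_const k M \<psi> =
     (let f = conductor M \<psi>; \<psi>f = associated_primitive M \<psi>
      in (of_nat M / of_nat f) ^ k * gauss_sum f \<psi>f * (cnj (gen_bernoulli k f \<psi>f) / of_nat k) *
         (\<Prod>p | prime p \<and> p dvd M. 1 - \<psi>f (int p) / of_nat p ^ k))"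

definition z_const ::
    "nat \<Rightarrow> (int \<Rightarrow> complex) \<Rightarrow> nat \<Rightarrow> (int \<Rightarrow> complex) \<Rightarrow> nat \<Rightarrow> nat \<Rightarrow> nat \<Rightarrow> complex" where
  "z_const k \<chi>1 N1 \<chi>2 N2 e C =
     (let g = gcd e C; g2 = gcd (N2 * g) C
      in 2 * (of_nat (N2 * e) / of_nat g2) ^ (k - 1) * (of_nat e / of_nat g) *
         gauss_sum N1 (conj_char \<chi>1) * gauss_sum N2 (conj_char \<chi>2))"

text \<open>
  In the following definitions all uses of \<open>div\<close> are exact when \<open>m\<close> divides \<open>n\<close> and \<open>C\<close> divides
  \<open>e N1 N2\<close>. The argument \<open>u\<close> stands for an inverse of \<open>A e / g\<close> modulo \<open>C / g\<close>, and \<open>A'\<close> for an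
  inverse of \<open>A\<close> modulo \<open>e N1 N2\<close>.
\<close>

definition c_coeff ::
    "(int \<Rightarrow> complex) \<Rightarrow> nat \<Rightarrow> (int \<Rightarrow> complex) \<Rightarrow> nat \<Rightarrow> nat \<Rightarrow> nat \<Rightarrow> int \<Rightarrow> nat \<Rightarrow> int \<Rightarrow> complex" where
  "c_coeff \<chi>1 N1 \<chi>2 N2 e C u n m =
     (let g = gcd e C; g1 = gcd (N1 * g) C; g2 = gcd (N2 * g) C;
          r1 = int (N1 * g div g1); r2 = int (N2 * g div g2);
          M1 = int (C div g1); M2 = int (C div g2)
      in \<Sum>s1 | s1 \<in> {0..<int (C div g)} \<and> [r1 * s1 = int n div m] (mod M1).
           conj_char \<chi>1 ((int n div m - r1 * s1) div M1) *
           (\<Sum>s2 | s2 \<in> {0..<int (C div g)} \<and> [r2 * s2 = m] (mod M2).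
              conj_char \<chi>2 ((m - r2 * s2) div M2) * zeta_root (C div g) powi (- (u * s1 * s2))))"

definition T_const ::
    "nat \<Rightarrow> (int \<Rightarrow> complex) \<Rightarrow> nat \<Rightarrow> (int \<Rightarrow> complex) \<Rightarrow> nat \<Rightarrow> nat \<Rightarrow> int \<Rightarrow> nat \<Rightarrow> complex" where
  "T_const k \<chi>1 N1 \<chi>2 N2 e A C =
     (let g = gcd e C; g2 = gcd (N2 * g) C
      in if C div g = N1
         then (-1) ^ (k - 1) *
              (gauss_sum N2 (conj_char \<chi>2) / (of_nat N2 * (of_nat g2 / of_nat g) ^ (k - 1))) *
              conj_char \<chi>1 (- A * int (e div g)) *
              S_const k (N1 * N2) (\<lambda>a. conj_char \<chi>1 a * \<chi>2 a)
         else 0)"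

definition a_coeff ::
    "nat \<Rightarrow> (int \<Rightarrow> complex) \<Rightarrow> nat \<Rightarrow> (int \<Rightarrow> complex) \<Rightarrow> nat \<Rightarrow> nat \<Rightarrow>
     int \<Rightarrow> nat \<Rightarrow> int \<Rightarrow> int \<Rightarrow> nat \<Rightarrow> complex" where
  "a_coeff k \<chi>1 N1 \<chi>2 N2 e A C A' u n =
     (let g = gcd e C; g1 = gcd (N1 * g) C; g2 = gcd (N2 * g) C
      in if n = 0 then
           (if k > 1 then T_const k \<chi>1 N1 \<chi>2 N2 e A C
            else T_const 1 \<chi>1 N1 \<chi>2 N2 e A C + T_const 1 \<chi>2 N2 \<chi>1 N1 e A C)
         else
           zeta_root (e * N1 * N2) powi (A' * int (g1 * g2 div C) * int n) *
           (\<Sum>m | m dvd int n. of_int (sgn m * m ^ (k - 1)) * c_coeff \<chi>1 N1 \<chi>2 N2 e C u n m))"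

end

theory Submission
  imports Defs
begin

text \<open>
  A function \<open>J(\<tau>, z)\<close>, one half plus geometric series in \<open>e\<^sup>2\<^sup>\<pi>\<^sup>i\<^sup>z\<close>, is determined by its simple
  poles on the lattice and its quasi-periods, whence \<open>J(-1/\<tau>, z/\<tau>)/\<tau> = J(\<tau>, z) - z/\<tau>\<close>; this is the
  only modular input.  Summing \<open>J\<close> over torsion translates against a finite Fourier transform and
  taking the \<open>(k-1)\<close>-st Taylor coefficient at \<open>z = 0\<close> gives, uniformly in \<open>k \<ge> 1\<close> and without Hecke's
  convergence factors, an inversion formula for the series \<open>\<Sum> \<Phi>(n,m) n\<^sup>k\<^sup>-\<^sup>1 q\<^sup>m\<^sup>n\<close> with doubly
  periodic \<open>\<Phi>\<close>: inversion replaces \<open>\<Phi>\<close> by its two-variable finite Fourier transform.  Since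
  \<open>(A\<tau> + B)/(C\<tau> + D) = A/C - 1/(C(C\<tau> + D))\<close>, the left-hand side of the theorem is such a series for
  \<open>\<Phi>(n,m) = \<chi>\<^sub>1(n) \<chi>\<^sub>2(m) e(A e n m/C)\<close>, evaluated at an inversion, and the transform of \<open>\<Phi>\<close> is
  \<open>c(n,m)\<close> up to a constant.  The constant terms are Bernoulli numbers of finite Fourier transforms;
  the one of \<open>F\<^sub>k\<close> is identified with \<open>L(1-k)\<close> by analytic continuation.
\<close>

subsection \<open>A Lambert series and its inversion\<close>

text \<open>In weights 1 and 2 the lattice sums behind Eisenstein series do not converge absolutely;
  the q-expansion of J does, in every weight. The quasi-period 1 of J is why
  \<open>torsion_sum\<close> subtracts \<open>a / M2\<close>, and the correction z/\<tau> of the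
  inversion survives only as a multiple of t^2: the anomaly of weight 2, proportional to \<Sum>
  \<Phi>(0,a), which is zero unless both characters are trivial.

  The periods M1 and M2 are the least common multiples of N1 and N2 with c = C/g. Writing the
  argument of F_k as \<alpha>/c - 1/(\<sigma> M2) forces \<sigma> = (C\<tau>+D) g2/(N2 e). The
  transformed series runs in powers of e(\<sigma>/M1), and \<sigma>/M1 = g1 g2 \<tau>/N + D g1 g2/(C
  N) yields both the exponent and the root of unity in the claim, with D congruent to the inverse of
  A because N divides B. Against the automorphy factor \<sigma>^k leaves the power of N2 e/g2, which
  together with the normalisation of the Fourier transform makes up z_k.\<close>

definition ee :: "complex \<Rightarrow> complex" where
  "ee x = exp (2 * complex_of_real pi * \<i> * x)"

lemma ee_0 [simp]: "ee 0 = 1"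
  by (simp add: ee_def)

lemma ee_nonzero [simp]: "ee x \<noteq> 0"
  by (simp add: ee_def)

lemma ee_add: "ee (x + y) = ee x * ee y"
  by (simp add: ee_def exp_add ring_distribs)

lemma ee_minus: "ee (- x) = inverse (ee x)"
  by (simp add: ee_def exp_minus)

lemma ee_diff: "ee (x - y) = ee x / ee y"
  using ee_add[of x "- y"] by (simp add: ee_minus divide_inverse)

lemma ee_eq_1_iff: "ee x = 1 \<longleftrightarrow> x \<in> \<int>"
proof -
  have "ee x = 1 \<longleftrightarrow> (\<exists>n::int. 2 * complex_of_real pi * \<i> * x = 0 + complex_of_real (2 * of_int n * pi) * \<i>)"
    unfolding ee_def using exp_eq[of "2 * complex_of_real pi * \<i> * x" 0] by (simp add: mult_ac)
  also have "\<dots> \<longleftrightarrow> (\<exists>n::int. x = of_int n)"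
  proof (intro arg_cong[where f = Ex] ext)
    fix n :: int
    have "complex_of_real (2 * of_int n * pi) * \<i> = 2 * complex_of_real pi * \<i> * of_int n" by simp
    thus "2 * complex_of_real pi * \<i> * x = 0 + complex_of_real (2 * of_int n * pi) * \<i> \<longleftrightarrow> x = of_int n"
      by (simp only: add_0_left mult_cancel_left) simp
  qed
  finally show ?thesis by (auto simp: Ints_def)
qed

lemma ee_of_int [simp]: "ee (of_int n) = 1"
  by (subst ee_eq_1_iff) auto

lemma ee_of_nat [simp]: "ee (of_nat n) = 1"
  using ee_of_int[of "int n"] by simp

lemma ee_1 [simp]: "ee 1 = 1"
  using ee_of_nat[of 1] by simp

lemma ee_power: "ee x ^ n = ee (of_nat n * x)"
  by (simp add: ee_def exp_of_nat_mult[symmetric] mult_ac)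

lemma norm_ee: "norm (ee x) = exp (- 2 * pi * Im x)"
  by (simp add: ee_def norm_exp_eq_Re)

lemma norm_ee_less_1_iff: "norm (ee x) < 1 \<longleftrightarrow> Im x > 0"
  by (simp add: norm_ee mult_less_0_iff zero_less_mult_iff)

lemma Im_neg_inverse_pos: "Im \<tau> > 0 \<Longrightarrow> Im (- 1 / \<tau>) > 0"
  by (simp add: Im_divide zero_less_divide_iff complex_neq_0 not_less_iff_gr_or_eq add_pos_pos sum_power2_gt_zero_iff)

lemma holomorphic_on_ee [holomorphic_intros]:
  "f holomorphic_on A \<Longrightarrow> (\<lambda>z. ee (f z)) holomorphic_on A"
  unfolding ee_def by (intro holomorphic_intros)

lemma continuous_on_ee [continuous_intros]:
  "continuous_on A f \<Longrightarrow> continuous_on A (\<lambda>z. ee (f z))"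
  unfolding ee_def by (intro continuous_intros)

text \<open>The sum of x^n over n \<ge> 1, kept as a rational function because it is evaluated
  outside the unit disc as well.\<close>

definition geo :: "complex \<Rightarrow> complex" where
  "geo x = x / (1 - x)"

text \<open>So 1/2 + geo is odd under x -> 1/x, the reason for the constant 1/2 in
  \<open>Jfun\<close>; the -1 is also the source of its quasi-period.\<close>

lemma geo_inverse: "x \<noteq> 0 \<Longrightarrow> x \<noteq> 1 \<Longrightarrow> geo (inverse x) = - 1 - geo x"
  by (simp add: geo_def divide_simps)

lemma norm_geo_le:
  assumes "norm x \<le> r" "r < 1"
  shows   "norm (geo x) \<le> norm x / (1 - r)"
proof -
  have "1 - r \<le> norm (1 - x)"
    using norm_triangle_ineq2[of 1 x] assms by simp
  thus ?thesis
    using assms by (auto simp: geo_def norm_divide intro!: divide_left_mono mult_pos_pos)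
qed

text \<open>Locally uniform M-test. It serves both the Lambert series and, later, the remainder
  series of the Dirichlet continuation.\<close>

lemma holomorphic_on_suminf:
  fixes f :: "nat \<Rightarrow> complex \<Rightarrow> complex"
  assumes "open A" and hol: "\<And>n. f n holomorphic_on A"
    and bound: "\<And>x. x \<in> A \<Longrightarrow> \<exists>d>0. \<exists>M. cball x d \<subseteq> A \<and> summable M \<and>
                   (\<forall>\<^sub>F n in sequentially. \<forall>y\<in>cball x d. norm (f n y) \<le> M n)"
  shows "(\<lambda>z. \<Sum>n. f n z) holomorphic_on A"
proof (rule holomorphic_uniform_sequence[where f = "\<lambda>N z. \<Sum>n<N. f n z"])
  show "\<exists>d>0. cball x d \<subseteq> A \<and> uniform_limit (cball x d) (\<lambda>N z. \<Sum>n<N. f n z) (\<lambda>z. \<Sum>n. f n z) sequentially"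
    if "x \<in> A" for x
  proof -
    from bound[OF that] obtain d M where dM: "d > 0" "cball x d \<subseteq> A" "summable M"
      "\<forall>\<^sub>F n in sequentially. \<forall>y\<in>cball x d. norm (f n y) \<le> M n" by blast
    have "uniform_limit (cball x d) (\<lambda>N z. \<Sum>n<N. f n z) (\<lambda>z. \<Sum>n. f n z) sequentially"
      by (rule Weierstrass_m_test_ev) (use dM in auto)
    with dM show ?thesis by blast
  qed
qed (use assms in \<open>auto intro!: holomorphic_intros\<close>)

text \<open>Only m \<ge> 1: the omitted term m = 0 carries the pole at z = 0, so this part is
  holomorphic on a half-plane containing the real axis.\<close>

definition lam :: "complex \<Rightarrow> complex \<Rightarrow> complex" where
  "lam \<tau> z = (\<Sum>m. geo (ee (of_nat (Suc m) * \<tau> + z)))"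

text \<open>The bound depends on z only through a lower bound b of its imaginary part, as the M-test
  requires.\<close>

lemma norm_ee_shift_bound:
  assumes "Im \<tau> > 0" "Im z \<ge> b" "Im \<tau> + b > 0"
  shows "norm (geo (ee (of_nat (Suc m) * \<tau> + z))) \<le>
           exp (- 2 * pi * Im \<tau>) ^ m * (1 / (1 - exp (- 2 * pi * (Im \<tau> + b))))"
proof -
  define r where "r = exp (- 2 * pi * (Im \<tau> + b))"
  have r: "r < 1" "r > 0" using assms by (auto simp: r_def mult_less_0_iff)
  have "norm (ee (of_nat (Suc m) * \<tau> + z)) = exp (- 2 * pi * Im \<tau>) ^ m * exp (- 2 * pi * (Im \<tau> + Im z))"
    by (simp add: norm_ee exp_of_nat_mult[symmetric] exp_add[symmetric] algebra_simps)
  also have "\<dots> \<le> exp (- 2 * pi * Im \<tau>) ^ m * r"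
    unfolding r_def using assms by (intro mult_left_mono) auto
  finally have 1: "norm (ee (of_nat (Suc m) * \<tau> + z)) \<le> exp (- 2 * pi * Im \<tau>) ^ m * r" .
  have "exp (- 2 * pi * Im \<tau>) ^ m \<le> 1"
    using assms by (intro power_le_one) auto
  hence 2: "exp (- 2 * pi * Im \<tau>) ^ m * r \<le> r" using r by (simp add: mult_le_cancel_right1)
  have "norm (geo (ee (of_nat (Suc m) * \<tau> + z))) \<le> norm (ee (of_nat (Suc m) * \<tau> + z)) / (1 - r)"
    using r by (intro norm_geo_le order_trans[OF 1 2])
  also have "\<dots> \<le> exp (- 2 * pi * Im \<tau>) ^ m * 1 / (1 - r)"
  proof (intro divide_right_mono)
    have "exp (- 2 * pi * Im \<tau>) ^ m * r \<le> exp (- 2 * pi * Im \<tau>) ^ m * 1"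
      using r by (intro mult_left_mono) auto
    with 1 show "norm (ee (of_nat (Suc m) * \<tau> + z)) \<le> exp (- 2 * pi * Im \<tau>) ^ m * 1" by linarith
  qed (use r in auto)
  finally show ?thesis by (simp add: r_def)
qed

lemma summable_lam_bound:
  assumes "Im \<tau> > 0"
  shows "summable (\<lambda>m. exp (- 2 * pi * Im \<tau>) ^ m * c)"
  using assms by (intro summable_mult2 summable_geometric) (auto simp: mult_less_0_iff)

lemma summable_norm_lam:
  assumes "Im \<tau> > 0" "Im \<tau> + Im z > 0"
  shows "summable (\<lambda>m. norm (geo (ee (of_nat (Suc m) * \<tau> + z))))"
  by (rule summable_comparison_test'[OF summable_lam_bound[OF assms(1)], of 0])
     (use norm_ee_shift_bound[of \<tau> "Im z" z, OF assms(1) order_refl assms(2)] in \<open>simp only: real_norm_def abs_norm_cancel\<close>)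

lemma lam_shift:
  assumes "Im \<tau> > 0" "Im \<tau> + Im z > 0"
  shows "lam \<tau> z = geo (ee (\<tau> + z)) + lam \<tau> (z + \<tau>)"
proof -
  have "summable (\<lambda>m. geo (ee (of_nat (Suc m) * \<tau> + z)))"
    using summable_norm_lam[OF assms] by (rule summable_norm_cancel)
  from suminf_split_head[OF this] show ?thesis
    by (simp add: lam_def algebra_simps)
qed

lemma lam_periodic: "lam \<tau> (z + 1) = lam \<tau> z"
  by (simp add: lam_def ee_add add.assoc[symmetric])

lemma holomorphic_on_lam:
  assumes "Im \<tau> > 0"
  shows "lam \<tau> holomorphic_on {z. Im \<tau> + Im z > 0}"
  unfolding lam_def
proof (rule holomorphic_on_suminf)
  let ?A = "{z. Im \<tau> + Im z > 0}"
  show "open ?A" by (intro open_Collect_less continuous_intros)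
  show "(\<lambda>z. geo (ee (of_nat (Suc n) * \<tau> + z))) holomorphic_on ?A" for n
  proof -
    have "ee (of_nat (Suc n) * \<tau> + z) \<noteq> 1" if "z \<in> ?A" for z
    proof -
      have "Im (of_nat (Suc n) * \<tau> + z) = of_nat n * Im \<tau> + (Im \<tau> + Im z)"
        by (simp add: algebra_simps)
      also have "\<dots> > 0" using that assms by (intro add_nonneg_pos[where b = "Im \<tau> + Im z"]) auto
      finally have "norm (ee (of_nat (Suc n) * \<tau> + z)) < 1" by (simp only: norm_ee_less_1_iff)
      thus ?thesis by auto
    qed
    thus ?thesis unfolding geo_def by (intro holomorphic_intros) auto
  qed
  fix x assume x: "x \<in> ?A"
  define d where "d = (Im \<tau> + Im x) / 2"
  have d: "d > 0" using x by (simp add: d_def)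
  have im: "Im y \<ge> Im x - d" if "y \<in> cball x d" for y
    using that abs_Im_le_cmod[of "x - y"] by (auto simp: dist_norm)
  have pos: "Im \<tau> + (Im x - d) > 0" using x by (simp add: d_def field_simps)
  show "\<exists>d>0. \<exists>M. cball x d \<subseteq> ?A \<and> summable M \<and>
          (\<forall>\<^sub>F n in sequentially. \<forall>y\<in>cball x d. norm (geo (ee (of_nat (Suc n) * \<tau> + y))) \<le> M n)"
  proof (intro exI conjI)
    show "d > 0" by (rule d)
    show "cball x d \<subseteq> ?A" using im pos by force
    show "summable (\<lambda>m. exp (- 2 * pi * Im \<tau>) ^ m * (1 / (1 - exp (- 2 * pi * (Im \<tau> + (Im x - d))))))"
      by (rule summable_lam_bound[OF assms])
    show "\<forall>\<^sub>F n in sequentially. \<forall>y\<in>cball x d. norm (geo (ee (of_nat (Suc n) * \<tau> + y))) \<le>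
            exp (- 2 * pi * Im \<tau>) ^ n * (1 / (1 - exp (- 2 * pi * (Im \<tau> + (Im x - d)))))"
      by (intro always_eventually allI ballI norm_ee_shift_bound[OF assms im pos])
  qed
qed

text \<open>For |Im z| < Im \<tau> this is -1/(2 \<pi> i) times the logarithmic z-derivative of the
  Jacobi theta function that vanishes on the lattice.\<close>

definition Jfun :: "complex \<Rightarrow> complex \<Rightarrow> complex" where
  "Jfun \<tau> z = 1 / 2 + geo (ee z) + lam \<tau> z - lam \<tau> (- z)"

lemma Jfun_periodic: "Jfun \<tau> (z + 1) = Jfun \<tau> z"
proof -
  have "lam \<tau> (- 1 - z) = lam \<tau> (- z)"
    using lam_periodic[of \<tau> "- 1 - z"] by simp
  moreover have "- 1 - z = - (z + 1)" by simp
  ultimately have "lam \<tau> (- (z + 1)) = lam \<tau> (- z)" by metis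
  thus ?thesis by (simp add: Jfun_def lam_periodic ee_add del: minus_add_distrib)
qed

lemma Jfun_minus: "ee z \<noteq> 1 \<Longrightarrow> Jfun \<tau> (- z) = - Jfun \<tau> z"
  using geo_inverse[of "ee z"] unfolding Jfun_def ee_minus minus_minus by simp

text \<open>The strip is the one where z and z + \<tau> both have |Im| < Im \<tau>. The shift
  creates the summand geo(ee(-z)) at the head of the descending half, and \<open>geo_inverse\<close>
  rewrites it as the pole term at z plus 1.\<close>

lemma Jfun_quasiperiodic:
  assumes "Im \<tau> > 0" "- Im \<tau> < Im z" "Im z < 0"
  shows "Jfun \<tau> (z + \<tau>) = Jfun \<tau> z + 1"
proof -
  have "ee z \<noteq> 1" using assms norm_ee_less_1_iff[of "- z"] ee_minus[of z] by auto
  have 1: "geo (ee (- z)) = - 1 - geo (ee z)"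
    unfolding ee_minus by (rule geo_inverse) (use \<open>ee z \<noteq> 1\<close> in auto)
  have 2: "lam \<tau> z = geo (ee (z + \<tau>)) + lam \<tau> (z + \<tau>)"
    using lam_shift[of \<tau> z] assms by (simp add: add_ac)
  have "lam \<tau> (- (z + \<tau>)) = geo (ee (\<tau> + - (z + \<tau>))) + lam \<tau> (- (z + \<tau>) + \<tau>)"
    using lam_shift[of \<tau> "- (z + \<tau>)"] assms by simp
  also have "\<dots> = geo (ee (- z)) + lam \<tau> (- z)" by simp
  finally have 3: "lam \<tau> (- (z + \<tau>)) = - 1 - geo (ee z) + lam \<tau> (- z)" by (simp only: 1)
  show ?thesis by (simp only: Jfun_def 2 3) simp
qed

lemma holomorphic_on_Jfun:
  assumes "Im \<tau> > 0"
  shows "Jfun \<tau> holomorphic_on {z. \<bar>Im z\<bar> < Im \<tau> \<and> z \<notin> \<int>}"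
proof -
  let ?A = "{z. \<bar>Im z\<bar> < Im \<tau> \<and> z \<notin> \<int>}"
  have "lam \<tau> holomorphic_on ?A"
    by (rule holomorphic_on_subset[OF holomorphic_on_lam[OF assms]]) auto
  moreover have "(\<lambda>z. lam \<tau> (- z)) holomorphic_on ?A"
    by (rule holomorphic_on_compose_gen[of uminus ?A "lam \<tau>", OF _ holomorphic_on_lam[OF assms], unfolded o_def])
       (auto intro: holomorphic_on_minus[OF holomorphic_on_ident])
  ultimately have "(\<lambda>z. 1 / 2 + ee z / (1 - ee z) + lam \<tau> z - lam \<tau> (- z)) holomorphic_on ?A"
    by (intro holomorphic_intros) (auto simp: ee_eq_1_iff)
  thus ?thesis by (simp add: Jfun_def [abs_def] geo_def)
qed

text \<open>The residue of J at 0, which both sides of the inversion must share.\<close>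

lemma tendsto_times_geo_ee: "((\<lambda>z. z * geo (ee z)) \<longlongrightarrow> - 1 / (2 * complex_of_real pi * \<i>)) (at 0)"
proof -
  let ?c = "2 * complex_of_real pi * \<i>"
  have "((\<lambda>z. ee z) has_field_derivative ?c) (at 0)"
    unfolding ee_def by (auto intro!: derivative_eq_intros)
  hence "((\<lambda>z. (ee z - 1) / z) \<longlongrightarrow> ?c) (at 0)"
    by (simp add: has_field_derivative_iff)
  moreover have "(ee \<longlongrightarrow> ee 0) (at 0)"
    using continuous_on_ee[of UNIV "\<lambda>z. z"] unfolding continuous_on_def by (auto simp del: ee_0)
  ultimately have "((\<lambda>z. - ee z / ((ee z - 1) / z)) \<longlongrightarrow> - 1 / ?c) (at 0)"
    by (intro tendsto_intros) auto
  moreover have "- ee z / ((ee z - 1) / z) = z * geo (ee z)" for z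
    by (cases "ee z = 1") (auto simp: geo_def divide_simps algebra_simps)
  ultimately show ?thesis by simp
qed

text \<open>
  The difference of the two sides is an elliptic function with a removable singularity at \<open>0\<close>.
  By periodicity its modulus attains its maximum over the double period parallelogram in the
  closed inner half, hence in the interior; so it is constant, and being odd it vanishes.
\<close>

lemma Jfun_inversion:
  fixes \<tau> z :: complex
  defines "P \<equiv> {z. \<bar>Im z\<bar> < Im \<tau> \<and> \<bar>Im (z / \<tau>)\<bar> < Im (- 1 / \<tau>)}"
  assumes \<tau>: "Im \<tau> > 0" and z: "z \<in> P" "z \<noteq> 0"
  shows "Jfun (- 1 / \<tau>) (z / \<tau>) / \<tau> = Jfun \<tau> z - z / \<tau>"
proof -
  define \<tau>' where "\<tau>' = - 1 / \<tau>"
  have [simp]: "\<tau> \<noteq> 0" using \<tau> by auto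
  have \<tau>': "Im \<tau>' > 0" unfolding \<tau>'_def by (rule Im_neg_inverse_pos[OF \<tau>])
  \<comment> \<open>X and Y are the real coordinates with z = X \<tau> + Y. As 1/\<tau> has
    imaginary part -Im \<tau>', reading Y off Im (z/\<tau>) needs a minus sign. In these coordinates
    P is the square |X|, |Y| < 1.\<close>
  define X where "X = (\<lambda>z. Im z / Im \<tau>)"
  define Y where "Y = (\<lambda>z. - Im (z / \<tau>) / Im \<tau>')"
  have XY: "z = of_real (X z) * \<tau> + of_real (Y z)" for z
  proof -
    define y where "y = z - of_real (X z) * \<tau>"
    have "Im y = 0" using \<tau> by (simp add: y_def X_def)
    hence y: "y = of_real (Re y)" by (simp add: complex_eq_iff)
    have "z / \<tau> = of_real (X z) - y * \<tau>'"
      by (simp add: y_def \<tau>'_def field_simps)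
    also have "Im \<dots> = - Re y * Im \<tau>'" by (subst y) simp
    finally have "Y z = Re y" using \<tau>' by (simp add: Y_def)
    with y have "y = of_real (Y z)" by simp
    thus ?thesis by (simp add: y_def algebra_simps)
  qed
  have X_add [simp]: "X (z + \<tau>) = X z + 1" "X (z - \<tau>) = X z - 1" "X (z + 1) = X z" "X (z - 1) = X z" for z
    using \<tau> by (auto simp: X_def field_simps)
  have "Im (1 / \<tau>) = - Im \<tau>'" by (simp add: \<tau>'_def)
  hence Y_add [simp]: "Y (z + \<tau>) = Y z" "Y (z - \<tau>) = Y z" "Y (z + 1) = Y z + 1" "Y (z - 1) = Y z - 1" for z
    using \<tau>' by (auto simp: Y_def add_divide_distrib diff_divide_distrib)
  have P_iff: "z \<in> P \<longleftrightarrow> \<bar>X z\<bar> < 1 \<and> \<bar>Y z\<bar> < 1" for z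
    using \<tau> \<tau>' unfolding P_def X_def Y_def \<tau>'_def[symmetric] by (auto simp: abs_less_iff field_simps)
  have X_0 [simp]: "X 0 = 0" "Y 0 = 0" by (simp_all add: X_def Y_def)
  have X_minus [simp]: "X (- z) = - X z" "Y (- z) = - Y z" for z by (simp_all add: X_def Y_def)
  have not_Ints: "z \<notin> \<int>" "z / \<tau> \<notin> \<int>" if "z \<in> P" "z \<noteq> 0" for z
  proof -
    show "z \<notin> \<int>"
    proof
      assume "z \<in> \<int>"
      then obtain n where n: "z = of_int n" by (auto elim: Ints_cases)
      hence "X z = 0" by (simp add: X_def)
      with XY[of z] have "z = of_real (Y z)" by simp
      with n have "Y z = of_int n" by (metis of_real_eq_iff of_real_of_int_eq)
      with that n show False by (auto simp: P_iff abs_less_iff)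
    qed
    show "z / \<tau> \<notin> \<int>"
    proof
      assume "z / \<tau> \<in> \<int>"
      then obtain n where n: "z / \<tau> = of_int n" by (auto elim: Ints_cases)
      hence "Y z = 0" by (simp add: Y_def)
      with XY[of z] have "z / \<tau> = of_real (X z)" by (simp add: field_simps)
      with n have X: "X z = of_int n" by (metis of_real_eq_iff of_real_of_int_eq)
      moreover have "n = 0" using that X by (auto simp: P_iff abs_less_iff)
      ultimately show False using that n by simp
    qed
  qed
  define D where "D = (\<lambda>z. Jfun \<tau>' (z / \<tau>) / \<tau> - Jfun \<tau> z + z / \<tau>)"
  have "open P" unfolding P_def
    by (intro open_Collect_conj open_Collect_less continuous_intros) simp_all
  have "convex P"
  proof -
    have eq: "P = {z. Im z < Im \<tau>} \<inter> {z. Im z > - Im \<tau>} \<inter> {z. Im (z / \<tau>) < Im \<tau>'} \<inter> {z. Im (z / \<tau>) > - Im \<tau>'}"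
      by (auto simp: P_def \<tau>'_def abs_less_iff)
    have "linear (\<lambda>z. Im (z / \<tau>))"
      by (intro linearI) (auto simp: add_divide_distrib scaleR_conv_of_real simp flip: times_divide_eq_right)
    hence "convex ((\<lambda>z. Im (z / \<tau>)) -` {..<Im \<tau>'})" "convex ((\<lambda>z. Im (z / \<tau>)) -` {- Im \<tau>'<..})"
      by (intro convex_linear_vimage convex_real_interval; simp)+
    hence "convex {z. Im (z / \<tau>) < Im \<tau>'}" "convex {z. Im (z / \<tau>) > - Im \<tau>'}"
      by (simp_all add: vimage_def)
    moreover have "convex {z. Im z < Im \<tau>}" "convex {z. Im z > - Im \<tau>}"
      by (simp_all add: convex_halfspace_Im_lt convex_halfspace_Im_gt)
    ultimately show ?thesis unfolding eq by (intro convex_Int)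
  qed
  hence "connected P" by (rule convex_connected)
  have "0 \<in> P" by (simp add: P_iff)
  have D_hol: "D holomorphic_on P - {0}"
  proof -
    have "Jfun \<tau> holomorphic_on P - {0}"
      by (rule holomorphic_on_subset[OF holomorphic_on_Jfun[OF \<tau>]]) (use not_Ints in \<open>auto simp: P_def\<close>)
    moreover have "(\<lambda>z. Jfun \<tau>' (z / \<tau>)) holomorphic_on P - {0}"
      by (rule holomorphic_on_compose_gen[of "\<lambda>z. z / \<tau>" _ "Jfun \<tau>'", OF _ holomorphic_on_Jfun[OF \<tau>'], unfolded o_def])
         (use not_Ints in \<open>auto simp: P_def \<tau>'_def intro!: holomorphic_intros\<close>)
    ultimately show ?thesis unfolding D_def by (intro holomorphic_intros) auto
  qed
  \<comment> \<open>Substituting z/\<tau> in the residue computation absorbs the outer factor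
    1/\<tau>, so the two poles cancel.\<close>
  have D_lim: "((\<lambda>z. (z - 0) * D z) \<longlongrightarrow> 0) (at 0)"
  proof -
    have lam_lim: "((\<lambda>z. lam t (c * z)) \<longlongrightarrow> lam t 0) (at 0)" if "Im t > 0" for t c
    proof -
      have "open {z. Im t + Im z > 0}" by (intro open_Collect_less continuous_intros)
      hence "isCont (lam t) 0"
        using holomorphic_on_imp_continuous_on[OF holomorphic_on_lam[OF that]] that
        by (auto simp: continuous_on_eq_continuous_at)
      moreover have "((\<lambda>z. c * z) \<longlongrightarrow> 0) (at 0)" by (auto intro!: tendsto_eq_intros)
      ultimately show ?thesis by (rule isCont_tendsto_compose)
    qed
    have 1: "((\<lambda>z. (z / \<tau>) * geo (ee (z / \<tau>))) \<longlongrightarrow> - 1 / (2 * complex_of_real pi * \<i>)) (at 0)"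
    proof (rule tendsto_compose_at[OF _ tendsto_times_geo_ee, unfolded o_def])
      show "((\<lambda>z. z / \<tau>) \<longlongrightarrow> 0) (at 0)" by (auto intro!: tendsto_eq_intros)
      show "\<forall>\<^sub>F z in at 0. z / \<tau> = 0 \<longrightarrow> 0 * geo (ee 0) = - 1 / (2 * complex_of_real pi * \<i>)"
        by (auto simp: eventually_at_filter)
    qed
    define R where "R = (\<lambda>z. (1 / 2 + lam \<tau>' ((1 / \<tau>) * z) - lam \<tau>' ((- 1 / \<tau>) * z)) / \<tau> -
                        (1 / 2 + lam \<tau> (1 * z) - lam \<tau> ((- 1) * z)) + z / \<tau>)"
    define r where "r = (1 / 2 + lam \<tau>' 0 - lam \<tau>' 0) / \<tau> - (1 / 2 + lam \<tau> 0 - lam \<tau> 0) + 0 / \<tau>"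
    have R: "(R \<longlongrightarrow> r) (at 0)"
      unfolding R_def r_def by (intro tendsto_intros lam_lim \<tau> \<tau>') auto
    have "((\<lambda>z. (z / \<tau>) * geo (ee (z / \<tau>)) - z * geo (ee z) + z * R z) \<longlongrightarrow>
             - 1 / (2 * complex_of_real pi * \<i>) - - 1 / (2 * complex_of_real pi * \<i>) + 0 * r) (at 0)"
      by (intro tendsto_intros 1 tendsto_times_geo_ee R)
    also have "(\<lambda>z. (z / \<tau>) * geo (ee (z / \<tau>)) - z * geo (ee z) + z * R z) = (\<lambda>z. (z - 0) * D z)"
      by (auto simp: D_def R_def Jfun_def field_simps)
    finally show ?thesis by simp
  qed
  obtain g where g: "g holomorphic_on P" "\<And>z. z \<in> P - {0} \<Longrightarrow> g z = D z"
    using holomorphic_on_extend_lim[OF D_hol, of ] D_lim \<open>open P\<close> \<open>0 \<in> P\<close> interior_open by metis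
  \<comment> \<open>Adding 1 to z translates z/\<tau> by -\<tau>'; the quasi-period costs -1/\<tau>
    and the linear term z/\<tau> repays it.\<close>
  have D_1: "D (z + 1) = D z" if "- 1 < Y z" "Y z < 0" for z
  proof -
    have "Im (z / \<tau> - \<tau>') = - (Y z + 1) * Im \<tau>'" 
    proof -
      have "Im (z / \<tau>) = - Y z * Im \<tau>'" using \<tau>' by (simp add: Y_def)
      thus ?thesis by (simp add: algebra_simps)
    qed
    moreover have "\<dots> < 0" using that \<tau>' by (simp add: mult_neg_pos)
    moreover have "(Y z + 1) * Im \<tau>' < 1 * Im \<tau>'" using that \<tau>' by (intro mult_strict_right_mono) auto
    ultimately have "Jfun \<tau>' ((z / \<tau> - \<tau>') + \<tau>') = Jfun \<tau>' (z / \<tau> - \<tau>') + 1"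
      by (intro Jfun_quasiperiodic \<tau>') (auto simp: algebra_simps)
    hence "Jfun \<tau>' (z / \<tau> - \<tau>') = Jfun \<tau>' (z / \<tau>) - 1" by simp
    moreover have "(z + 1) / \<tau> = z / \<tau> - \<tau>'" by (simp add: \<tau>'_def add_divide_distrib)
    ultimately show ?thesis
      by (simp add: D_def Jfun_periodic diff_divide_distrib add_divide_distrib)
  qed
  \<comment> \<open>Here the quasi-period of \<open>Jfun \<tau>\<close> costs -1 and the linear term
    grows by 1.\<close>
  have D_tau: "D (z + \<tau>) = D z" if "- 1 < X z" "X z < 0" for z
  proof -
    have "Jfun \<tau> (z + \<tau>) = Jfun \<tau> z + 1"
      using that \<tau> by (intro Jfun_quasiperiodic \<tau>) (auto simp: X_def field_simps)
    moreover have "(z + \<tau>) / \<tau> = z / \<tau> + 1" by (simp add: add_divide_distrib)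
    ultimately show ?thesis by (simp add: D_def Jfun_periodic)
  qed
  \<comment> \<open>A shift is made only when |X| > 1/2, and it leaves X nonzero; so the reduction
    never lands on the singularity at 0.\<close>
  have red_X: "\<exists>z'. z' \<noteq> 0 \<and> \<bar>X z'\<bar> \<le> 1/2 \<and> Y z' = Y z \<and> D z' = D z" if "z \<noteq> 0" "z \<in> P" for z
  proof -
    consider "\<bar>X z\<bar> \<le> 1/2" | "X z < - 1/2" | "X z > 1/2" by linarith
    thus ?thesis
    proof cases
      case 2
      hence "X (z + \<tau>) \<noteq> 0" "\<bar>X (z + \<tau>)\<bar> \<le> 1/2" "D (z + \<tau>) = D z"
        using that by (auto simp: P_iff abs_le_iff intro!: D_tau)
      moreover from this(1) have "z + \<tau> \<noteq> 0" using X_0(1) by metis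
      ultimately show ?thesis using X_add Y_add by blast
    next
      case 3
      hence "X (z - \<tau>) \<noteq> 0" "\<bar>X (z - \<tau>)\<bar> \<le> 1/2" "D (z - \<tau>) = D z"
        using that D_tau[of "z - \<tau>"] by (auto simp: P_iff abs_le_iff)
      moreover from this(1) have "z - \<tau> \<noteq> 0" using X_0(1) by metis
      ultimately show ?thesis using X_add Y_add by blast
    qed (use that in auto)
  qed
  have red_Y: "\<exists>z'. z' \<noteq> 0 \<and> \<bar>Y z'\<bar> \<le> 1/2 \<and> X z' = X z \<and> D z' = D z" if "z \<noteq> 0" "z \<in> P" for z
  proof -
    consider "\<bar>Y z\<bar> \<le> 1/2" | "Y z < - 1/2" | "Y z > 1/2" by linarith
    thus ?thesis
    proof cases
      case 2
      hence "Y (z + 1) \<noteq> 0" "\<bar>Y (z + 1)\<bar> \<le> 1/2" "D (z + 1) = D z"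
        using that by (auto simp: P_iff abs_le_iff intro!: D_1)
      moreover from this(1) have "z + 1 \<noteq> 0" using X_0(2) by metis
      ultimately show ?thesis using X_add Y_add by blast
    next
      case 3
      hence "Y (z - 1) \<noteq> 0" "\<bar>Y (z - 1)\<bar> \<le> 1/2" "D (z - 1) = D z"
        using that D_1[of "z - 1"] by (auto simp: P_iff abs_le_iff)
      moreover from this(1) have "z - 1 \<noteq> 0" using X_0(2) by metis
      ultimately show ?thesis using X_add Y_add by blast
    qed (use that in auto)
  qed
  define Q where "Q = (\<lambda>(x, y). of_real x * \<tau> + of_real y) ` ({-1/2..1/2::real} \<times> {-1/2..1/2})"
  have Q_iff: "z \<in> Q" if "\<bar>X z\<bar> \<le> 1/2" "\<bar>Y z\<bar> \<le> 1/2" for z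
    unfolding Q_def by (rule image_eqI[of _ _ "(X z, Y z)"]) (use that XY[of z] in auto)
  have "Q \<subseteq> P"
  proof
    fix z assume "z \<in> Q"
    then obtain x y where xy: "z = of_real x * \<tau> + of_real y" "\<bar>x\<bar> \<le> 1/2" "\<bar>y\<bar> \<le> 1/2"
      by (auto simp: Q_def)
    have "X z = x" using xy(1) \<tau> by (simp add: X_def)
    moreover from this have "Y z = y" using XY[of z] xy(1) by simp
    ultimately show "z \<in> P" using xy by (simp add: P_iff)
  qed
  have red: "\<exists>z'\<in>Q. g z' = g z" if "z \<in> P" for z
  proof (cases "z = 0")
    case True
    thus ?thesis using Q_iff[of 0] by auto
  next
    case False
    from red_X[OF False that] obtain z1 where z1: "z1 \<noteq> 0" "\<bar>X z1\<bar> \<le> 1/2" "Y z1 = Y z" "D z1 = D z" by blast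
    have "z1 \<in> P" using z1 that by (auto simp: P_iff)
    from red_Y[OF z1(1) this] obtain z2 where z2: "z2 \<noteq> 0" "\<bar>Y z2\<bar> \<le> 1/2" "X z2 = X z1" "D z2 = D z1" by blast
    have "z2 \<in> Q" using z1 z2 by (intro Q_iff) auto
    moreover have "g z2 = g z" using z1 z2 \<open>z2 \<in> Q\<close> \<open>Q \<subseteq> P\<close> that False by (subst (1 2) g(2)) auto
    ultimately show ?thesis by blast
  qed
  have "compact Q" unfolding Q_def case_prod_unfold
    by (intro compact_continuous_image continuous_intros compact_Times compact_Icc)
  moreover have "continuous_on Q (\<lambda>z. norm (g z))"
    by (intro continuous_on_norm holomorphic_on_imp_continuous_on holomorphic_on_subset[OF g(1) \<open>Q \<subseteq> P\<close>])
  moreover have "Q \<noteq> {}" using Q_iff[of 0] by auto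
  ultimately obtain \<xi> where \<xi>: "\<xi> \<in> Q" "\<And>z. z \<in> Q \<Longrightarrow> norm (g z) \<le> norm (g \<xi>)"
    using continuous_attains_sup[of Q "\<lambda>z. norm (g z)"] by metis
  have "g constant_on P"
  proof (rule maximum_modulus_principle[OF g(1) \<open>open P\<close> \<open>connected P\<close> \<open>open P\<close> order_refl])
    show "\<xi> \<in> P" using \<xi> \<open>Q \<subseteq> P\<close> by auto
    show "norm (g z) \<le> norm (g \<xi>)" if "z \<in> P" for z
      using red[OF that] \<xi>(2) by metis
  qed
  then obtain c where c: "\<And>z. z \<in> P \<Longrightarrow> g z = c" by (auto simp: constant_on_def)
  have "- z \<in> P" using z by (simp add: P_iff)
  hence "D (- z) = D z" using c[of z] c[of "- z"] g(2)[of z] g(2)[of "- z"] z by auto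
  moreover have "D (- z) = - D z"
  proof -
    have "ee z \<noteq> 1" "ee (z / \<tau>) \<noteq> 1" using not_Ints[OF z] by (auto simp: ee_eq_1_iff)
    hence "Jfun \<tau> (- z) = - Jfun \<tau> z" "Jfun \<tau>' (- z / \<tau>) = - Jfun \<tau>' (z / \<tau>)"
      using Jfun_minus[of z \<tau>] Jfun_minus[of "z / \<tau>" \<tau>'] by auto
    thus ?thesis by (simp add: D_def)
  qed
  ultimately have "D z = 0" by simp
  thus ?thesis by (simp add: D_def \<tau>'_def algebra_simps)
qed

subsection \<open>Finite Fourier transforms and generalized Bernoulli numbers\<close>

definition mod_periodic :: "nat \<Rightarrow> (int \<Rightarrow> 'a) \<Rightarrow> bool" where
  "mod_periodic M \<phi> \<longleftrightarrow> (\<forall>a b. [a = b] (mod int M) \<longrightarrow> \<phi> a = \<phi> b)"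

lemma mod_periodicD: "mod_periodic M \<phi> \<Longrightarrow> [a = b] (mod int M) \<Longrightarrow> \<phi> a = \<phi> b"
  by (simp add: mod_periodic_def)

lemma mod_periodic_dvd: "mod_periodic M \<phi> \<Longrightarrow> M dvd L \<Longrightarrow> mod_periodic L \<phi>"
  unfolding mod_periodic_def by (meson cong_dvd_modulus int_dvd_int_iff)

lemma mod_periodic_uminus: "mod_periodic M \<phi> \<Longrightarrow> mod_periodic M (\<lambda>a. \<phi> (- a))"
  by (simp add: mod_periodic_def cong_minus_minus_iff)

lemma mod_periodic_mult: "mod_periodic M f \<Longrightarrow> mod_periodic M g \<Longrightarrow> mod_periodic M (\<lambda>a. f a * g a)"
  unfolding mod_periodic_def by metis

text \<open>Injectivity modulo M is enough, an injective self-map of a finite set being bijective;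
  the cases used are negation and multiplication by a unit.\<close>

lemma sum_residues_reindex:
  fixes \<phi> :: "int \<Rightarrow> 'a :: comm_monoid_add"
  assumes "mod_periodic M \<phi>" "M > 0"
    and inj: "\<And>a b. [f a = f b] (mod int M) \<Longrightarrow> [a = b] (mod int M)"
  shows "(\<Sum>a<M. \<phi> (f (int a))) = (\<Sum>a<M. \<phi> (int a))"
proof -
  define h where "h = (\<lambda>a. nat (f (int a) mod int M))"
  have h: "int (h a) = f (int a) mod int M" for a
    using assms(2) by (simp add: h_def)
  have "inj_on h {..<M}"
  proof (rule inj_onI)
    fix a b assume ab: "a \<in> {..<M}" "b \<in> {..<M}" "h a = h b"
    hence "[f (int a) = f (int b)] (mod int M)" using h[of a] h[of b] by (simp add: cong_def)
    from inj[OF this] ab show "a = b" by (simp add: cong_def)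
  qed
  moreover have "h ` {..<M} \<subseteq> {..<M}"
    using assms(2) by (auto simp: h_def nat_less_iff)
  ultimately have "bij_betw h {..<M} {..<M}"
    by (simp add: bij_betw_def endo_inj_surj)
  hence "(\<Sum>a<M. \<phi> (int a)) = (\<Sum>a<M. \<phi> (int (h a)))"
    by (rule sum.reindex_bij_betw[symmetric])
  also have "\<dots> = (\<Sum>a<M. \<phi> (f (int a)))"
    by (intro sum.cong refl mod_periodicD[OF assms(1)]) (simp add: h cong_def)
  finally show ?thesis ..
qed

lemma sum_residues_uminus:
  fixes \<phi> :: "int \<Rightarrow> 'a :: comm_monoid_add"
  assumes "mod_periodic M \<phi>" "M > 0"
  shows "(\<Sum>a<M. \<phi> (- int a)) = (\<Sum>a<M. \<phi> (int a))"
  by (rule sum_residues_reindex[OF assms]) (simp add: cong_minus_minus_iff)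

lemma sum_residues_mult:
  fixes \<phi> :: "int \<Rightarrow> 'a :: comm_monoid_add"
  assumes "mod_periodic M \<phi>" "M > 0" "coprime c (int M)"
  shows "(\<Sum>a<M. \<phi> (c * int a)) = (\<Sum>a<M. \<phi> (int a))"
  by (rule sum_residues_reindex[OF assms(1,2)]) (use assms(3) in \<open>simp add: cong_mult_lcancel\<close>)

lemma sum_lessThan_mult:
  fixes f :: "nat \<Rightarrow> 'a :: comm_monoid_add"
  shows "(\<Sum>r<L * M. f r) = (\<Sum>l<L. \<Sum>r<M. f (l * M + r))"
  using sum.nat_group[of f M L] by (simp add: lessThan_atLeast0 add.commute sum.shift_bounds_nat_ivl[of _ 0, simplified])

definition rt :: "nat \<Rightarrow> int \<Rightarrow> complex" where
  "rt M x = ee (of_int x / of_nat M)"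

lemma rt_0 [simp]: "rt M 0 = 1" by (simp add: rt_def)

lemma rt_add: "rt M (x + y) = rt M x * rt M y"
  by (simp add: rt_def add_divide_distrib ee_add)

lemma rt_eq_1_iff: "M > 0 \<Longrightarrow> rt M x = 1 \<longleftrightarrow> int M dvd x"
proof -
  assume "M > 0"
  have "rt M x = 1 \<longleftrightarrow> (\<exists>n. of_int x = (of_int (int M * n) :: complex))"
    using \<open>M > 0\<close> by (auto simp: rt_def ee_eq_1_iff Ints_def field_simps)
  also have "\<dots> \<longleftrightarrow> int M dvd x"
    by (auto simp del: of_int_mult simp: dvd_def)
  finally show ?thesis .
qed

lemma rt_diff: "rt M (x - y) = rt M x / rt M y"
  by (simp add: rt_def diff_divide_distrib ee_diff)

lemma rt_cong: "[x = y] (mod int M) \<Longrightarrow> M > 0 \<Longrightarrow> rt M x = rt M y"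
  using rt_eq_1_iff[of M "x - y"] by (simp add: rt_diff cong_iff_dvd_diff)

lemma mod_periodic_rt: "M > 0 \<Longrightarrow> mod_periodic M (\<lambda>a. rt M (c * a))"
  by (auto simp: mod_periodic_def intro!: rt_cong cong_mult)

lemma rt_power: "rt M x ^ n = rt M (int n * x)"
  by (simp add: rt_def ee_power mult_ac)

lemma rt_mult_cancel: "L > 0 \<Longrightarrow> rt (L * M) (int L * x) = rt M x"
  by (simp add: rt_def)

lemma sum_rt:
  assumes "M > 0"
  shows "(\<Sum>b<M. rt M (x * int b)) = (if int M dvd x then of_nat M else 0)"
proof (cases "int M dvd x")
  case True
  hence "rt M (x * int b) = 1" for b using assms by (subst rt_eq_1_iff) auto
  thus ?thesis using True by simp
next
  case False
  have "rt M (x * int b) = rt M x ^ b" for b by (simp add: rt_power mult.commute)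
  moreover have "rt M x \<noteq> 1" using False assms by (simp add: rt_eq_1_iff)
  moreover have "rt M x ^ M = 1" using assms by (simp add: rt_power rt_eq_1_iff)
  ultimately show ?thesis using False by (simp add: geometric_sum)
qed

text \<open>Positive sign in the exponent and no normalisation, so that the value at 1 for a
  character is its Gauss sum.\<close>

definition dft :: "nat \<Rightarrow> (int \<Rightarrow> complex) \<Rightarrow> int \<Rightarrow> complex" where
  "dft M \<phi> v = (\<Sum>a<M. \<phi> (int a) * rt M (int a * v))"

lemma mod_periodic_dft: "M > 0 \<Longrightarrow> mod_periodic M (dft M \<phi>)"
  unfolding dft_def mod_periodic_def
  by (intro allI impI sum.cong refl arg_cong2[where f = "(*)"] rt_cong cong_mult) auto

lemma dft_inverse:
  assumes "M > 0" "mod_periodic M \<phi>"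
  shows "(\<Sum>b<M. dft M \<phi> (- int b) * rt M (int b * n)) = of_nat M * \<phi> n"
proof -
  have "(\<Sum>b<M. dft M \<phi> (- int b) * rt M (int b * n)) =
          (\<Sum>a<M. \<phi> (int a) * (\<Sum>b<M. rt M ((n - int a) * int b)))"
    unfolding dft_def sum_distrib_left sum_distrib_right
    by (subst sum.swap) (intro sum.cong refl, simp add: rt_add[symmetric] algebra_simps)
  also have "\<dots> = (\<Sum>a<M. if int M dvd n - int a then of_nat M * \<phi> (int a) else 0)"
    using assms(1) by (intro sum.cong refl) (simp add: sum_rt)
  also have "\<dots> = (\<Sum>a<M. if a = nat (n mod int M) then of_nat M * \<phi> n else 0)"
  proof (intro sum.cong refl)
    fix a assume "a \<in> {..<M}"
    hence "int M dvd n - int a \<longleftrightarrow> a = nat (n mod int M)"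
      using assms(1) by (auto simp: mod_eq_dvd_iff[symmetric] nat_eq_iff)
    moreover have "\<phi> (int a) = \<phi> n" if "int M dvd n - int a"
      using that by (intro mod_periodicD[OF assms(2)]) (simp add: cong_iff_dvd_diff dvd_diff_commute)
    ultimately show "(if int M dvd n - int a then of_nat M * \<phi> (int a) else 0) =
                     (if a = nat (n mod int M) then of_nat M * \<phi> n else 0)" by auto
  qed
  also have "\<dots> = of_nat M * \<phi> n"
    using assms(1) by (simp add: sum.delta nat_less_iff)
  finally show ?thesis .
qed

section \<open>Generalized Bernoulli numbers through their generating series\<close>

text \<open>The denominator of the Bernoulli series has a simple zero, which the factor
  \<open>fps_X\<close> of the numerator cancels; hence the division is exact.\<close>

lemma subdegree_fps_exp_minus_1:
  assumes "M > 0"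
  shows "subdegree (fps_exp (of_nat M :: complex) - 1) = 1"
  using assms by (intro subdegreeI) auto

lemma fps_exp_minus_1_nonzero: "M > 0 \<Longrightarrow> fps_exp (of_nat M :: complex) - 1 \<noteq> 0"
  using subdegree_fps_exp_minus_1[of M] by force

definition bernoulli_fps :: "nat \<Rightarrow> (int \<Rightarrow> complex) \<Rightarrow> complex fps" where
  "bernoulli_fps M \<phi> =
     fps_X * (\<Sum>r<M. fps_const (\<phi> (int r)) * fps_exp (of_nat r)) / (fps_exp (of_nat M) - 1)"

lemma gen_bernoulli_conv_fps: "gen_bernoulli k M \<phi> = fact k * fps_nth (bernoulli_fps M \<phi>) k"
  by (simp add: gen_bernoulli_def bernoulli_fps_def)

lemma bernoulli_fps_mult:
  assumes "M > 0"
  shows "bernoulli_fps M \<phi> * (fps_exp (of_nat M) - 1) =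
           fps_X * (\<Sum>r<M. fps_const (\<phi> (int r)) * fps_exp (of_nat r))"
proof -
  let ?S = "\<Sum>r<M. fps_const (\<phi> (int r)) * fps_exp (of_nat r)"
  have "fps_exp (of_nat M) - 1 dvd fps_X * ?S"
  proof (cases "?S = 0")
    case False
    hence "fps_X * ?S \<noteq> 0" by simp
    moreover have "subdegree (fps_exp (of_nat M :: complex) - 1) \<le> subdegree (fps_X * ?S)"
      using False by (simp only: subdegree_fps_exp_minus_1[OF assms]) simp
    ultimately show ?thesis
      using fps_dvd_iff fps_exp_minus_1_nonzero[OF assms] by blast
  qed auto
  thus ?thesis unfolding bernoulli_fps_def by (rule dvd_div_mult_self)
qed

text \<open>Power series over a field have no zero divisors, so identities between Bernoulli series
  can be checked after clearing the denominator.\<close>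

lemma bernoulli_fps_unique:
  assumes "M > 0"
    and "F * (fps_exp (of_nat M) - 1) = fps_X * (\<Sum>r<M. fps_const (\<phi> (int r)) * fps_exp (of_nat r))"
  shows "bernoulli_fps M \<phi> = F"
  using bernoulli_fps_mult[OF assms(1), of \<phi>] assms(2) fps_exp_minus_1_nonzero[OF assms(1)]
  by (metis mult_right_cancel)

lemma gen_bernoulli_cmult:
  assumes "M > 0"
  shows "gen_bernoulli k M (\<lambda>v. c * \<phi> v) = c * gen_bernoulli k M \<phi>"
proof -
  have "bernoulli_fps M (\<lambda>v. c * \<phi> v) = fps_const c * bernoulli_fps M \<phi>"
    using assms by (intro bernoulli_fps_unique)
      (simp_all add: mult.assoc bernoulli_fps_mult sum_distrib_left fps_const_mult[symmetric] mult.left_commute del: fps_const_mult)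
  thus ?thesis by (simp add: gen_bernoulli_conv_fps)
qed

lemma gen_bernoulli_diff:
  assumes "M > 0"
  shows "gen_bernoulli k M (\<lambda>v. \<phi> v - \<psi> v) = gen_bernoulli k M \<phi> - gen_bernoulli k M \<psi>"
proof -
  have "bernoulli_fps M (\<lambda>v. \<phi> v - \<psi> v) = bernoulli_fps M \<phi> - bernoulli_fps M \<psi>"
  proof (rule bernoulli_fps_unique[OF assms])
    show "(bernoulli_fps M \<phi> - bernoulli_fps M \<psi>) * (fps_exp (of_nat M) - 1) =
            fps_X * (\<Sum>r<M. fps_const (\<phi> (int r) - \<psi> (int r)) * fps_exp (of_nat r))"
      unfolding left_diff_distrib[of "bernoulli_fps M \<phi>"] bernoulli_fps_mult[OF assms]
      by (simp add: right_diff_distrib[symmetric] sum_subtractf[symmetric] left_diff_distrib[symmetric])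
  qed
  thus ?thesis by (simp add: gen_bernoulli_conv_fps right_diff_distrib)
qed

lemma gen_bernoulli_cnj:
  assumes "M > 0"
  shows "gen_bernoulli k M (\<lambda>v. cnj (\<phi> v)) = cnj (gen_bernoulli k M \<phi>)"
proof -
  \<comment> \<open>Coefficientwise conjugation is a ring homomorphism and fixes
    \<open>fps_exp\<close> at natural numbers.\<close>
  define C where "C = (\<lambda>F. Abs_fps (\<lambda>n. cnj (fps_nth F n)))"
  have C_mult: "C (F * G) = C F * C G" for F G
    by (simp add: C_def fps_eq_iff fps_mult_nth)
  have C_exp: "C (fps_exp (of_nat r)) = fps_exp (of_nat r)" for r
    by (simp add: C_def fps_eq_iff)
  have C_sum: "C (\<Sum>r\<in>A. f r) = (\<Sum>r\<in>A. C (f r))" for A :: "nat set" and f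
    by (simp add: C_def fps_eq_iff fps_sum_nth)
  have [simp]: "C fps_X = fps_X" "C (F - 1) = C F - 1" "C (fps_const c) = fps_const (cnj c)" for F c
    by (simp_all add: C_def fps_eq_iff fps_X_def)
  have "C (bernoulli_fps M \<phi> * (fps_exp (of_nat M) - 1)) =
          C (fps_X * (\<Sum>r<M. fps_const (\<phi> (int r)) * fps_exp (of_nat r)))"
    by (simp add: bernoulli_fps_mult[OF assms])
  hence "bernoulli_fps M (\<lambda>v. cnj (\<phi> v)) = C (bernoulli_fps M \<phi>)"
    by (intro bernoulli_fps_unique assms) (simp add: C_mult C_exp C_sum)
  thus ?thesis by (simp add: gen_bernoulli_conv_fps C_def)
qed

text \<open>Passing from M to L M multiplies numerator and denominator by the same geometric sum in
  exp (M t).\<close>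

lemma gen_bernoulli_period:
  assumes "M > 0" "L > 0" "mod_periodic M \<phi>"
  shows "gen_bernoulli k (L * M) \<phi> = gen_bernoulli k M \<phi>"
proof -
  let ?S = "\<Sum>r<M. fps_const (\<phi> (int r)) * fps_exp (of_nat r)"
  let ?E = "fps_exp (of_nat M) :: complex fps"
  have "(\<Sum>r<L * M. fps_const (\<phi> (int r)) * fps_exp (of_nat r)) =
          (\<Sum>l<L. \<Sum>r<M. fps_const (\<phi> (int (l * M + r))) * fps_exp (of_nat (l * M + r)))"
    by (rule sum_lessThan_mult)
  also have "\<dots> = (\<Sum>l<L. \<Sum>r<M. fps_const (\<phi> (int r)) * fps_exp (of_nat r) * ?E ^ l)"
  proof (intro sum.cong refl)
    fix l r
    have "\<phi> (int (l * M + r)) = \<phi> (int r)"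
      by (rule mod_periodicD[OF assms(3)]) (simp add: cong_def)
    thus "fps_const (\<phi> (int (l * M + r))) * fps_exp (of_nat (l * M + r)) =
            fps_const (\<phi> (int r)) * fps_exp (of_nat r) * ?E ^ l"
      by (simp add: fps_exp_add_mult fps_exp_power_mult mult_ac)
  qed
  also have "\<dots> = ?S * (\<Sum>l<L. ?E ^ l)"
    by (simp only: sum_distrib_left sum_distrib_right)
  finally have S: "(\<Sum>r<L * M. fps_const (\<phi> (int r)) * fps_exp (of_nat r)) = ?S * (\<Sum>l<L. ?E ^ l)" .
  have E: "fps_exp (of_nat (L * M)) - 1 = (?E - 1) * (\<Sum>l<L. ?E ^ l)"
    by (subst power_diff_1_eq[symmetric]) (simp add: fps_exp_power_mult)
  have "bernoulli_fps (L * M) \<phi> = bernoulli_fps M \<phi>"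
  proof (rule bernoulli_fps_unique)
    show "bernoulli_fps M \<phi> * (fps_exp (of_nat (L * M)) - 1) =
            fps_X * (\<Sum>r<L * M. fps_const (\<phi> (int r)) * fps_exp (of_nat r))"
      unfolding S E using bernoulli_fps_mult[OF assms(1), of \<phi>] by (simp add: mult.assoc[symmetric])
  qed (use assms in auto)
  thus ?thesis by (simp add: gen_bernoulli_conv_fps)
qed

text \<open>For a function supported on the multiples of L the generating series is that of \<psi>
  at L t; the weight L in front supplies the scaling of \<open>fps_X\<close>.\<close>

lemma gen_bernoulli_scale:
  assumes "M > 0" "L > 0"
  shows "gen_bernoulli k (L * M) (\<lambda>v. of_nat L * (if int L dvd v then \<psi> (v div int L) else 0)) =
           of_nat L ^ k * gen_bernoulli k M \<psi>"
proof -
  define c where "c = (fps_const (of_nat L) * fps_X :: complex fps)"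
  have [simp]: "fps_nth c 0 = 0" by (simp add: c_def)
  have exp_c: "fps_compose (fps_exp (of_nat r)) c = fps_exp (of_nat (L * r))" for r :: nat
    by (simp add: c_def fps_eq_iff fps_compose_linear power_mult_distrib)
  let ?\<phi> = "\<lambda>v. of_nat L * (if int L dvd v then \<psi> (v div int L) else 0)"
  have "(\<Sum>r<M * L. fps_const (?\<phi> (int r)) * fps_exp (of_nat r)) =
          (\<Sum>l<M. \<Sum>r<L. fps_const (?\<phi> (int (l * L + r))) * fps_exp (of_nat (l * L + r)))"
    by (rule sum_lessThan_mult)
  also have "\<dots> = (\<Sum>l<M. \<Sum>r<L. if r = 0 then fps_const (of_nat L * \<psi> (int l)) * fps_exp (of_nat (L * l)) else 0)"
  proof (intro sum.cong refl)
    fix l r assume "r \<in> {..<L}"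
    hence "int L dvd int (l * L + r) \<longleftrightarrow> r = 0" by (auto simp: dvd_add_right_iff zdvd_not_zless simp flip: of_nat_add of_nat_mult dest: nat_dvd_not_less)
    thus "fps_const (?\<phi> (int (l * L + r))) * fps_exp (of_nat (l * L + r)) =
           (if r = 0 then fps_const (of_nat L * \<psi> (int l)) * fps_exp (of_nat (L * l)) else 0)"
      using assms by (auto simp: mult_ac)
  qed
  also have "\<dots> = (\<Sum>l<M. fps_const (of_nat L * \<psi> (int l)) * fps_exp (of_nat (L * l)))"
    using assms by (simp add: sum.delta)
  finally have S: "(\<Sum>r<L * M. fps_const (?\<phi> (int r)) * fps_exp (of_nat r)) =
     (\<Sum>l<M. fps_const (of_nat L * \<psi> (int l)) * fps_exp (of_nat (L * l)))" by (simp only: mult.commute[of L M])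
  have "bernoulli_fps (L * M) ?\<phi> = fps_compose (bernoulli_fps M \<psi>) c"
  proof (rule bernoulli_fps_unique)
    have "fps_compose (bernoulli_fps M \<psi> * (fps_exp (of_nat M) - 1)) c =
            fps_compose (fps_X * (\<Sum>r<M. fps_const (\<psi> (int r)) * fps_exp (of_nat r))) c"
      using bernoulli_fps_mult[OF assms(1)] by simp
    hence "fps_compose (bernoulli_fps M \<psi>) c * (fps_exp (of_nat (L * M)) - 1) =
             c * (\<Sum>r<M. fps_const (\<psi> (int r)) * fps_exp (of_nat (L * r)))"
      by (simp only: fps_compose_mult_distrib[OF \<open>fps_nth c 0 = 0\<close>] fps_compose_sub_distrib
            fps_compose_sum_distrib fps_const_compose fps_X_fps_compose_startby0[OF \<open>fps_nth c 0 = 0\<close>] exp_c fps_compose_1)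
    also have "\<dots> = fps_X * (\<Sum>l<M. fps_const (of_nat L * \<psi> (int l)) * fps_exp (of_nat (L * l)))"
      by (simp add: c_def sum_distrib_left fps_const_mult[symmetric] mult_ac del: fps_const_mult)
    finally show "fps_compose (bernoulli_fps M \<psi>) c * (fps_exp (of_nat (L * M)) - 1) =
            fps_X * (\<Sum>r<L * M. fps_const (?\<phi> (int r)) * fps_exp (of_nat r))"
      by (simp only: S)
  qed (use assms in auto)
  thus ?thesis by (simp add: gen_bernoulli_conv_fps c_def fps_compose_linear)
qed

text \<open>The weight 1 constants of the torsion sums appear in this explicit form.\<close>

lemma gen_bernoulli_1:
  assumes "M > 0"
  shows "gen_bernoulli 1 M \<phi> = (\<Sum>r<M. \<phi> (int r) * (of_nat r / of_nat M - 1 / 2))"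
proof -
  let ?S = "\<Sum>r<M. fps_const (\<phi> (int r)) * fps_exp (of_nat r)"
  define b where "b = fps_nth (bernoulli_fps M \<phi>)"
  have *: "fps_nth (bernoulli_fps M \<phi> * (fps_exp (of_nat M) - 1)) n = fps_nth (fps_X * ?S) n" for n
    by (simp add: bernoulli_fps_mult[OF assms])
  have S: "fps_nth ?S 0 = (\<Sum>r<M. \<phi> (int r))" "fps_nth ?S 1 = (\<Sum>r<M. \<phi> (int r) * of_nat r)"
    by (simp_all add: fps_sum_nth)
  have 1: "b 0 * of_nat M = (\<Sum>r<M. \<phi> (int r))"
    using *[of 1] S by (simp add: fps_mult_nth b_def)
  have 2: "b 0 * (of_nat M ^ 2 / 2) + b 1 * of_nat M = (\<Sum>r<M. \<phi> (int r) * of_nat r)"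
    using *[of 2] S by (simp add: fps_mult_nth b_def numeral_2_eq_2 atLeast0_atMost_Suc add.commute)
  have "b 1 * of_nat M = (\<Sum>r<M. \<phi> (int r) * of_nat r) - (b 0 * of_nat M) * (of_nat M / 2)"
    using 2 by (simp add: power2_eq_square algebra_simps)
  also have "\<dots> = (\<Sum>r<M. \<phi> (int r) * (of_nat r - of_nat M / 2))"
    unfolding 1 by (simp add: sum_distrib_right sum_subtractf right_diff_distrib)
  finally have "b 1 = (\<Sum>r<M. \<phi> (int r) * (of_nat r - of_nat M / 2)) / of_nat M"
    using assms by (simp add: field_simps)
  also have "\<dots> = (\<Sum>r<M. \<phi> (int r) * (of_nat r / of_nat M - 1 / 2))"
    using assms unfolding sum_divide_distrib by (intro sum.cong refl) (simp add: field_simps)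
  finally show ?thesis by (simp add: gen_bernoulli_conv_fps b_def)
qed

lemma bernoulli_has_fps_expansion:
  assumes "M > 0"
  shows "\<exists>c. (\<lambda>t. if t = 0 then c else t * (\<Sum>r<M. \<phi> (int r) * exp (of_nat r * t)) / (exp (of_nat M * t) - 1))
               has_fps_expansion bernoulli_fps M \<phi>"
\<comment> \<open>The zero series has subdegree 0 by convention, so the comparison of subdegrees
  required for the quotient fails when the numerator vanishes; that case is treated apart.\<close>
proof (cases "(\<Sum>r<M. fps_const (\<phi> (int r)) * fps_exp (of_nat r)) = 0")
  let ?S = "\<Sum>r<M. fps_const (\<phi> (int r)) * fps_exp (of_nat r)"
  have S: "(\<lambda>t. (\<Sum>r<M. \<phi> (int r) * exp (of_nat r * t))) has_fps_expansion ?S"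
    by (intro fps_expansion_intros)
  have E: "(\<lambda>t::complex. exp (of_nat M * t) - 1) has_fps_expansion fps_exp (of_nat M) - 1"
    by (intro fps_expansion_intros)
  {
    case False
    have "(\<lambda>t. if t = 0 then fps_nth (fps_X * ?S) (subdegree (fps_exp (of_nat M) - 1 :: complex fps)) /
                fps_nth (fps_exp (of_nat M) - 1) (subdegree (fps_exp (of_nat M) - 1 :: complex fps))
              else t * (\<Sum>r<M. \<phi> (int r) * exp (of_nat r * t)) / (exp (of_nat M * t) - 1))
            has_fps_expansion bernoulli_fps M \<phi>"
      unfolding bernoulli_fps_def
    proof (rule has_fps_expansion_divide)
      show "(\<lambda>t. t * (\<Sum>r<M. \<phi> (int r) * exp (of_nat r * t))) has_fps_expansion fps_X * ?S"
        by (intro fps_expansion_intros S)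
      show "subdegree (fps_exp (of_nat M :: complex) - 1) \<le> subdegree (fps_X * ?S)"
        using False by (simp only: subdegree_fps_exp_minus_1[OF assms]) simp
    qed (use E fps_exp_minus_1_nonzero[OF assms] in auto)
    thus ?thesis by blast
  next
    case True
    hence B: "bernoulli_fps M \<phi> = 0" by (simp only: bernoulli_fps_def) simp
    have "eventually (\<lambda>t. (\<Sum>r<M. \<phi> (int r) * exp (of_nat r * t)) = 0) (nhds 0)"
      using S unfolding True has_fps_expansion_0_iff .
    hence "eventually (\<lambda>t. (if t = 0 then 0 else t * (\<Sum>r<M. \<phi> (int r) * exp (of_nat r * t)) / (exp (of_nat M * t) - 1)) = 0) (nhds 0)"
      by eventually_elim auto
    thus ?thesis unfolding B has_fps_expansion_0_iff[symmetric] by blast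
  }
qed

subsection \<open>Inversion of Eisenstein series with doubly periodic coefficients\<close>

text \<open>Each exponential is expanded and the sums are exchanged. The hypothesis is absolute
  convergence of the double series at |t| = r, hence for all smaller t.\<close>

lemma exp_sum_has_fps_expansion:
  fixes A l :: "'i \<Rightarrow> complex"
  assumes r: "r > 0" and summ: "(\<lambda>i. norm (A i) * exp (norm (l i) * r)) summable_on I"
  shows "(\<lambda>t. \<Sum>\<^sub>\<infinity>i\<in>I. A i * exp (l i * t)) has_fps_expansion
           Abs_fps (\<lambda>j. (\<Sum>\<^sub>\<infinity>i\<in>I. A i * l i ^ j) / fact j)"
proof (rule has_fps_expansionI)
  have "(\<lambda>j. fps_nth (Abs_fps (\<lambda>j. (\<Sum>\<^sub>\<infinity>i\<in>I. A i * l i ^ j) / fact j)) j * t ^ j) sums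
          (\<Sum>\<^sub>\<infinity>i\<in>I. A i * exp (l i * t))" if t: "norm t < r" for t
  proof -
    define f where "f = (\<lambda>(i, j). A i * ((l i * t) ^ j / fact j))"
    \<comment> \<open>Wanted over the reals for the norms and over the complex numbers for the
      terms.\<close>
    have exp_has_sum: "((\<lambda>j. x ^ j / fact j) has_sum exp x) UNIV"
      if "x = x" for x :: "'b :: {real_normed_field, banach}"
    proof (rule norm_summable_imp_has_sum)
      show "summable (\<lambda>j. norm (x ^ j / fact j))"
        using summable_norm_exp[of x] by (simp add: scaleR_conv_of_real divide_inverse mult.commute)
      show "(\<lambda>j. x ^ j / fact j) sums exp x"
        using exp_converges[of x] by (simp add: scaleR_conv_of_real divide_inverse mult.commute)
    qed
    have norm_f: "((\<lambda>j. norm (f (i, j))) has_sum (norm (A i) * exp (norm (l i * t)))) UNIV" for i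
      using has_sum_cmult_right[OF exp_has_sum[OF refl, of "norm (l i * t)"], of "norm (A i)"]
      by (simp add: f_def norm_mult norm_divide norm_power)
    have "(\<lambda>i. norm (A i) * exp (norm (l i * t))) summable_on I"
      by (rule summable_on_comparison_test[OF summ])
         (use t in \<open>auto simp: norm_mult intro!: mult_left_mono\<close>)
    hence "(\<lambda>x. norm (f x)) summable_on (I \<times> UNIV)"
      by (intro summable_on_SigmaI[where g = "\<lambda>i. norm (A i) * exp (norm (l i * t))"] norm_f) auto
    hence f: "f summable_on (I \<times> UNIV)" by (rule abs_summable_summable)
    then obtain S where S: "(f has_sum S) (I \<times> UNIV)" by (auto simp: summable_on_def)
    have "((\<lambda>i. A i * exp (l i * t)) has_sum S) I"
      by (rule has_sum_SigmaD[OF S]) (unfold f_def prod.case, intro has_sum_cmult_right exp_has_sum refl)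
    hence S_eq: "(\<Sum>\<^sub>\<infinity>i\<in>I. A i * exp (l i * t)) = S" by (rule infsumI)
    have S': "((\<lambda>(j, i). f (i, j)) has_sum S) (UNIV \<times> I)"
      using S by (subst (asm) has_sum_swap)
    have "((\<lambda>j. \<Sum>\<^sub>\<infinity>i\<in>I. f (i, j)) has_sum S) UNIV"
    proof (rule has_sum_SigmaD[OF S'])
      fix j :: nat
      have "(\<lambda>i. f (i, j)) summable_on I"
        using summable_on_SigmaD1[of "\<lambda>j i. f (i, j)" UNIV "\<lambda>_. I" j] S' by (auto simp: summable_on_def)
      thus "((\<lambda>i. (\<lambda>(j, i). f (i, j)) (j, i)) has_sum (\<Sum>\<^sub>\<infinity>i\<in>I. f (i, j))) I" by simp
    qed
    moreover have "(\<Sum>\<^sub>\<infinity>i\<in>I. f (i, j)) = (\<Sum>\<^sub>\<infinity>i\<in>I. A i * l i ^ j) / fact j * t ^ j" for j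
    proof -
      have "(\<Sum>\<^sub>\<infinity>i\<in>I. f (i, j)) = (\<Sum>\<^sub>\<infinity>i\<in>I. (A i * l i ^ j) * (t ^ j / fact j))"
        by (simp add: f_def power_mult_distrib mult_ac)
      thus ?thesis by (subst (asm) infsum_cmult_left') simp
    qed
    ultimately show ?thesis unfolding S_eq by (intro has_sum_imp_sums) simp
  qed
  moreover have "eventually (\<lambda>t::complex. norm t < r) (nhds 0)"
    using eventually_nhds_ball[OF r, of "0 :: complex"] by (simp add: dist_norm)
  ultimately show "eventually (\<lambda>t. (\<lambda>j. fps_nth (Abs_fps (\<lambda>j. (\<Sum>\<^sub>\<infinity>i\<in>I. A i * l i ^ j) / fact j)) j * t ^ j) sums
          (\<Sum>\<^sub>\<infinity>i\<in>I. A i * exp (l i * t))) (nhds 0)"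
    by (elim eventually_mono) blast
qed

text \<open>Summing over n first leaves q^m / (1 - q^m), which is at most q^m / (1 - q).\<close>

lemma summable_on_power_mult:
  assumes "0 \<le> q" "q < (1::real)"
  shows "(\<lambda>(m, n). q ^ (m * n)) summable_on ({1..} \<times> {1::nat..})"
proof (rule summable_on_SigmaI)
  fix m :: nat assume m: "m \<in> {1..}"
  have "q ^ m \<le> q" using assms m power_decreasing[of 1 m q] by simp
  hence "q ^ m < 1" using assms by linarith
  hence "((\<lambda>n. (q ^ m) ^ n) has_sum (q ^ m / (1 - q ^ m))) {1..}"
    using assms by (intro has_sum_geometric_from_1) simp
  thus "((\<lambda>n. (\<lambda>(m, n). q ^ (m * n)) (m, n)) has_sum (q ^ m / (1 - q ^ m))) {1..}"
    by (simp add: power_mult)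
next
  have "(\<lambda>m. q ^ m * (1 / (1 - q))) summable_on {1::nat..}"
    using has_sum_geometric_from_1[of q] assms
    by (intro summable_on_cmult_left) (auto simp: summable_on_def)
  thus "(\<lambda>m. q ^ m / (1 - q ^ m)) summable_on {1::nat..}"
  proof (rule summable_on_comparison_test)
    fix m :: nat assume m: "m \<in> {1..}"
    have q: "q ^ m \<le> q" using assms m power_decreasing[of 1 m q] by simp
    thus "q ^ m / (1 - q ^ m) \<le> q ^ m * (1 / (1 - q))"
      using assms by (auto intro!: divide_left_mono mult_pos_pos)
    show "0 \<le> q ^ m / (1 - q ^ m)" using assms q by auto
  qed
qed (use assms in auto)

text \<open>The first argument will carry the weight n^(k-1), the second is its cofactor; their
  periods are kept apart because inversion exchanges them.\<close>

definition biperiodic :: "nat \<Rightarrow> nat \<Rightarrow> (int \<Rightarrow> int \<Rightarrow> 'a) \<Rightarrow> bool" where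
  "biperiodic M1 M2 \<Phi> \<longleftrightarrow> (\<forall>m. mod_periodic M1 (\<lambda>n. \<Phi> n m)) \<and> (\<forall>n. mod_periodic M2 (\<Phi> n))"

lemma biperiodicD1: "biperiodic M1 M2 \<Phi> \<Longrightarrow> mod_periodic M1 (\<lambda>n. \<Phi> n m)"
  and biperiodicD2: "biperiodic M1 M2 \<Phi> \<Longrightarrow> mod_periodic M2 (\<Phi> n)"
  by (simp_all add: biperiodic_def)

lemma biperiodic_bounded:
  fixes \<Phi> :: "int \<Rightarrow> int \<Rightarrow> complex"
  assumes "biperiodic M1 M2 \<Phi>" "M1 > 0" "M2 > 0"
  obtains B where "B > 0" "\<And>n m. norm (\<Phi> n m) \<le> B"
proof
  define S where "S = (\<Sum>(a, b)\<in>{..<M1} \<times> {..<M2}. norm (\<Phi> (int a) (int b)))"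
  have "S \<ge> 0" unfolding S_def by (intro sum_nonneg) auto
  thus "S + 1 > 0" by simp
  fix n m
  define a b where "a = nat (n mod int M1)" and "b = nat (m mod int M2)"
  have "\<Phi> n m = \<Phi> (int a) m"
    by (rule mod_periodicD[OF biperiodicD1[OF assms(1)]]) (use assms in \<open>simp add: a_def cong_def\<close>)
  also have "\<dots> = \<Phi> (int a) (int b)"
    by (rule mod_periodicD[OF biperiodicD2[OF assms(1)]]) (use assms in \<open>simp add: b_def cong_def\<close>)
  also have "norm \<dots> \<le> S"
  proof -
    have "(a, b) \<in> {..<M1} \<times> {..<M2}" using assms by (auto simp: a_def b_def nat_less_iff)
    thus ?thesis unfolding S_def
      using member_le_sum[of "(a, b)" "{..<M1} \<times> {..<M2}" "\<lambda>(a, b). norm (\<Phi> (int a) (int b))"] by auto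
  qed
  finally show "norm (\<Phi> n m) \<le> S + 1" by simp
qed

text \<open>Because n \<le> m n, the extra growth exp (n r) can be moved into the base of q^(m n);
  this room is what the Taylor expansion in z uses.\<close>

lemma double_series_summable:
  fixes \<Phi> :: "int \<Rightarrow> int \<Rightarrow> complex"
  assumes "Im \<tau> > 0" "M > 0" and B: "B > 0" "\<And>n m. norm (\<Phi> n m) \<le> B"
    and r: "r < 2 * pi * Im \<tau> / of_nat M" "r \<ge> 0"
  shows "(\<lambda>(m, n). norm (\<Phi> (int n) (int m) * ee (of_nat (m * n) * \<tau> / of_nat M)) * exp (of_nat n * r))
           summable_on ({1..} \<times> {1..})"
proof -
  define Q where "Q = exp (- 2 * pi * Im \<tau> / of_nat M)"
  define q where "q = Q * exp r"
  have q: "q = exp (r - 2 * pi * Im \<tau> / of_nat M)" by (simp add: q_def Q_def exp_add[symmetric])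
  have q01: "0 \<le> q" "q < 1" unfolding q using r by auto
  have "(\<lambda>mn. B * (\<lambda>(m, n). q ^ (m * n)) mn) summable_on ({1..} \<times> {1..})"
    by (intro summable_on_cmult_right summable_on_power_mult q01)
  thus ?thesis
  proof (rule summable_on_comparison_test)
    fix mn :: "nat \<times> nat" assume "mn \<in> {1..} \<times> {1..}"
    then obtain m n where mn: "mn = (m, n)" "m \<ge> 1" "n \<ge> 1" by auto
    have "norm (ee (of_nat (m * n) * \<tau> / of_nat M)) = Q ^ (m * n)"
      by (simp add: norm_ee Q_def exp_of_nat_mult[symmetric] Im_divide_of_nat[symmetric])
    moreover have "exp (of_nat n * r) \<le> exp r ^ (m * n)"
    proof -
      have "real n * r \<le> real (m * n) * r"
        using mn r by (intro mult_right_mono) auto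
      thus ?thesis by (simp add: exp_of_nat_mult[symmetric])
    qed
    ultimately have "norm (\<Phi> (int n) (int m) * ee (of_nat (m * n) * \<tau> / of_nat M)) * exp (of_nat n * r)
       \<le> (B * Q ^ (m * n)) * exp r ^ (m * n)"
      using B Q_def unfolding norm_mult by (intro mult_mono) auto
    thus "(case mn of (m, n) \<Rightarrow> norm (\<Phi> (int n) (int m) * ee (of_nat (m * n) * \<tau> / of_nat M)) * exp (of_nat n * r))
       \<le> B * (\<lambda>(m, n). q ^ (m * n)) mn"
      by (simp add: mn q_def power_mult_distrib mult_ac)
  qed (auto)
qed

text \<open>The m in question are (k + 1) M - a, so m \<tau> / M = (k + 1) \<tau> - a \<tau> / M: a
  residue class modulo M is a \<open>lam\<close> series at a torsion translate.\<close>

lemma lam_has_sum: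
  assumes "Im \<tau> > 0" "M > 0" "a < M" and y: "Im y > - Im \<tau> / of_nat M"
  shows "((\<lambda>m. geo (ee (of_nat m * \<tau> / of_nat M + y))) has_sum lam \<tau> (y - of_nat a * \<tau> / of_nat M))
           {m. 1 \<le> m \<and> M dvd m + a}"
proof -
  let ?z = "y - of_nat a * \<tau> / of_nat M"
  have "Im \<tau> + Im ?z > 0"
  proof -
    have "real a \<le> real M - 1" using assms(3) by linarith
    hence "real a * Im \<tau> / of_nat M \<le> (real M - 1) * Im \<tau> / of_nat M"
      using assms by (intro divide_right_mono mult_right_mono) auto
    also have "\<dots> = Im \<tau> - Im \<tau> / of_nat M" using assms(2) by (simp add: field_simps)
    finally have "real a * Im \<tau> / of_nat M \<le> Im \<tau> - Im \<tau> / of_nat M" .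
    moreover have "Im ?z = Im y - real a * Im \<tau> / of_nat M" by simp
    ultimately show ?thesis using y by linarith
  qed
  note summ = summable_norm_lam[OF assms(1) this]
  have "((\<lambda>k. geo (ee (of_nat (Suc k) * \<tau> + ?z))) has_sum lam \<tau> ?z) UNIV"
    unfolding lam_def by (rule norm_summable_imp_has_sum[OF summ summable_sums[OF summable_norm_cancel[OF summ]]])
  also have "?this \<longleftrightarrow> ?thesis"
  proof (rule has_sum_reindex_bij_witness[of _ "\<lambda>m. (m + a) div M - 1" "\<lambda>k. Suc k * M - a"])
    fix k :: nat
    have le: "a \<le> Suc k * M" "a < Suc k * M" using assms(3) by auto
    thus "(Suc k * M - a + a) div M - 1 = k" using assms(2) by simp
    show "Suc k * M - a \<in> {m. 1 \<le> m \<and> M dvd m + a}" using le by auto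
    have "of_nat (Suc k * M - a) = (of_nat (Suc k) * of_nat M - of_nat a :: complex)"
      by (simp only: of_nat_diff[OF le(1)] of_nat_mult)
    hence "of_nat (Suc k * M - a) * \<tau> / of_nat M + y = of_nat (Suc k) * \<tau> + ?z"
      using assms(2) by (simp add: left_diff_distrib diff_divide_distrib del: of_nat_Suc)
    thus "geo (ee (of_nat (Suc k * M - a) * \<tau> / of_nat M + y)) = geo (ee (of_nat (Suc k) * \<tau> + ?z))"
      by (simp only:)
  next
    fix m assume m: "m \<in> {m. 1 \<le> m \<and> M dvd m + a}"
    hence "M \<le> m + a" by (intro dvd_imp_le) auto
    hence "(m + a) div M > 0" using assms(2) by (simp add: div_greater_zero_iff)
    thus "Suc ((m + a) div M - 1) * M - a = m" using m by simp
  qed auto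
  finally show ?thesis .
qed

lemma lam_has_sum_residues:
  assumes "Im \<tau> > 0" "M > 0" and \<psi>: "mod_periodic M \<psi>" and y: "Im y > - Im \<tau> / of_nat M"
  shows "((\<lambda>m. \<psi> (int m) * geo (ee (of_nat m * \<tau> / of_nat M + y))) has_sum
            (\<Sum>a<M. \<psi> (- int a) * lam \<tau> (y - of_nat a * \<tau> / of_nat M))) {1..}"
proof -
  define B where "B = (\<lambda>a. {m. 1 \<le> m \<and> M dvd m + a})"
  have "((\<lambda>m. \<psi> (int m) * geo (ee (of_nat m * \<tau> / of_nat M + y))) has_sum
            (\<Sum>a<M. \<psi> (- int a) * lam \<tau> (y - of_nat a * \<tau> / of_nat M))) (\<Union>a\<in>{..<M}. B a)"
  proof (rule sum_has_sum)
    fix a assume a: "a \<in> {..<M}"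
    have "((\<lambda>m. \<psi> (- int a) * geo (ee (of_nat m * \<tau> / of_nat M + y))) has_sum
            (\<psi> (- int a) * lam \<tau> (y - of_nat a * \<tau> / of_nat M))) (B a)"
      unfolding B_def by (intro has_sum_cmult_right lam_has_sum assms) (use a in auto)
    also have "?this \<longleftrightarrow> ((\<lambda>m. \<psi> (int m) * geo (ee (of_nat m * \<tau> / of_nat M + y))) has_sum
            (\<psi> (- int a) * lam \<tau> (y - of_nat a * \<tau> / of_nat M))) (B a)"
    proof (rule has_sum_cong)
      fix m assume "m \<in> B a"
      hence "int M dvd int m + int a" by (auto simp: B_def simp flip: of_nat_add)
      hence "\<psi> (- int a) = \<psi> (int m)"
        by (intro mod_periodicD[OF \<psi>]) (simp add: cong_iff_dvd_diff dvd_diff_commute[of _ "- int a"])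
      thus "\<psi> (- int a) * geo (ee (of_nat m * \<tau> / of_nat M + y)) =
            \<psi> (int m) * geo (ee (of_nat m * \<tau> / of_nat M + y))" by simp
    qed
    finally show "((\<lambda>m. \<psi> (int m) * geo (ee (of_nat m * \<tau> / of_nat M + y))) has_sum
            (\<psi> (- int a) * lam \<tau> (y - of_nat a * \<tau> / of_nat M))) (B a)" .
  next
    fix a a' assume *: "a \<in> {..<M}" "a' \<in> {..<M}" "a \<noteq> a'"
    show "B a \<inter> B a' = {}"
    proof (rule ccontr)
      assume "B a \<inter> B a' \<noteq> {}"
      then obtain m where "M dvd m + a" "M dvd m + a'" by (auto simp: B_def)
      hence "[m + a = m + a'] (mod M)" by (simp add: cong_def mod_eq_0_iff_dvd[symmetric])
      hence "[a = a'] (mod M)" by (simp add: cong_add_lcancel_nat)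
      with * show False by (simp add: cong_def)
    qed
  qed auto
  also have "(\<Union>a\<in>{..<M}. B a) = {1..}"
  proof (intro equalityI subsetI)
    fix m :: nat assume "m \<in> {1..}"
    define a where "a = nat ((- int m) mod int M)"
    have a: "int a = (- int m) mod int M" using assms(2) by (simp add: a_def)
    have "int M dvd int (m + a)" by (simp add: a mod_0_imp_dvd mod_add_right_eq)
    hence "M dvd m + a" by (simp only: int_dvd_int_iff)
    moreover have "a < M" using assms(2) by (simp add: a_def nat_less_iff)
    ultimately show "m \<in> (\<Union>a\<in>{..<M}. B a)" using \<open>m \<in> {1..}\<close> by (auto simp: B_def)
  qed (auto simp: B_def)
  finally show ?thesis .
qed

lemma has_sum_finite_sum:
  fixes f :: "'i \<Rightarrow> 'a \<Rightarrow> 'b :: {topological_comm_monoid_add}"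
  assumes "\<And>i. i \<in> I \<Longrightarrow> (f i has_sum S i) A"
  shows "((\<lambda>x. \<Sum>i\<in>I. f i x) has_sum (\<Sum>i\<in>I. S i)) A"
  using assms by (induction I rule: infinite_finite_induct) (auto intro!: has_sum_add)

text \<open>Summing over n turns the additive characters in \<Phi> into translations by b / M1, and
  the residue classes of m give those by a \<tau> / M2. The sign c is 1 for the ascending half of J
  and -1 for the descending half.\<close>

lemma double_series_has_sum:
  fixes \<Psi> :: "int \<Rightarrow> int \<Rightarrow> complex" and c :: int and M1 M2 :: nat
  defines "\<Phi> \<equiv> (\<lambda>n m. \<Sum>b<M1. \<Psi> m (int b) * rt M1 (c * int b * n))"
  assumes \<tau>: "Im \<tau> > 0" and M: "M1 > 0" "M2 > 0" and z: "\<bar>Im z\<bar> < Im \<tau> / of_nat M2"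
    and \<Psi>: "\<And>b. mod_periodic M2 (\<lambda>a. \<Psi> a b)"
  shows "((\<lambda>(m, n). \<Phi> (int n) (int m) * ee (of_nat (m * n) * \<tau> / of_nat M2) * ee (of_nat n * z)) has_sum
            (\<Sum>b<M1. \<Sum>a<M2. \<Psi> (- int a) (int b) *
                lam \<tau> (z + of_int (c * int b) / of_nat M1 - of_nat a * \<tau> / of_nat M2))) ({1..} \<times> {1..})"
proof (rule has_sum_SigmaI)
  let ?y = "\<lambda>b. z + of_int (c * int b) / of_nat M1"
  have Im_y: "Im (?y b) = Im z" for b by simp
  show "((\<lambda>m. \<Sum>b<M1. \<Psi> (int m) (int b) * geo (ee (of_nat m * \<tau> / of_nat M2 + ?y b))) has_sum
          (\<Sum>b<M1. \<Sum>a<M2. \<Psi> (- int a) (int b) * lam \<tau> (?y b - of_nat a * \<tau> / of_nat M2))) {1..}"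
    by (intro has_sum_finite_sum lam_has_sum_residues[OF \<tau> M(2) \<Psi>]) (use z in \<open>auto simp: abs_less_iff\<close>)
  show "((\<lambda>n. (\<lambda>(m, n). \<Phi> (int n) (int m) * ee (of_nat (m * n) * \<tau> / of_nat M2) * ee (of_nat n * z)) (m, n)) has_sum
          (\<Sum>b<M1. \<Psi> (int m) (int b) * geo (ee (of_nat m * \<tau> / of_nat M2 + ?y b)))) {1..}"
    if m: "m \<in> {1..}" for m :: nat
  proof -
    have "((\<lambda>n. \<Sum>b<M1. \<Psi> (int m) (int b) * ee (of_nat m * \<tau> / of_nat M2 + ?y b) ^ n) has_sum
          (\<Sum>b<M1. \<Psi> (int m) (int b) * geo (ee (of_nat m * \<tau> / of_nat M2 + ?y b)))) {1..}"
      unfolding geo_def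
    proof (intro has_sum_finite_sum has_sum_cmult_right has_sum_geometric_from_1)
      fix b
      have "Im \<tau> / of_nat M2 \<le> real m * Im \<tau> / of_nat M2"
        using m \<tau> by (intro divide_right_mono) auto
      moreover have "Im (of_nat m * \<tau> / of_nat M2 + ?y b) = real m * Im \<tau> / of_nat M2 + Im z" by simp
      ultimately have "Im (of_nat m * \<tau> / of_nat M2 + ?y b) > 0" using z by linarith
      thus "norm (ee (of_nat m * \<tau> / of_nat M2 + ?y b)) < 1" by (simp only: norm_ee_less_1_iff)
    qed
    also have "(\<lambda>n. \<Sum>b<M1. \<Psi> (int m) (int b) * ee (of_nat m * \<tau> / of_nat M2 + ?y b) ^ n) =
               (\<lambda>n. \<Phi> (int n) (int m) * ee (of_nat (m * n) * \<tau> / of_nat M2) * ee (of_nat n * z))"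
    proof
      fix n
      have "ee (of_nat m * \<tau> / of_nat M2 + ?y b) ^ n =
              rt M1 (c * int b * int n) * ee (of_nat (m * n) * \<tau> / of_nat M2) * ee (of_nat n * z)" for b
        unfolding ee_power rt_def ee_add[symmetric] by (simp add: algebra_simps)
      thus "(\<Sum>b<M1. \<Psi> (int m) (int b) * ee (of_nat m * \<tau> / of_nat M2 + ?y b) ^ n) =
            \<Phi> (int n) (int m) * ee (of_nat (m * n) * \<tau> / of_nat M2) * ee (of_nat n * z)"
        unfolding \<Phi>_def by (simp add: sum_distrib_right mult.assoc)
    qed
    finally show ?thesis by simp
  qed
  show "(\<lambda>(m, n). \<Phi> (int n) (int m) * ee (of_nat (m * n) * \<tau> / of_nat M2) * ee (of_nat n * z)) summable_on
          ({1..} \<times> {1..})"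
  proof -
    have "biperiodic M1 M2 \<Phi>"
      unfolding biperiodic_def
    proof (intro conjI allI)
      fix m show "mod_periodic M1 (\<lambda>n. \<Phi> n m)"
        unfolding mod_periodic_def \<Phi>_def using M by (auto intro!: sum.cong rt_cong cong_mult)
    next
      fix n show "mod_periodic M2 (\<Phi> n)"
        unfolding mod_periodic_def \<Phi>_def using mod_periodicD[OF \<Psi>] by (auto intro!: sum.cong)
    qed
    then obtain B where B: "B > 0" "\<And>n m. norm (\<Phi> n m) \<le> B"
      using biperiodic_bounded M by blast
    have "(\<lambda>(m, n). norm (\<Phi> (int n) (int m) * ee (of_nat (m * n) * \<tau> / of_nat M2)) *
             exp (of_nat n * (2 * pi * \<bar>Im z\<bar>))) summable_on ({1..} \<times> {1..})"
      using mult_strict_left_mono[OF z, of "2 * pi"]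
      by (intro double_series_summable[OF \<tau> M(2) B]) auto
    hence "(\<lambda>x. norm ((\<lambda>(m, n). \<Phi> (int n) (int m) * ee (of_nat (m * n) * \<tau> / of_nat M2) * ee (of_nat n * z)) x)) summable_on
          ({1..} \<times> {1..})"
    proof (rule summable_on_comparison_test)
      fix x :: "nat \<times> nat" assume "x \<in> {1..} \<times> {1..}"
      obtain m n where x: "x = (m, n)" by force
      have "real n * (- 2 * pi * Im z) \<le> real n * (2 * pi * \<bar>Im z\<bar>)"
        by (intro mult_left_mono) (auto simp: abs_if)
      hence "norm (ee (of_nat n * z)) \<le> exp (of_nat n * (2 * pi * \<bar>Im z\<bar>))"
        by (simp add: norm_ee mult_ac)
      thus "norm ((\<lambda>(m, n). \<Phi> (int n) (int m) * ee (of_nat (m * n) * \<tau> / of_nat M2) * ee (of_nat n * z)) x) \<le>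
        (case x of (m, n) \<Rightarrow> norm (\<Phi> (int n) (int m) * ee (of_nat (m * n) * \<tau> / of_nat M2)) *
             exp (of_nat n * (2 * pi * \<bar>Im z\<bar>)))"
        unfolding x prod.case norm_mult by (intro mult_left_mono) auto
    qed auto
    thus ?thesis by (rule abs_summable_summable)
  qed
qed

lemma Jfun_add_int: "Jfun \<tau> (z + of_int n) = Jfun \<tau> z"
proof (induction n rule: int_induct[where k = 0])
  case (step1 i)
  thus ?case using Jfun_periodic[of \<tau> "z + of_int i"] by (simp add: add.assoc)
next
  case (step2 i)
  thus ?case using Jfun_periodic[of \<tau> "z + of_int (i - 1)"] by (simp add: add.assoc)
qed auto

section \<open>Sums of J over torsion translates\<close>

text \<open>J gains 1 under z -> z + \<tau>; subtracting a / M2 compensates this, so that the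
  summand belongs to the residue of a modulo M2.\<close>

definition torsion_sum :: "nat \<Rightarrow> nat \<Rightarrow> (int \<Rightarrow> int \<Rightarrow> complex) \<Rightarrow> complex \<Rightarrow> complex \<Rightarrow> complex" where
  "torsion_sum M1 M2 \<Psi> \<tau> z = (\<Sum>a<M2. \<Sum>b<M1. \<Psi> (int a) (int b) *
     (Jfun \<tau> (z + of_nat a * \<tau> / of_nat M2 + of_nat b / of_nat M1) - of_nat a / of_nat M2))"

text \<open>Inversion carries the torsion point of (a, b) to that of (b, -a), whence the exchanged
  moduli and the sign. The linear corrections at the torsion points are exactly the subtracted
  constants, apart from the common part z / \<tau>.\<close>

lemma torsion_sum_inversion:
  fixes \<Psi> :: "int \<Rightarrow> int \<Rightarrow> complex" and M1 M2 :: nat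
  assumes \<tau>: "Im \<tau> > 0" and M: "M1 > 0" "M2 > 0"
    and \<Psi>: "\<And>b. mod_periodic M2 (\<lambda>a. \<Psi> a b)"
  shows "eventually (\<lambda>z. torsion_sum M1 M2 \<Psi> (- 1 / \<tau>) (z / \<tau>) / \<tau> =
           torsion_sum M2 M1 (\<lambda>a b. \<Psi> (- b) a) \<tau> z - z / \<tau> * (\<Sum>a<M2. \<Sum>b<M1. \<Psi> (int a) (int b))) (at 0)"
proof -
  have [simp]: "\<tau> \<noteq> 0" using \<tau> by auto
  \<comment> \<open>Solved from (z + c a b) / \<tau> = z / \<tau> + a (-1/\<tau>) / M2 + b /
    M1.\<close>
  define c where "c = (\<lambda>a b. of_nat b * \<tau> / of_nat M1 - of_nat a / (of_nat M2 :: complex))"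
  define P where "P = {z. \<bar>Im z\<bar> < Im \<tau> \<and> \<bar>Im (z / \<tau>)\<bar> < Im (- 1 / \<tau>)}"
  have "open P" unfolding P_def
    by (intro open_Collect_conj open_Collect_less continuous_intros) simp_all
  have \<tau>': "Im (- 1 / \<tau>) > 0" by (rule Im_neg_inverse_pos[OF \<tau>])
  \<comment> \<open>Since a < M2 and b < M1, the point c a b lies in the open set P where
    \<open>Jfun_inversion\<close> applies; for a = b = 0 it is the pole, so z = 0 must be
    avoided.\<close>
  have ev: "eventually (\<lambda>z. z + c a b \<in> P \<and> z + c a b \<noteq> 0) (at 0)" if ab: "a < M2" "b < M1" for a b
  proof (rule eventually_conj)
    have "Im (c a b) = real b / real M1 * Im \<tau>" by (simp add: c_def)
    hence 1: "\<bar>Im (c a b)\<bar> < Im \<tau>" using mult_strict_right_mono[of "real b / real M1" 1 "Im \<tau>"] ab \<tau> by (simp add: abs_mult)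
    have Im_lin: "Im (of_real r + of_real s * w) = s * Im w" for r s w by simp
    have "c a b / \<tau> = of_real (real b / real M1) + of_real (real a / real M2) * (- 1 / \<tau>)"
      by (simp add: c_def field_simps)
    hence "Im (c a b / \<tau>) = real a / real M2 * Im (- 1 / \<tau>)" by (simp only: Im_lin)
    hence 2: "\<bar>Im (c a b / \<tau>)\<bar> < Im (- 1 / \<tau>)" 
      using mult_strict_right_mono[of "real a / real M2" 1 "Im (- 1 / \<tau>)"] ab \<tau>' by (simp only: abs_mult) simp
    have "open ((\<lambda>z. z + c a b) -` P)"
      by (intro continuous_open_vimage[OF \<open>open P\<close>] continuous_intros)
    moreover have "0 \<in> (\<lambda>z. z + c a b) -` P" using 1 2 by (simp add: P_def)
    ultimately have "eventually (\<lambda>z. z \<in> (\<lambda>z. z + c a b) -` P) (at 0)"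
      by (rule eventually_at_in_open')
    thus "eventually (\<lambda>z. z + c a b \<in> P) (at 0)" by simp
    show "eventually (\<lambda>z. z + c a b \<noteq> 0) (at 0)"
      using eventually_neq_at_within[of "- c a b" 0 UNIV] by eventually_elim (auto simp: add_eq_0_iff2)
  qed
  have "eventually (\<lambda>z. \<forall>a\<in>{..<M2}. \<forall>b\<in>{..<M1}. z + c a b \<in> P \<and> z + c a b \<noteq> 0) (at 0)"
    by (intro eventually_ball_finite ballI ev) auto
  thus ?thesis
  proof eventually_elim
    case (elim z)
    define G where "G = (\<lambda>a b. Jfun \<tau> (z + c a b) - of_nat b / of_nat M1)"
    have G: "Jfun (- 1 / \<tau>) (z / \<tau> + of_nat a * (- 1 / \<tau>) / of_nat M2 + of_nat b / of_nat M1) / \<tau> - of_nat a / of_nat M2 / \<tau>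
             = G a b - z / \<tau>" if "a < M2" "b < M1" for a b
    proof -
      have "Jfun (- 1 / \<tau>) ((z + c a b) / \<tau>) / \<tau> = Jfun \<tau> (z + c a b) - (z + c a b) / \<tau>"
        using elim that by (intro Jfun_inversion \<tau>) (auto simp: P_def)
      moreover have "(z + c a b) / \<tau> = z / \<tau> + of_nat a * (- 1 / \<tau>) / of_nat M2 + of_nat b / of_nat M1"
        by (simp add: c_def add_divide_distrib diff_divide_distrib)
      ultimately have "Jfun (- 1 / \<tau>) (z / \<tau> + of_nat a * (- 1 / \<tau>) / of_nat M2 + of_nat b / of_nat M1) / \<tau> =
         Jfun \<tau> (z + c a b) - (z / \<tau> + of_nat a * (- 1 / \<tau>) / of_nat M2 + of_nat b / of_nat M1)" by metis
      thus ?thesis by (simp add: G_def)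
    qed
    have "torsion_sum M1 M2 \<Psi> (- 1 / \<tau>) (z / \<tau>) / \<tau> = (\<Sum>a<M2. \<Sum>b<M1. \<Psi> (int a) (int b) *
            (Jfun (- 1 / \<tau>) (z / \<tau> + of_nat a * (- 1 / \<tau>) / of_nat M2 + of_nat b / of_nat M1) / \<tau> - of_nat a / of_nat M2 / \<tau>))"
      unfolding torsion_sum_def sum_divide_distrib
      by (intro sum.cong refl) (simp only: times_divide_eq_right[symmetric] diff_divide_distrib)
    also have "\<dots> = (\<Sum>a<M2. \<Sum>b<M1. \<Psi> (int a) (int b) * (G a b - z / \<tau>))"
      by (intro sum.cong refl) (use G in auto)
    also have "\<dots> = (\<Sum>a<M2. \<Sum>b<M1. \<Psi> (int a) (int b) * G a b) - z / \<tau> * (\<Sum>a<M2. \<Sum>b<M1. \<Psi> (int a) (int b))"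
      by (simp add: right_diff_distrib sum_subtractf sum_distrib_left mult_ac)
    also have "(\<Sum>a<M2. \<Sum>b<M1. \<Psi> (int a) (int b) * G a b) = (\<Sum>b<M1. \<Sum>a<M2. \<Psi> (int a) (int b) * G a b)"
      by (rule sum.swap)
    also have "\<dots> = torsion_sum M2 M1 (\<lambda>a b. \<Psi> (- b) a) \<tau> z"
      unfolding torsion_sum_def
    proof (rule sum.cong[OF refl])
      fix b
      \<comment> \<open>The translates come out at -a / M2; as J has period 1, reversing the
        residues a restores the standard form.\<close>
      define \<phi> where "\<phi> = (\<lambda>a. \<Psi> a (int b) * (Jfun \<tau> (z + of_nat b * \<tau> / of_nat M1 + of_int (- a) / of_nat M2) - of_nat b / of_nat M1))"
      have "mod_periodic M2 \<phi>"
        unfolding mod_periodic_def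
      proof (intro allI impI)
        fix x y :: int assume xy: "[x = y] (mod int M2)"
        then obtain d where d: "y = x + int M2 * d" by (auto simp: cong_iff_lin)
        have "z + of_nat b * \<tau> / of_nat M1 + of_int (- x) / of_nat M2 =
              (z + of_nat b * \<tau> / of_nat M1 + of_int (- y) / of_nat M2) + of_int d"
          using M by (simp add: d field_simps)
        thus "\<phi> x = \<phi> y"
          unfolding \<phi>_def using mod_periodicD[OF \<Psi> xy] by (simp only: Jfun_add_int)
      qed
      from sum_residues_uminus[OF this M(2)]
      show "(\<Sum>a<M2. \<Psi> (int a) (int b) * G a b) =
            (\<Sum>a<M2. \<Psi> (- int a) (int b) * (Jfun \<tau> (z + of_nat b * \<tau> / of_nat M1 + of_nat a / of_nat M2) - of_nat b / of_nat M1))"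
        by (simp add: \<phi>_def G_def c_def algebra_simps)
    qed
    finally show ?case .
  qed
qed

text \<open>Every x = \<open>w * rt M b\<close> has x^M = w^M, hence 1 / (x - 1) is the sum of x^r
  over r < M divided by w^M - 1. At w = e(z) this becomes, up to the factor t, the generating
  function of generalized Bernoulli numbers.\<close>

lemma sum_geo_rt:
  assumes "M > 0" "w ^ M \<noteq> 1"
  shows "(\<Sum>b<M. \<psi> (int b) * geo (w * rt M (int b))) =
           - (\<Sum>b<M. \<psi> (int b)) - (\<Sum>r<M. (\<Sum>b<M. \<psi> (int b) * rt M (int b * int r)) * w ^ r) / (w ^ M - 1)"
proof -
  have "geo (w * rt M (int b)) = - 1 - (\<Sum>r<M. rt M (int b * int r) * w ^ r) / (w ^ M - 1)" for b
  proof -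
    define x where "x = w * rt M (int b)"
    have "rt M (int b) ^ M = 1" using assms(1) by (simp add: rt_power rt_eq_1_iff)
    hence x: "x ^ M = w ^ M" by (simp add: x_def power_mult_distrib)
    hence "x \<noteq> 1" using assms(2) by auto
    have "(\<Sum>r<M. rt M (int b * int r) * w ^ r) = (\<Sum>r<M. x ^ r)"
      by (simp add: x_def power_mult_distrib rt_power mult_ac)
    also have "\<dots> = (w ^ M - 1) / (x - 1)"
      using \<open>x \<noteq> 1\<close> by (simp add: geometric_sum x)
    finally have "(\<Sum>r<M. rt M (int b * int r) * w ^ r) / (w ^ M - 1) = 1 / (x - 1)"
      using assms(2) by simp
    moreover have "geo x = - 1 - 1 / (x - 1)" using \<open>x \<noteq> 1\<close> by (simp add: geo_def divide_simps) (simp add: algebra_simps)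
    ultimately show ?thesis by (simp add: x_def)
  qed
  hence "(\<Sum>b<M. \<psi> (int b) * geo (w * rt M (int b))) =
     - (\<Sum>b<M. \<psi> (int b)) - (\<Sum>b<M. \<psi> (int b) * (\<Sum>r<M. rt M (int b * int r) * w ^ r)) / (w ^ M - 1)"
    by (simp add: right_diff_distrib sum_subtractf sum_negf flip: sum_divide_distrib)
  also have "(\<Sum>b<M. \<psi> (int b) * (\<Sum>r<M. rt M (int b * int r) * w ^ r)) =
             (\<Sum>r<M. (\<Sum>b<M. \<psi> (int b) * rt M (int b * int r)) * w ^ r)"
    unfolding sum_distrib_left sum_distrib_right by (subst sum.swap) (simp add: mult.assoc)
  finally show ?thesis .
qed

text \<open>The translates with a = 0 contain the pole at z = 0 and give the Bernoulli quotient;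
  those with a > 0 have their \<open>geo\<close> term absorbed into \<open>lam\<close>. The two
  double series are the two halves of J.\<close>

lemma torsion_sum_expansion:
  fixes \<Psi> \<Phi> :: "int \<Rightarrow> int \<Rightarrow> complex" and M1 M2 :: nat
  defines "I \<equiv> {1..} \<times> {1::nat..}"
  assumes \<tau>: "Im \<tau> > 0" and M: "M1 > 0" "M2 > 0" and z: "\<bar>Im z\<bar> < Im \<tau> / of_nat M2" "ee (of_nat M1 * z) \<noteq> 1"
    and \<Psi>: "\<And>b. mod_periodic M2 (\<lambda>a. \<Psi> a b)"
    and \<Phi>: "\<And>n m. \<Phi> n m = (\<Sum>b<M1. \<Psi> m (int b) * rt M1 (int b * n))"
  shows "torsion_sum M1 M2 \<Psi> \<tau> z =
           (\<Sum>a<M2. \<Phi> 0 (int a) * (1 / 2 - of_nat a / of_nat M2)) - \<Phi> 0 0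
           - (\<Sum>r<M1. \<Phi> (int r) 0 * ee (of_nat r * z)) / (ee (of_nat M1 * z) - 1)
           + (\<Sum>\<^sub>\<infinity>(m, n)\<in>I. \<Phi> (int n) (int m) * ee (of_nat (m * n) * \<tau> / of_nat M2) * ee (of_nat n * z))
           - (\<Sum>\<^sub>\<infinity>(m, n)\<in>I. \<Phi> (- int n) (- int m) * ee (of_nat (m * n) * \<tau> / of_nat M2) * ee (of_nat n * - z))"
proof -
  define x where "x = (\<lambda>a b. z + of_nat a * \<tau> / of_nat M2 + of_nat b / of_nat M1)"
  have "((\<lambda>(m, n). (\<Sum>b<M1. \<Psi> (int m) (int b) * rt M1 (1 * int b * int n)) * ee (of_nat (m * n) * \<tau> / of_nat M2) * ee (of_nat n * z)) has_sum
            (\<Sum>b<M1. \<Sum>a<M2. \<Psi> (- int a) (int b) *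
                lam \<tau> (z + of_int (1 * int b) / of_nat M1 - of_nat a * \<tau> / of_nat M2))) ({1..} \<times> {1..})"
    by (rule double_series_has_sum[OF \<tau> M z(1) \<Psi>])
  hence 1: "(\<Sum>\<^sub>\<infinity>(m, n)\<in>I. \<Phi> (int n) (int m) * ee (of_nat (m * n) * \<tau> / of_nat M2) * ee (of_nat n * z)) =
     (\<Sum>b<M1. \<Sum>a<M2. \<Psi> (- int a) (int b) * lam \<tau> (z + of_nat b / of_nat M1 - of_nat a * \<tau> / of_nat M2))"
    unfolding I_def by (intro infsumI) (simp add: \<Phi>)
  have "((\<lambda>(m, n). (\<Sum>b<M1. \<Psi> (- int m) (int b) * rt M1 ((- 1) * int b * int n)) * ee (of_nat (m * n) * \<tau> / of_nat M2) * ee (of_nat n * - z)) has_sum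
            (\<Sum>b<M1. \<Sum>a<M2. \<Psi> (- (- int a)) (int b) *
                lam \<tau> (- z + of_int ((- 1) * int b) / of_nat M1 - of_nat a * \<tau> / of_nat M2))) ({1..} \<times> {1..})"
    by (rule double_series_has_sum[OF \<tau> M _ mod_periodic_uminus[OF \<Psi>]]) (use z(1) in auto)
  hence 2: "(\<Sum>\<^sub>\<infinity>(m, n)\<in>I. \<Phi> (- int n) (- int m) * ee (of_nat (m * n) * \<tau> / of_nat M2) * ee (of_nat n * - z)) =
     (\<Sum>b<M1. \<Sum>a<M2. \<Psi> (int a) (int b) * lam \<tau> (- x a b))"
    unfolding I_def by (intro infsumI) (simp add: \<Phi> x_def algebra_simps)
  have 3: "(\<Sum>a<M2. \<Psi> (int a) (int b) * ((if a = 0 then 0 else geo (ee (x a b))) + lam \<tau> (x a b))) =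
           (\<Sum>a<M2. \<Psi> (- int a) (int b) * lam \<tau> (z + of_nat b / of_nat M1 - of_nat a * \<tau> / of_nat M2))" for b
  proof -
    \<comment> \<open>For a > 0 the \<open>geo\<close> term completes \<open>lam\<close> at x to
      \<open>lam\<close> at x - \<tau>, the translate belonging to M2 - a; a = 0 stays
      fixed.\<close>
    define h where "h = (\<lambda>a. \<Psi> (- int a) (int b) * lam \<tau> (z + of_nat b / of_nat M1 - of_nat a * \<tau> / of_nat M2))"
    have eq: "\<Psi> (int a) (int b) * ((if a = 0 then 0 else geo (ee (x a b))) + lam \<tau> (x a b)) =
                h (if a = 0 then 0 else M2 - a)" if a: "a < M2" for a
    proof (cases "a = 0")
      case True
      thus ?thesis by (simp add: h_def x_def)
    next
      case False
      have "Im (x a b) = Im z + real a * (Im \<tau> / real M2)" by (simp add: x_def)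
      moreover have "1 * (Im \<tau> / real M2) \<le> real a * (Im \<tau> / real M2)"
        using False \<tau> by (intro mult_right_mono) auto
      ultimately have "Im (x a b) > 0" using z(1) by linarith
      hence "lam \<tau> (x a b - \<tau>) = geo (ee (x a b)) + lam \<tau> (x a b)"
        using lam_shift[of \<tau> "x a b - \<tau>"] \<tau> by simp
      moreover have "z + of_nat b / of_nat M1 - of_nat (M2 - a) * \<tau> / of_nat M2 = x a b - \<tau>"
        using a M by (simp add: x_def of_nat_diff left_diff_distrib diff_divide_distrib)
      moreover have "\<Psi> (- int (M2 - a)) (int b) = \<Psi> (int a) (int b)"
        by (rule mod_periodicD[OF \<Psi>]) (use a in \<open>simp add: cong_iff_dvd_diff of_nat_diff\<close>)
      ultimately show ?thesis using False by (simp add: h_def)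
    qed
    have "(\<Sum>a<M2. \<Psi> (int a) (int b) * ((if a = 0 then 0 else geo (ee (x a b))) + lam \<tau> (x a b))) =
             (\<Sum>a<M2. h (if a = 0 then 0 else M2 - a))"
      by (intro sum.cong refl eq) auto
    also have "\<dots> = (\<Sum>a<M2. h a)"
      by (rule sum.reindex_bij_witness[of _ "\<lambda>a. if a = 0 then 0 else M2 - a" "\<lambda>a. if a = 0 then 0 else M2 - a"]) auto
    finally show ?thesis by (simp add: h_def)
  qed
  have eq: "Jfun \<tau> (x a b) - of_nat a / of_nat M2 = (1 / 2 - of_nat a / of_nat M2) + (if a = 0 then geo (ee (x a b)) else 0)
          + ((if a = 0 then 0 else geo (ee (x a b))) + lam \<tau> (x a b)) - lam \<tau> (- x a b)" for a b
    by (simp add: Jfun_def)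
  have x_app: "x a b = z + of_nat a * \<tau> / of_nat M2 + of_nat b / of_nat M1" for a b
    by (simp add: x_def)
  have distrib4: "p * (A + B + C - D) = p * A + p * B + p * C - p * D" for p A B C D :: complex
    by (simp add: algebra_simps)
  have "torsion_sum M1 M2 \<Psi> \<tau> z =
          (\<Sum>a<M2. \<Sum>b<M1. \<Psi> (int a) (int b) * (1 / 2 - of_nat a / of_nat M2)) +
          (\<Sum>a<M2. \<Sum>b<M1. \<Psi> (int a) (int b) * (if a = 0 then geo (ee (x a b)) else 0)) +
          (\<Sum>a<M2. \<Sum>b<M1. \<Psi> (int a) (int b) * ((if a = 0 then 0 else geo (ee (x a b))) + lam \<tau> (x a b))) -
          (\<Sum>a<M2. \<Sum>b<M1. \<Psi> (int a) (int b) * lam \<tau> (- x a b))"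
    unfolding torsion_sum_def x_app[symmetric] eq
      distrib4 sum.distrib sum_subtractf by (rule refl)
  also have "(\<Sum>a<M2. \<Sum>b<M1. \<Psi> (int a) (int b) * (1 / 2 - of_nat a / of_nat M2)) =
             (\<Sum>a<M2. \<Phi> 0 (int a) * (1 / 2 - of_nat a / of_nat M2))"
    by (simp add: \<Phi> sum_distrib_right)
  also have "(\<Sum>a<M2. \<Sum>b<M1. \<Psi> (int a) (int b) * (if a = 0 then geo (ee (x a b)) else 0)) =
             (\<Sum>a<M2. if a = 0 then (\<Sum>b<M1. \<Psi> 0 (int b) * geo (ee z * rt M1 (int b))) else 0)"
    by (intro sum.cong refl) (auto simp: x_def ee_add rt_def)
  also have "\<dots> = (\<Sum>b<M1. \<Psi> 0 (int b) * geo (ee z * rt M1 (int b)))"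
    using M by (simp add: sum.delta)
  also have "\<dots> = - \<Phi> 0 0 - (\<Sum>r<M1. \<Phi> (int r) 0 * ee (of_nat r * z)) / (ee (of_nat M1 * z) - 1)"
    using z(2) M by (subst sum_geo_rt) (simp_all add: ee_power \<Phi>)
  also have "(\<Sum>a<M2. \<Sum>b<M1. \<Psi> (int a) (int b) * ((if a = 0 then 0 else geo (ee (x a b))) + lam \<tau> (x a b))) =
     (\<Sum>b<M1. \<Sum>a<M2. \<Psi> (- int a) (int b) * lam \<tau> (z + of_nat b / of_nat M1 - of_nat a * \<tau> / of_nat M2))"
    by (subst sum.swap) (simp only: 3)
  also have "(\<Sum>a<M2. \<Sum>b<M1. \<Psi> (int a) (int b) * lam \<tau> (- x a b)) =
             (\<Sum>b<M1. \<Sum>a<M2. \<Psi> (int a) (int b) * lam \<tau> (- x a b))"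
    by (rule sum.swap)
  finally show ?thesis unfolding 1 2 by simp
qed

section \<open>Eisenstein series and their inversion formula\<close>

text \<open>Both signs of (n, m) enter because J has two halves; for \<Phi> of parity (-1)^k the
  bracket is 2 \<Phi>.\<close>

definition eis_series :: "nat \<Rightarrow> nat \<Rightarrow> complex \<Rightarrow> (int \<Rightarrow> int \<Rightarrow> complex) \<Rightarrow> complex" where
  "eis_series k M \<tau> \<Phi> = (\<Sum>\<^sub>\<infinity>(m, n)\<in>{1..} \<times> {1..}.
     (\<Phi> (int n) (int m) + (- 1) ^ k * \<Phi> (- int n) (- int m)) * of_nat n ^ (k - 1) *
     ee (of_nat (m * n) * \<tau> / of_nat M))"

text \<open>The regularised contributions of the axes: m = 0 in every weight, n = 0 only in weight
  1.\<close>

definition eis_const :: "nat \<Rightarrow> nat \<Rightarrow> nat \<Rightarrow> (int \<Rightarrow> int \<Rightarrow> complex) \<Rightarrow> complex" where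
  "eis_const k M1 M2 \<Phi> = - gen_bernoulli k M1 (\<lambda>n. \<Phi> n 0) / of_nat k -
     (if k = 1 then gen_bernoulli 1 M2 (\<Phi> 0) else 0)"

text \<open>Each argument is dual to the opposite one: n pairs with the variable of period M2 and m
  with that of period M1, so the periods swap. The factor 1/M1 normalises the transform in the first
  variable only.\<close>

definition dft2 :: "nat \<Rightarrow> nat \<Rightarrow> (int \<Rightarrow> int \<Rightarrow> complex) \<Rightarrow> int \<Rightarrow> int \<Rightarrow> complex" where
  "dft2 M1 M2 \<Phi> n m = (\<Sum>a<M2. dft M1 (\<lambda>x. \<Phi> x (int a)) (- m) * rt M2 (- int a * n)) / of_nat M1"

text \<open>The polynomial weight is dominated through n^j \<le> j! / r^j exp (n r).\<close>

lemma double_series_weighted_summable: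
  fixes \<Phi> :: "int \<Rightarrow> int \<Rightarrow> complex"
  assumes "Im \<tau> > 0" "M > 0" "\<And>n m. norm (\<Phi> n m) \<le> B"
  shows "(\<lambda>(m, n). norm (\<Phi> (int n) (int m) * of_nat n ^ j * ee (of_nat (m * n) * \<tau> / of_nat M)))
           summable_on ({1..} \<times> {1..})"
proof -
  have B: "\<bar>B\<bar> + 1 > 0" "\<And>n m. norm (\<Phi> n m) \<le> \<bar>B\<bar> + 1" 
    using order_trans[OF assms(3), of "\<bar>B\<bar> + 1"] by auto
  define r where "r = pi * Im \<tau> / of_nat M"
  have r: "r > 0" "r < 2 * pi * Im \<tau> / of_nat M" using assms by (auto simp: r_def divide_strict_right_mono)
  have "(\<lambda>x. fact j / r ^ j * (case x of (m, n) \<Rightarrow>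
      norm (\<Phi> (int n) (int m) * ee (of_nat (m * n) * \<tau> / of_nat M)) * exp (of_nat n * r)))
           summable_on ({1..} \<times> {1..})"
    by (intro summable_on_cmult_right double_series_summable[OF assms(1,2) B]) (use r in auto)
  thus ?thesis
  proof (rule summable_on_comparison_test)
    fix x :: "nat \<times> nat"
    obtain m n where x: "x = (m, n)" by force
    have "(of_nat n * r) ^ j / fact j \<le> exp (of_nat n * r)"
      using sum_le_suminf[OF summable_exp_generic[of "of_nat n * r"], of "{j}"] r
      by (simp add: exp_def divide_inverse mult.commute)
    hence "real n ^ j \<le> fact j / r ^ j * exp (of_nat n * r)"
      using r by (simp add: power_mult_distrib field_simps)
    hence "norm (\<Phi> (int n) (int m) * ee (of_nat (m * n) * \<tau> / of_nat M)) * real n ^ j \<le>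
           norm (\<Phi> (int n) (int m) * ee (of_nat (m * n) * \<tau> / of_nat M)) * (fact j / r ^ j * exp (of_nat n * r))"
      by (intro mult_left_mono) auto
    thus "(case x of (m, n) \<Rightarrow> norm (\<Phi> (int n) (int m) * of_nat n ^ j * ee (of_nat (m * n) * \<tau> / of_nat M))) \<le>
          fact j / r ^ j * (case x of (m, n) \<Rightarrow>
      norm (\<Phi> (int n) (int m) * ee (of_nat (m * n) * \<tau> / of_nat M)) * exp (of_nat n * r))"
      by (simp add: x norm_mult norm_power mult_ac)
  qed auto
qed

text \<open>With z = t / (2 \<pi> i) the exponentials become exp (n t). The factor t removes the
  simple pole, so coefficient k of G belongs to t^(k-1) in the torsion sum, which accounts for
  \<open>fact (k - 1)\<close>.\<close>

lemma torsion_sum_fps: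
  fixes \<Psi> \<Phi> :: "int \<Rightarrow> int \<Rightarrow> complex" and M1 M2 :: nat
  assumes \<tau>: "Im \<tau> > 0" and M: "M1 > 0" "M2 > 0"
    and \<Psi>: "\<And>b. mod_periodic M2 (\<lambda>a. \<Psi> a b)"
    and \<Phi>: "\<And>n m. \<Phi> n m = (\<Sum>b<M1. \<Psi> m (int b) * rt M1 (int b * n))"
  shows "\<exists>F G. F has_fps_expansion G \<and>
           (\<forall>\<^sub>F t in at 0. F t = t * torsion_sum M1 M2 \<Psi> \<tau> (t / (2 * complex_of_real pi * \<i>))) \<and>
           (\<forall>k\<ge>1. fact (k - 1) * fps_nth G k =
              (if k = 1 then (\<Sum>a<M2. \<Phi> 0 (int a) * (1 / 2 - of_nat a / of_nat M2)) - \<Phi> 0 0 else 0) -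
              gen_bernoulli k M1 (\<lambda>n. \<Phi> n 0) / of_nat k + eis_series k M2 \<tau> \<Phi>)"
proof -
  define I where "I = {1::nat..} \<times> {1::nat..}"
  define c where "c = (\<Sum>a<M2. \<Phi> 0 (int a) * (1 / 2 - of_nat a / of_nat M2)) - \<Phi> 0 0"
  define q where "q = (\<lambda>(m, n). ee (of_nat (m * n) * \<tau> / of_nat M2))"
  define A1 where "A1 = (\<lambda>(m, n). \<Phi> (int n) (int m) * q (m, n))"
  define A2 where "A2 = (\<lambda>(m, n). \<Phi> (- int n) (- int m) * q (m, n))"
  define l where "l = (\<lambda>(m::nat, n). of_nat n :: complex)"
  have "biperiodic M1 M2 \<Phi>"
    unfolding biperiodic_def
  proof (intro conjI allI)
    fix m show "mod_periodic M1 (\<lambda>n. \<Phi> n m)"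
      unfolding mod_periodic_def \<Phi> using M by (auto intro!: sum.cong rt_cong cong_mult)
  next
    fix n show "mod_periodic M2 (\<Phi> n)"
      unfolding mod_periodic_def \<Phi> using mod_periodicD[OF \<Psi>] by (auto intro!: sum.cong)
  qed
  then obtain B where B: "B > 0" "\<And>n m. norm (\<Phi> n m) \<le> B"
    using biperiodic_bounded M by blast
  define r where "r = pi * Im \<tau> / of_nat M2"
  have r: "r > 0" "r < 2 * pi * Im \<tau> / of_nat M2" using \<tau> M by (auto simp: r_def divide_strict_right_mono)
  have s1: "(\<lambda>i. norm (A1 i) * exp (norm (l i) * r)) summable_on I"
    using double_series_summable[OF \<tau> M(2) B r(2)] r
    by (simp add: A1_def q_def l_def I_def case_prod_unfold)
  have s2: "(\<lambda>i. norm (A2 i) * exp (norm (- l i) * r)) summable_on I"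
    using double_series_summable[OF \<tau> M(2) B(1), of "\<lambda>n m. \<Phi> (- n) (- m)", OF B(2) r(2)] r
    by (simp add: A2_def q_def l_def I_def case_prod_unfold)
  define T1 where "T1 = Abs_fps (\<lambda>j. (\<Sum>\<^sub>\<infinity>i\<in>I. A1 i * l i ^ j) / fact j)"
  define T2 where "T2 = Abs_fps (\<lambda>j. (\<Sum>\<^sub>\<infinity>i\<in>I. A2 i * (- l i) ^ j) / fact j)"
  have T1: "(\<lambda>t. \<Sum>\<^sub>\<infinity>i\<in>I. A1 i * exp (l i * t)) has_fps_expansion T1"
    unfolding T1_def by (rule exp_sum_has_fps_expansion[OF r(1) s1])
  have T2: "(\<lambda>t. \<Sum>\<^sub>\<infinity>i\<in>I. A2 i * exp (- l i * t)) has_fps_expansion T2"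
    unfolding T2_def by (rule exp_sum_has_fps_expansion[OF r(1) s2])
  obtain c0 where "(\<lambda>t. if t = 0 then c0 else t * (\<Sum>r<M1. \<Phi> (int r) 0 * exp (of_nat r * t)) / (exp (of_nat M1 * t) - 1))
               has_fps_expansion bernoulli_fps M1 (\<lambda>n. \<Phi> n 0)"
    using bernoulli_has_fps_expansion[OF M(1), of "\<lambda>n. \<Phi> n 0"] by blast
  note Be = this
  define F where "F = (\<lambda>t. t * (c + (\<Sum>\<^sub>\<infinity>i\<in>I. A1 i * exp (l i * t)) - (\<Sum>\<^sub>\<infinity>i\<in>I. A2 i * exp (- l i * t))) -
    (if t = 0 then c0 else t * (\<Sum>r<M1. \<Phi> (int r) 0 * exp (of_nat r * t)) / (exp (of_nat M1 * t) - 1)))"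
  define G where "G = fps_X * (fps_const c + T1 - T2) - bernoulli_fps M1 (\<lambda>n. \<Phi> n 0)"
  have "F has_fps_expansion G"
    unfolding F_def G_def by (intro fps_expansion_intros T1 T2 Be)
  moreover have "\<forall>\<^sub>F t in at 0. F t = t * torsion_sum M1 M2 \<Psi> \<tau> (t / (2 * complex_of_real pi * \<i>))"
  proof -
    \<comment> \<open>The first bound gives |Im z| < Im \<tau> / M2, the second keeps M1 z away from
      nonzero integers.\<close>
    define \<epsilon> where "\<epsilon> = min (2 * pi * (Im \<tau> / of_nat M2)) (2 * pi / of_nat M1)"
    have "\<epsilon> > 0" using \<tau> M by (simp add: \<epsilon>_def)
    hence "\<forall>\<^sub>F t in at (0 :: complex). t \<in> ball 0 \<epsilon> - {0}"
      by (intro eventually_at_in_open) auto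
    thus ?thesis
    proof eventually_elim
      case (elim t)
      define z where "z = t / (2 * complex_of_real pi * \<i>)"
      have t: "t \<noteq> 0" "norm t < 2 * pi * (Im \<tau> / of_nat M2)" "norm t < 2 * pi / of_nat M1"
        using elim by (auto simp: \<epsilon>_def)
      have z: "norm z = norm t / (2 * pi)" by (simp add: z_def norm_divide norm_mult)
      have "\<bar>Im z\<bar> \<le> norm t / (2 * pi)" using abs_Im_le_cmod[of z] by (simp add: z)
      also have "\<dots> < Im \<tau> / of_nat M2" using t(2) by (simp add: divide_less_eq mult.commute)
      finally have z1: "\<bar>Im z\<bar> < Im \<tau> / of_nat M2" .
      have ee_z: "ee (of_nat n * z) = exp (of_nat n * t)" "ee (of_nat n * - z) = exp (- of_nat n * t)" for n
        by (simp_all add: ee_def z_def)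
      have z2: "ee (of_nat M1 * z) \<noteq> 1"
      proof
        assume "ee (of_nat M1 * z) = 1"
        then obtain n where n: "of_nat M1 * z = of_int n" by (auto simp: ee_eq_1_iff elim: Ints_cases)
        hence "real M1 * norm z = \<bar>of_int n\<bar>" by (metis norm_mult norm_of_nat norm_of_int)
        moreover have "real M1 * norm z < 1" using t(3) M by (simp add: z field_simps)
        ultimately have "n = 0" by linarith
        with n M have "z = 0" by simp
        thus False using t(1) by (simp add: z_def)
      qed
      have eq: "torsion_sum M1 M2 \<Psi> \<tau> z = c
           - (\<Sum>r<M1. \<Phi> (int r) 0 * exp (of_nat r * t)) / (exp (of_nat M1 * t) - 1)
           + (\<Sum>\<^sub>\<infinity>i\<in>I. A1 i * exp (l i * t)) - (\<Sum>\<^sub>\<infinity>i\<in>I. A2 i * exp (- l i * t))"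
        by (subst torsion_sum_expansion[OF \<tau> M z1 z2 \<Psi> \<Phi>])
           (simp only: ee_z c_def A1_def A2_def q_def l_def I_def case_prod_unfold fst_conv snd_conv)
      show ?case unfolding z_def[symmetric] eq F_def using t(1) by (simp add: algebra_simps)
    qed
  qed
  moreover have "fact (k - 1) * fps_nth G k = (if k = 1 then c else 0) - gen_bernoulli k M1 (\<lambda>n. \<Phi> n 0) / of_nat k
      + eis_series k M2 \<tau> \<Phi>" if k: "k \<ge> 1" for k
  proof -
    from k obtain j where j: "k = Suc j" by (cases k) auto
    have a1: "(\<lambda>i. A1 i * l i ^ j) summable_on I"
    proof (rule abs_summable_summable)
      show "(\<lambda>i. norm (A1 i * l i ^ j)) summable_on I"
        using double_series_weighted_summable[OF \<tau> M(2) B(2), of "\<lambda>n m. n" "\<lambda>n m. m" j] unfolding I_def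
        by (rule summable_on_cong[THEN iffD1, rotated]) (auto simp: A1_def q_def l_def norm_mult norm_power)
    qed
    have a2: "(\<lambda>i. A2 i * (- l i) ^ j) summable_on I"
    proof (rule abs_summable_summable)
      show "(\<lambda>i. norm (A2 i * (- l i) ^ j)) summable_on I"
        using double_series_weighted_summable[OF \<tau> M(2) B(2), of "\<lambda>n m. - n" "\<lambda>n m. - m" j] unfolding I_def
        by (rule summable_on_cong[THEN iffD1, rotated]) (auto simp: A2_def q_def l_def norm_mult norm_power)
    qed
    have "fact j * fps_nth G k = (if j = 0 then c else 0) + ((\<Sum>\<^sub>\<infinity>i\<in>I. A1 i * l i ^ j) - (\<Sum>\<^sub>\<infinity>i\<in>I. A2 i * (- l i) ^ j))
        - fact j * fps_nth (bernoulli_fps M1 (\<lambda>n. \<Phi> n 0)) k"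
      by (simp add: G_def j T1_def T2_def algebra_simps)
    also have "fact j * fps_nth (bernoulli_fps M1 (\<lambda>n. \<Phi> n 0)) k = gen_bernoulli k M1 (\<lambda>n. \<Phi> n 0) / of_nat k"
      by (simp add: gen_bernoulli_conv_fps j del: of_nat_Suc)
    also have "(\<Sum>\<^sub>\<infinity>i\<in>I. A1 i * l i ^ j) - (\<Sum>\<^sub>\<infinity>i\<in>I. A2 i * (- l i) ^ j) =
               (\<Sum>\<^sub>\<infinity>i\<in>I. A1 i * l i ^ j + - (A2 i * (- l i) ^ j))"
      using a1 a2 by (subst infsum_add) (auto simp: infsum_uminus summable_on_uminus)
    also have "\<dots> = eis_series k M2 \<tau> \<Phi>"
      unfolding eis_series_def I_def[symmetric]
      by (intro infsum_cong) (auto simp: A1_def A2_def q_def l_def j power_minus[of "of_nat _"] algebra_simps)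
    finally show ?thesis by (simp add: j)
  qed
  ultimately show ?thesis unfolding c_def by blast
qed

text \<open>Comparison of the k-th coefficients in \<open>torsion_sum_inversion\<close>. The term in
  t^2 is the anomaly of weight 2 and \<open>sum0\<close> removes it; in weight 1 oddness clears the
  values at (0, 0) from the constant terms.\<close>

theorem eis_inversion:
  fixes \<Phi> :: "int \<Rightarrow> int \<Rightarrow> complex" and M1 M2 :: nat
  assumes \<tau>: "Im \<tau> > 0" and M: "M1 > 0" "M2 > 0" and \<Phi>: "biperiodic M1 M2 \<Phi>" and k: "k \<ge> 1"
    and odd: "\<And>n m. k = 1 \<Longrightarrow> \<Phi> (- n) (- m) = - \<Phi> n m"
    and sum0: "k = 2 \<Longrightarrow> (\<Sum>a<M2. \<Phi> 0 (int a)) = 0"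
  shows "eis_const k M1 M2 \<Phi> + eis_series k M2 (- 1 / \<tau>) \<Phi> =
           \<tau> ^ k * (eis_const k M2 M1 (dft2 M1 M2 \<Phi>) + eis_series k M1 \<tau> (dft2 M1 M2 \<Phi>))"
proof -
  have [simp]: "\<tau> \<noteq> 0" using \<tau> by auto
  have \<tau>': "Im (- 1 / \<tau>) > 0" by (rule Im_neg_inverse_pos[OF \<tau>])
  \<comment> \<open>The inverse transform in the first variable only: it presents \<Phi> as a sum of
    additive characters in n, the form \<open>torsion_sum_fps\<close> expects.\<close>
  define \<Psi> where "\<Psi> = (\<lambda>a b. dft M1 (\<lambda>x. \<Phi> x a) (- b) / of_nat M1)"
  define \<Phi>' where "\<Phi>' = dft2 M1 M2 \<Phi>"
  have \<Psi>1: "mod_periodic M2 (\<lambda>a. \<Psi> a b)" for b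
    unfolding mod_periodic_def \<Psi>_def dft_def using mod_periodicD[OF biperiodicD2[OF \<Phi>]]
    by (auto intro!: sum.cong)
  have \<Psi>2: "mod_periodic M1 (\<Psi> a)" for a
    using mod_periodic_uminus[OF mod_periodic_dft[OF M(1)]] by (simp add: \<Psi>_def mod_periodic_def)
  have \<Phi>\<Psi>: "\<Phi> n m = (\<Sum>b<M1. \<Psi> m (int b) * rt M1 (int b * n))" for n m
    using dft_inverse[OF M(1) biperiodicD1[OF \<Phi>], of m n] M
    by (simp add: \<Psi>_def sum_divide_distrib[symmetric])
  have \<Phi>'\<Psi>: "\<Phi>' n m = (\<Sum>b<M2. \<Psi> (- int b) m * rt M2 (int b * n))" for n m
  proof -
    have "mod_periodic M2 (\<lambda>b. \<Psi> (- b) m * rt M2 (b * n))"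
      using mod_periodic_uminus[OF \<Psi>1[of m]] mod_periodic_rt[OF M(2), of n]
      by (intro mod_periodic_mult) (simp_all add: mult.commute)
    from sum_residues_uminus[OF this M(2)] show ?thesis
      by (simp add: \<Phi>'_def dft2_def \<Psi>_def sum_divide_distrib)
  qed
  obtain F1 G1 where F1: "F1 has_fps_expansion G1"
    "\<forall>\<^sub>F t in at 0. F1 t = t * torsion_sum M1 M2 \<Psi> (- 1 / \<tau>) (t / (2 * complex_of_real pi * \<i>))"
    "\<forall>k\<ge>1. fact (k - 1) * fps_nth G1 k =
              (if k = 1 then (\<Sum>a<M2. \<Phi> 0 (int a) * (1 / 2 - of_nat a / of_nat M2)) - \<Phi> 0 0 else 0) -
              gen_bernoulli k M1 (\<lambda>n. \<Phi> n 0) / of_nat k + eis_series k M2 (- 1 / \<tau>) \<Phi>"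
    using torsion_sum_fps[OF \<tau>' M \<Psi>1 \<Phi>\<Psi>] by blast
  obtain F2 G2 where F2: "F2 has_fps_expansion G2"
    "\<forall>\<^sub>F t in at 0. F2 t = t * torsion_sum M2 M1 (\<lambda>a b. \<Psi> (- b) a) \<tau> (t / (2 * complex_of_real pi * \<i>))"
    "\<forall>k\<ge>1. fact (k - 1) * fps_nth G2 k =
              (if k = 1 then (\<Sum>a<M1. \<Phi>' 0 (int a) * (1 / 2 - of_nat a / of_nat M1)) - \<Phi>' 0 0 else 0) -
              gen_bernoulli k M2 (\<lambda>n. \<Phi>' n 0) / of_nat k + eis_series k M1 \<tau> \<Phi>'"
    using torsion_sum_fps[OF \<tau> M(2,1), of "\<lambda>a b. \<Psi> (- b) a", OF \<Psi>2 \<Phi>'\<Psi>] by blast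
  define S where "S = (\<Sum>a<M2. \<Sum>b<M1. \<Psi> (int a) (int b))"
  define d where "d = S / (2 * complex_of_real pi * \<i> * \<tau>)"
  have lim: "filterlim (\<lambda>t. t / c) (at 0) (at 0)" if "c \<noteq> 0" for c :: complex
    using that by (auto simp: filterlim_at eventually_at_filter intro!: tendsto_eq_intros)
  have "\<forall>\<^sub>F t in at 0. (F1 \<circ> (\<lambda>t. 1 / \<tau> * t)) t = F2 t - d * t ^ 2"
  proof -
    have "\<forall>\<^sub>F t in at 0. F1 (t / \<tau>) = t / \<tau> * torsion_sum M1 M2 \<Psi> (- 1 / \<tau>) (t / \<tau> / (2 * complex_of_real pi * \<i>))"
      using eventually_compose_filterlim[OF F1(2) lim[of \<tau>]] by simp
    moreover have "\<forall>\<^sub>F t in at 0. torsion_sum M1 M2 \<Psi> (- 1 / \<tau>) (t / (2 * complex_of_real pi * \<i>) / \<tau>) / \<tau> =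
           torsion_sum M2 M1 (\<lambda>a b. \<Psi> (- b) a) \<tau> (t / (2 * complex_of_real pi * \<i>)) -
           t / (2 * complex_of_real pi * \<i>) / \<tau> * S"
      unfolding S_def
      using eventually_compose_filterlim[OF torsion_sum_inversion[OF \<tau> M \<Psi>1] lim[of "2 * complex_of_real pi * \<i>"]] by simp
    ultimately show ?thesis using F2(2)
    proof eventually_elim
      case (elim t)
      have "(F1 \<circ> (\<lambda>t. 1 / \<tau> * t)) t = F1 (t / \<tau>)" by simp
      also have "\<dots> = t * (torsion_sum M1 M2 \<Psi> (- 1 / \<tau>) (t / (2 * complex_of_real pi * \<i>) / \<tau>) / \<tau>)"
        unfolding elim(1) by (simp add: mult.commute)
      also have "\<dots> = F2 t - t * (t / (2 * complex_of_real pi * \<i>) / \<tau> * S)"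
        unfolding elim(2) elim(3) by (simp add: algebra_simps)
      also have "t * (t / (2 * complex_of_real pi * \<i>) / \<tau> * S) = d * t ^ 2"
        by (simp add: d_def power2_eq_square)
      finally show ?case .
    qed
  qed
  \<comment> \<open>The two sides are known to agree only on a punctured neighbourhood of 0, which
    Laurent expansions tolerate.\<close>
  moreover have "(F1 \<circ> (\<lambda>t. 1 / \<tau> * t)) has_laurent_expansion fps_to_fls (fps_compose G1 (fps_const (1 / \<tau>) * fps_X))"
    by (intro has_laurent_expansion_fps has_fps_expansion_compose F1(1) fps_expansion_intros) simp
  moreover have "(\<lambda>t. F2 t - d * t ^ 2) has_laurent_expansion fps_to_fls (G2 - fps_const d * fps_X ^ 2)"
    by (intro has_laurent_expansion_fps fps_expansion_intros F2(1))
  ultimately have "fps_to_fls (fps_compose G1 (fps_const (1 / \<tau>) * fps_X)) = fps_to_fls (G2 - fps_const d * fps_X ^ 2)"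
    using has_laurent_expansion_cong[OF _ refl] has_laurent_expansion_unique by metis
  hence "fps_nth (fps_compose G1 (fps_const (1 / \<tau>) * fps_X)) k = fps_nth (G2 - fps_const d * fps_X ^ 2) k"
    by (simp only: fps_to_fls_eq_iff)
  hence *: "(1 / \<tau>) ^ k * fps_nth G1 k = fps_nth G2 k - (if k = 2 then d else 0)"
    by (simp add: fps_X_power_nth)
  have "S = (\<Sum>a<M2. \<Phi> 0 (int a))"
    by (simp add: S_def \<Phi>\<Psi>)
  hence "(if k = 2 then d else 0) = 0" using sum0 by (auto simp: d_def)
  with * have "fps_nth G1 k = \<tau> ^ k * fps_nth G2 k" by (simp add: field_simps power_divide)
  hence G12: "fact (k - 1) * fps_nth G1 k = \<tau> ^ k * (fact (k - 1) * fps_nth G2 k)" by simp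
  have c1: "(if k = 1 then (\<Sum>a<M2. \<Phi> 0 (int a) * (1 / 2 - of_nat a / of_nat M2)) - \<Phi> 0 0 else 0) =
                 - (if k = 1 then gen_bernoulli 1 M2 (\<Phi> 0) else 0)"
    using odd[of 0 0] M by (simp add: gen_bernoulli_1[unfolded One_nat_def] right_diff_distrib sum_subtractf)
  have c2: "(if k = 1 then (\<Sum>a<M1. \<Phi>' 0 (int a) * (1 / 2 - of_nat a / of_nat M1)) - \<Phi>' 0 0 else 0) =
                 - (if k = 1 then gen_bernoulli 1 M1 (\<Phi>' 0) else 0)"
  proof (cases "k = 1")
    case True
    \<comment> \<open>Up to a factor, \<Phi>' 0 0 is the sum of \<Phi> over all residues; negating
      both variables shows that it is zero.\<close>
    define s where "s = (\<Sum>a<M2. \<Sum>x<M1. \<Phi> (int x) (int a))"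
    have "s = (\<Sum>a<M2. \<Sum>x<M1. \<Phi> (- int x) (int a))"
      unfolding s_def by (intro sum.cong refl sum_residues_uminus[symmetric] biperiodicD1[OF \<Phi>] M)
    also have "\<dots> = (\<Sum>a<M2. \<Sum>x<M1. \<Phi> (- int x) (- int a))"
    proof (rule sum_residues_uminus[symmetric, OF _ M(2)])
      show "mod_periodic M2 (\<lambda>a. \<Sum>x<M1. \<Phi> (- int x) a)"
        using mod_periodicD[OF biperiodicD2[OF \<Phi>]] unfolding mod_periodic_def by (auto intro!: sum.cong)
    qed
    also have "\<dots> = - s" by (simp add: s_def odd[OF True] sum_negf)
    finally have "s = 0" by simp
    moreover have "\<Phi>' 0 0 = s / of_nat M1" by (simp add: \<Phi>'_def dft2_def dft_def s_def)
    ultimately show ?thesis using M by (simp add: gen_bernoulli_1[unfolded One_nat_def] right_diff_distrib sum_subtractf)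
  qed auto
  have reorder: "- D - x / y + s = - x / y - D + s" for D x y s :: complex by simp
  show ?thesis
    using G12 unfolding \<Phi>'_def[symmetric] F1(3)[rule_format, OF k] F2(3)[rule_format, OF k] c1 c2 reorder eis_const_def \<Phi>'_def[symmetric] .
qed

subsection \<open>Dirichlet series at nonpositive integers\<close>

definition falling :: "nat \<Rightarrow> complex \<Rightarrow> complex" where
  "falling j a = (\<Prod>l<j. a - of_nat l)"

lemma falling_Suc: "falling (Suc j) a = falling j a * (a - of_nat j)"
  by (simp add: falling_def mult.commute)

lemma falling_0 [simp]: "falling 0 a = 1" by (simp add: falling_def)

lemma falling_of_nat: "j \<le> k \<Longrightarrow> falling j (of_nat k) = fact k / fact (k - j)"
proof (induction j)
  case (Suc j)
  have "k - j = Suc (k - Suc j)" using Suc.prems by simp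
  hence fct: "fact (k - j) = (of_nat (k - j) :: complex) * fact (k - Suc j)"
    by (metis fact_Suc)
  have d: "of_nat k - of_nat j = (of_nat (k - j) :: complex)"
    by (rule of_nat_diff[symmetric]) (use Suc.prems in auto)
  have "of_nat (k - j) \<noteq> (0 :: complex)" using Suc.prems by auto
  moreover have "falling j (of_nat k) = fact k / fact (k - j)" using Suc by simp
  ultimately show ?case unfolding falling_Suc d fct by (simp only: times_divide_eq_left nonzero_mult_divide_mult_cancel_right mult.commute[of "of_nat (k - j)"] not_False_eq_True)
qed auto

lemma falling_of_nat_eq_0: "j > k \<Longrightarrow> falling j (of_nat k) = 0"
  by (auto simp: falling_def)

lemma holomorphic_on_falling [holomorphic_intros]:
  "f holomorphic_on A \<Longrightarrow> (\<lambda>s. falling j (f s)) holomorphic_on A"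
  unfolding falling_def by (intro holomorphic_intros)

text \<open>The negative of the Taylor remainder of order J of x powr (1 - s) between m and m +
  N.\<close>

definition powr_remainder :: "nat \<Rightarrow> nat \<Rightarrow> complex \<Rightarrow> nat \<Rightarrow> complex" where
  "powr_remainder N J s m = of_nat m powr (1 - s) - of_nat (m + N) powr (1 - s) +
     (\<Sum>j=1..J. falling j (1 - s) / fact j * of_nat N ^ j * of_nat m powr (1 - s - of_nat j))"

text \<open>Taylor's formula on the segment from m to m + N. For Re s > 1 - J the exponent -Re s - J
  is below -1, so the bound is summable over m.\<close>

lemma norm_powr_remainder_le:
  assumes m: "m \<ge> 1" and s: "Re s > 1 - real J"
  shows "norm (powr_remainder N J s m) \<le>
           norm (falling (Suc J) (1 - s)) * real m powr (- Re s - J) * real N ^ Suc J / fact J"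
proof -
  define a where "a = 1 - s"
  define S where "S = complex_of_real ` {real m..real (m + N)}"
  define f where "f = (\<lambda>i z. falling i a * z powr (a - of_nat i))"
  have S: "z \<in> S \<Longrightarrow> z \<notin> \<real>\<^sub>\<le>\<^sub>0" for z using m by (auto simp: S_def complex_nonpos_Reals_iff)
  have "norm (f 0 (of_nat (m + N)) - (\<Sum>i\<le>J. f i (of_nat m) * (of_nat (m + N) - of_nat m) ^ i / fact i)) \<le>
          (norm (falling (Suc J) a) * real m powr (Re a - real (Suc J))) * norm (of_nat (m + N) - of_nat m :: complex) ^ Suc J / fact J"
  proof (rule complex_Taylor[where S = S])
    show "convex S" unfolding S_def
      by (intro convex_linear_image) (auto intro!: bounded_linear.linear bounded_linear_of_real)
    fix i z assume "z \<in> S"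
    show "(f i has_field_derivative f (Suc i) z) (at z within S)"
      unfolding f_def using S[OF \<open>z \<in> S\<close>]
      by (auto intro!: derivative_eq_intros simp: falling_Suc algebra_simps)
  next
    fix z assume "z \<in> S"
    then obtain x where x: "z = of_real x" "x \<ge> m" by (auto simp: S_def)
    have "norm (z powr (a - of_nat (Suc J))) = x powr (Re a - real (Suc J))"
      using x m by (subst norm_powr_real_powr) auto
    also have "\<dots> \<le> real m powr (Re a - real (Suc J))"
      using x m s by (intro powr_mono2') (auto simp: a_def)
    finally show "norm (f (Suc J) z) \<le> norm (falling (Suc J) a) * real m powr (Re a - real (Suc J))"
      unfolding f_def norm_mult by (intro mult_left_mono) auto
  next
    show "of_nat m \<in> S" unfolding S_def by (rule image_eqI[of _ _ "real m"]) auto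
    show "of_nat (m + N) \<in> S" unfolding S_def by (rule image_eqI[of _ _ "real (m + N)"]) auto
  qed
  also have "f 0 (of_nat (m + N)) - (\<Sum>i\<le>J. f i (of_nat m) * (of_nat (m + N) - of_nat m) ^ i / fact i) = - powr_remainder N J s m"
  proof -
    have "{..J} = insert 0 {1..J}" by auto
    thus ?thesis by (simp add: f_def powr_remainder_def a_def mult_ac)
  qed
  also have "Re a - real (Suc J) = - Re s - real J" by (simp add: a_def)
  finally show ?thesis by (simp add: a_def norm_minus_commute)
qed

text \<open>At s = 1 - k the function is the polynomial x^k, whose Taylor expansion of order J \<ge>
  k is exact. At these points the continuation therefore becomes a finite recursion.\<close>

lemma powr_remainder_of_nat:
  assumes "k \<le> J" "m \<ge> 1"
  shows "powr_remainder N J (1 - of_nat k) m = 0"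
proof -
  have "(\<Sum>j=1..J. falling j (of_nat k) / fact j * of_nat N ^ j * of_nat m powr (of_nat k - of_nat j)) =
        (\<Sum>j=1..k. falling j (of_nat k) / fact j * of_nat N ^ j * of_nat m powr (of_nat k - of_nat j))"
    using assms by (intro sum.mono_neutral_right) (auto simp: falling_of_nat_eq_0)
  also have "\<dots> = (\<Sum>j=1..k. of_nat (k choose j) * of_nat N ^ j * of_nat m ^ (k - j))"
  proof (intro sum.cong refl)
    fix j assume j: "j \<in> {1..k}"
    have "of_nat m powr (of_nat k - of_nat j) = (of_nat m :: complex) ^ (k - j)"
    proof -
      have "of_nat k - of_nat j = (of_nat (k - j) :: complex)" using j by (simp add: of_nat_diff)
      thus ?thesis using assms by (simp only: powr_nat') auto
    qed
    moreover have "falling j (of_nat k) / fact j = of_nat (k choose j)"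
      using j by (simp add: falling_of_nat binomial_fact)
    ultimately show "falling j (of_nat k) / fact j * of_nat N ^ j * of_nat m powr (of_nat k - of_nat j) =
      of_nat (k choose j) * of_nat N ^ j * of_nat m ^ (k - j)" by simp
  qed
  also have "of_nat m ^ k + \<dots> = (\<Sum>j\<le>k. of_nat (k choose j) * of_nat N ^ j * of_nat m ^ (k - j))"
  proof -
    have "{..k} = insert 0 {1..k}" by auto
    thus ?thesis by simp
  qed
  also have "\<dots> = (of_nat N + of_nat m :: complex) ^ k"
    by (rule binomial_ring[symmetric])
  finally have "(\<Sum>j=1..J. falling j (of_nat k) / fact j * of_nat N ^ j * of_nat m powr (of_nat k - of_nat j)) =
       (of_nat (m + N)) ^ k - of_nat m ^ k" by (simp add: algebra_simps)
  moreover have "of_nat x powr of_nat k = (of_nat x :: complex) ^ k" if "x \<ge> 1" for x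
    using that by (simp add: powr_nat')
  ultimately show ?thesis using assms by (simp add: powr_remainder_def del: of_nat_add)
qed

section \<open>Analytic continuation of Dirichlet series with periodic coefficients\<close>

definition dirichlet_series :: "(int \<Rightarrow> complex) \<Rightarrow> complex \<Rightarrow> complex" where
  "dirichlet_series \<phi> s = (\<Sum>n. \<phi> (int (Suc n)) / of_nat (Suc n) powr s)"

lemma summable_Suc_powr: "c < -1 \<Longrightarrow> summable (\<lambda>n. real (Suc n) powr c)"
  using summable_Suc_iff[of "\<lambda>n. real n powr c"] by (simp add: summable_real_powr_iff)

lemma dirichlet_series_sums:
  assumes \<phi>: "\<And>n. norm (\<phi> n) \<le> B" and s: "Re s > 1"
  shows "(\<lambda>n. \<phi> (int (Suc n)) / of_nat (Suc n) powr s) sums dirichlet_series \<phi> s"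
  unfolding dirichlet_series_def
proof (rule summable_sums, rule summable_comparison_test')
  show "summable (\<lambda>n. B * real (Suc n) powr (- Re s))"
    using s by (intro summable_mult summable_Suc_powr) auto
  fix n :: nat
  have "norm (of_nat (Suc n) powr s) = real (Suc n) powr Re s"
    by (subst norm_powr_real_powr) (auto simp del: of_nat_Suc)
  hence "norm (\<phi> (int (Suc n)) / of_nat (Suc n) powr s) = norm (\<phi> (int (Suc n))) * real (Suc n) powr (- Re s)"
    by (simp add: norm_mult norm_inverse powr_minus divide_inverse del: of_nat_Suc)
  also have "\<dots> \<le> B * real (Suc n) powr (- Re s)" by (intro mult_right_mono \<phi>) auto
  finally show "norm (\<phi> (int (Suc n)) / of_nat (Suc n) powr s) \<le> B * real (Suc n) powr (- Re s)" .
qed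

lemma mod_periodic_bounded:
  fixes \<phi> :: "int \<Rightarrow> complex"
  assumes "mod_periodic N \<phi>" "N > 0"
  obtains B where "B > 0" "\<And>n. norm (\<phi> n) \<le> B"
proof -
  have "biperiodic N 1 (\<lambda>n _. \<phi> n)" using assms by (simp add: biperiodic_def mod_periodic_def)
  from biperiodic_bounded[OF this assms(2)] show ?thesis using that by auto
qed

text \<open>By periodicity the sum telescopes with step N, and for Re s > 1 the powers tend to 0, so
  only the first N terms survive.\<close>

lemma periodic_telescope_sums:
  fixes \<phi> :: "int \<Rightarrow> complex"
  assumes \<phi>: "mod_periodic N \<phi>" and N: "N > 0" and s: "Re s > 1"
  shows "(\<lambda>n. \<phi> (int (Suc n)) * (of_nat (Suc n) powr (1 - s) - of_nat (Suc n + N) powr (1 - s))) sums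
           (\<Sum>n<N. \<phi> (int (Suc n)) * of_nat (Suc n) powr (1 - s))"
proof -
  obtain B where B: "B > 0" "\<And>n. norm (\<phi> n) \<le> B" using mod_periodic_bounded[OF \<phi> N] by blast
  define u where "u = (\<lambda>n. \<phi> (int (Suc n)) * of_nat (Suc n) powr (1 - s))"
  have u_shift: "\<phi> (int (Suc n)) * (of_nat (Suc n) powr (1 - s) - of_nat (Suc n + N) powr (1 - s)) = u n - u (n + N)" for n
  proof -
    have "\<phi> (int (Suc (n + N))) = \<phi> (int (Suc n))"
      by (rule mod_periodicD[OF \<phi>]) (simp add: cong_iff_dvd_diff)
    thus ?thesis by (simp add: u_def right_diff_distrib)
  qed
  have sum: "(\<Sum>n<T. u n - u (n + N)) = (\<Sum>n<N. u n) - (\<Sum>n<N. u (n + T))" for T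
  proof (induction T)
    case (Suc T)
    have "(\<Sum>n<N. u (n + Suc T)) + u T = (\<Sum>n<Suc N. u (n + T))"
      by (subst sum.lessThan_Suc_shift) simp
    hence "(\<Sum>n<N. u (n + Suc T)) = (\<Sum>n<N. u (n + T)) + u (T + N) - u T"
      by (simp add: algebra_simps)
    thus ?case using Suc by simp
  qed auto
  have "u \<longlonglongrightarrow> 0"
  proof (rule Lim_null_comparison)
    have "norm (u n) \<le> B * real (Suc n) powr (1 - Re s)" for n
    proof -
      have "norm (of_nat (Suc n) powr (1 - s)) = real (Suc n) powr (1 - Re s)"
        by (subst norm_powr_real_powr) (auto simp del: of_nat_Suc)
      thus ?thesis unfolding u_def norm_mult by (simp only: mult_right_mono B powr_ge_zero)
    qed
    thus "\<forall>\<^sub>F n in sequentially. norm (u n) \<le> B * real (Suc n) powr (1 - Re s)" by simp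
    have "filterlim (\<lambda>n. real (Suc n)) at_top sequentially"
      using filterlim_real_sequentially filterlim_sequentially_Suc by blast
    hence "(\<lambda>n. real (Suc n) powr (1 - Re s)) \<longlonglongrightarrow> 0"
      by (rule tendsto_neg_powr[rotated]) (use s in auto)
    thus "(\<lambda>n. B * real (Suc n) powr (1 - Re s)) \<longlonglongrightarrow> 0"
      by (rule tendsto_mult_right_zero)
  qed
  hence "(\<lambda>T. u (n + T)) \<longlonglongrightarrow> 0" for n
    by (subst add.commute) (rule LIMSEQ_ignore_initial_segment)
  hence "(\<lambda>T. (\<Sum>n<N. u n) - (\<Sum>n<N. u (n + T))) \<longlonglongrightarrow> (\<Sum>n<N. u n) - (\<Sum>n<N. 0)"
    by (intro tendsto_intros)
  thus ?thesis unfolding sums_def u_shift sum by (simp add: u_def)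
qed

definition remainder_series :: "nat \<Rightarrow> (int \<Rightarrow> complex) \<Rightarrow> nat \<Rightarrow> complex \<Rightarrow> complex" where
  "remainder_series N \<phi> J s = (\<Sum>n. \<phi> (int (Suc n)) * powr_remainder N J s (Suc n))"

lemma holomorphic_on_remainder_series:
  assumes B: "\<And>n. norm (\<phi> n) \<le> B"
  shows "remainder_series N \<phi> J holomorphic_on {s. Re s > 1 - real J}"
  unfolding remainder_series_def
proof (rule holomorphic_on_suminf)
  let ?A = "{s. Re s > 1 - real J}"
  show "open ?A" by (intro open_Collect_less continuous_intros)
  show "(\<lambda>z. \<phi> (int (Suc n)) * powr_remainder N J z (Suc n)) holomorphic_on ?A" for n
    unfolding powr_remainder_def by (intro holomorphic_intros) auto
  fix x assume x: "x \<in> ?A"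
  define d where "d = (Re x - (1 - real J)) / 2"
  have d: "d > 0" using x by (simp add: d_def)
  have re: "Re y + real J \<ge> 1 + d" if "y \<in> cball x d" for y
    using that abs_Re_le_cmod[of "x - y"] by (auto simp: dist_norm d_def field_simps)
  have "compact ((\<lambda>s. falling (Suc J) (1 - s)) ` cball x d)"
    by (intro compact_continuous_image holomorphic_on_imp_continuous_on holomorphic_intros) auto
  hence "bounded ((\<lambda>s. falling (Suc J) (1 - s)) ` cball x d)" by (rule compact_imp_bounded)
  then obtain C where "\<forall>v\<in>(\<lambda>s. falling (Suc J) (1 - s)) ` cball x d. norm v \<le> C"
    unfolding bounded_iff by blast
  hence C: "norm (falling (Suc J) (1 - y)) \<le> C" if "y \<in> cball x d" for y
    using that by blast
  have "B \<ge> 0" by (rule order_trans[OF norm_ge_zero B[of 0]])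
  have "C \<ge> 0" by (rule order_trans[OF norm_ge_zero C[of x]]) (use d in auto)
  define K where "K = B * (C * real N ^ Suc J / fact J)"
  show "\<exists>d>0. \<exists>M. cball x d \<subseteq> ?A \<and> summable M \<and>
          (\<forall>\<^sub>F n in sequentially. \<forall>y\<in>cball x d. norm (\<phi> (int (Suc n)) * powr_remainder N J y (Suc n)) \<le> M n)"
  proof (intro exI conjI)
    show "d > 0" by (rule d)
    show "cball x d \<subseteq> ?A" using re d by force
    show "summable (\<lambda>n. K * real (Suc n) powr (- (1 + d)))"
      using d by (intro summable_mult summable_Suc_powr) auto
    show "\<forall>\<^sub>F n in sequentially. \<forall>y\<in>cball x d. norm (\<phi> (int (Suc n)) * powr_remainder N J y (Suc n)) \<le> K * real (Suc n) powr (- (1 + d))"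
    proof (intro always_eventually allI ballI)
      fix n y assume y: "y \<in> cball x d"
      have "norm (powr_remainder N J y (Suc n)) \<le>
           norm (falling (Suc J) (1 - y)) * real (Suc n) powr (- Re y - J) * real N ^ Suc J / fact J"
        using re[OF y] d by (intro norm_powr_remainder_le) auto
      also have "\<dots> \<le> C * real (Suc n) powr (- (1 + d)) * real N ^ Suc J / fact J"
        using re[OF y] C[OF y] \<open>C \<ge> 0\<close>
        by (intro divide_right_mono mult_right_mono mult_mono powr_mono) auto
      finally have "norm (powr_remainder N J y (Suc n)) \<le> C * real (Suc n) powr (- (1 + d)) * real N ^ Suc J / fact J" .
      hence "norm (\<phi> (int (Suc n)) * powr_remainder N J y (Suc n)) \<le> B * (C * real (Suc n) powr (- (1 + d)) * real N ^ Suc J / fact J)"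
        unfolding norm_mult using B \<open>B \<ge> 0\<close> by (intro mult_mono) auto
      thus "norm (\<phi> (int (Suc n)) * powr_remainder N J y (Suc n)) \<le> K * real (Suc n) powr (- (1 + d))"
        by (simp add: K_def mult_ac)
    qed
  qed
qed

text \<open>
  Expanding \<open>(m + N) powr (1 - s)\<close> binomially in the telescoping sum above expresses
  \<open>(s - 1) L(s)\<close> through its values at \<open>s + 1, s + 2, \<dots>\<close>.
\<close>

definition continuation_step :: "nat \<Rightarrow> (int \<Rightarrow> complex) \<Rightarrow> nat \<Rightarrow> (complex \<Rightarrow> complex) \<Rightarrow> complex \<Rightarrow> complex" where
  "continuation_step N \<phi> J Z s =
     ((\<Sum>n<N. \<phi> (int (Suc n)) * of_nat (Suc n) powr (1 - s)) - remainder_series N \<phi> J s -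
      (\<Sum>j=2..J. falling (j - 1) (1 - s) / fact j * of_nat N ^ j * Z (s + of_nat j - 1))) / of_nat N"

text \<open>The term j = 1 of the expansion is (1 - s) N L(s), the one to solve for.\<close>

lemma continuation_step_eq:
  fixes \<phi> :: "int \<Rightarrow> complex"
  assumes \<phi>: "mod_periodic N \<phi>" and N: "N > 0" and s: "Re s > 1" and J: "J \<ge> 1"
    and Z: "\<And>s. Re s > 1 \<Longrightarrow> Z s = (s - 1) * dirichlet_series \<phi> s"
  shows "continuation_step N \<phi> J Z s = (s - 1) * dirichlet_series \<phi> s"
proof -
  obtain B where B: "B > 0" "\<And>n. norm (\<phi> n) \<le> B" using mod_periodic_bounded[OF \<phi> N] by blast
  let ?L = "dirichlet_series \<phi>" and ?T = "\<Sum>n<N. \<phi> (int (Suc n)) * of_nat (Suc n) powr (1 - s)"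
  define c where "c = (\<lambda>j. falling j (1 - s) / fact j * of_nat N ^ j)"
  have eq: "\<phi> (int (Suc n)) * powr_remainder N J s (Suc n) =
       \<phi> (int (Suc n)) * (of_nat (Suc n) powr (1 - s) - of_nat (Suc n + N) powr (1 - s)) +
       (\<Sum>j=1..J. c j * (\<phi> (int (Suc n)) / of_nat (Suc n) powr (s + of_nat j - 1)))" for n
  proof -
    have "of_nat (Suc n) powr (1 - s - of_nat j) = inverse (of_nat (Suc n) powr (s + of_nat j - 1) :: complex)" for j
      by (subst powr_minus[symmetric]) (simp add: algebra_simps)
    thus ?thesis
      by (simp add: powr_remainder_def distrib_left sum_distrib_left c_def divide_inverse mult_ac del: of_nat_Suc of_nat_add)
  qed
  have "(\<lambda>n. \<phi> (int (Suc n)) * powr_remainder N J s (Suc n)) sums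
           (?T + (\<Sum>j=1..J. c j * ?L (s + of_nat j - 1)))"
    unfolding eq
    by (intro sums_add periodic_telescope_sums \<phi> N s sums_sum sums_mult dirichlet_series_sums[OF B(2)]) (use s in auto)
  hence "remainder_series N \<phi> J s = ?T + (\<Sum>j=1..J. c j * ?L (s + of_nat j - 1))"
    unfolding remainder_series_def by (rule sums_unique[symmetric])
  moreover have "{1..J} = insert 1 {2..J}" using J by auto
  ultimately have R: "remainder_series N \<phi> J s = ?T + (1 - s) * of_nat N * ?L s + (\<Sum>j=2..J. c j * ?L (s + of_nat j - 1))"
    by (simp add: c_def falling_def)
  \<comment> \<open>The last factor of \<open>falling j (1 - s)\<close> is minus the factor s + j -
    2 by which Z differs from the Dirichlet series at s + j - 1; hence Z comes with
    \<open>falling (j - 1)\<close>.\<close>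
  have "(\<Sum>j=2..J. falling (j - 1) (1 - s) / fact j * of_nat N ^ j * Z (s + of_nat j - 1)) =
        (\<Sum>j=2..J. - c j * ?L (s + of_nat j - 1))"
  proof (intro sum.cong refl)
    fix j assume j: "j \<in> {2..J}"
    then obtain i where i: "j = Suc i" "i \<ge> 1" by (cases j) auto
    define w where "w = 1 - s - of_nat i"
    have "Z (s + of_nat j - 1) = (s + of_nat j - 1 - 1) * ?L (s + of_nat j - 1)"
      using s i by (intro Z) auto
    also have "s + of_nat j - 1 - 1 = - w" by (simp add: i w_def)
    finally have 1: "Z (s + of_nat j - 1) = - w * ?L (s + of_nat j - 1)" .
    have 2: "falling j (1 - s) = falling (j - 1) (1 - s) * w" by (simp add: i falling_Suc w_def)
    show "falling (j - 1) (1 - s) / fact j * of_nat N ^ j * Z (s + of_nat j - 1) = - c j * ?L (s + of_nat j - 1)"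
      unfolding 1 2 c_def by (simp add: divide_inverse mult_ac)
  qed
  hence "continuation_step N \<phi> J Z s = ((s - 1) * of_nat N * ?L s) / of_nat N"
    unfolding continuation_step_def R by (simp add: sum_negf algebra_simps)
  thus ?thesis using N by simp
qed

text \<open>The factor s - 1 removes the only possible pole. A continuation to Re s > 1 - (J - 1)
  yields one to Re s > 1 - J, as the step involves Z only at s + 1, ..., s + J - 1; the identity
  theorem glues the pieces.\<close>

lemma entire_continuation:
  fixes \<phi> :: "int \<Rightarrow> complex"
  assumes \<phi>: "mod_periodic N \<phi>" and N: "N > 0"
  obtains Z where "Z holomorphic_on UNIV" "\<And>s. Re s > 1 \<Longrightarrow> Z s = (s - 1) * dirichlet_series \<phi> s"
    "\<And>J s. J \<ge> 1 \<Longrightarrow> Re s > 1 - real J \<Longrightarrow> Z s = continuation_step N \<phi> J Z s"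
proof -
  obtain B where B: "B > 0" "\<And>n. norm (\<phi> n) \<le> B" using mod_periodic_bounded[OF \<phi> N] by blast
  define H where "H = (\<lambda>J. {s. Re s > 1 - real J})"
  have H: "open (H J)" "connected (H J)" for J
    by (auto simp: H_def convex_halfspace_Re_gt intro!: open_Collect_less continuous_intros convex_connected)
  have step_hol: "continuation_step N \<phi> J Z holomorphic_on H J"
    if "J \<ge> 1" "J = 1 \<or> Z holomorphic_on H (J - 1)" for Z J
  proof -
    have "(\<lambda>s. Z (s + of_nat j - 1)) holomorphic_on H J" if "j \<in> {2..J}" for j
    proof (rule holomorphic_on_compose_gen[where f = "\<lambda>s. s + of_nat j - 1" and g = Z, unfolded o_def])
      show "Z holomorphic_on H (J - 1)" using that \<open>J = 1 \<or> _\<close> by auto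
    qed (use that in \<open>auto simp: H_def of_nat_diff intro!: holomorphic_intros\<close>)
    moreover have "remainder_series N \<phi> J holomorphic_on H J"
      unfolding H_def by (rule holomorphic_on_remainder_series[OF B(2)])
    ultimately show ?thesis
      unfolding continuation_step_def [abs_def] by (intro holomorphic_intros) (use N in auto)
  qed
  have identity: "f s = g s" if "f holomorphic_on H J" "g holomorphic_on H J" "s \<in> H J" "J \<ge> 1"
    "\<And>s. Re s > 1 \<Longrightarrow> f s = g s" for f g J s
  proof -
    have "f s - g s = 0"
    proof (rule analytic_continuation_open[of "{s. Re s > 1}" "H J" "\<lambda>s. f s - g s" "\<lambda>_. 0"])
      show "open {s. Re s > 1}" by (intro open_Collect_less continuous_intros)
      have "2 \<in> {s :: complex. Re s > 1}" by simp
      thus "{s :: complex. Re s > 1} \<noteq> {}" by blast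
      show "{s. Re s > 1} \<subseteq> H J" by (auto simp: H_def)
    qed (use that H in \<open>auto intro!: holomorphic_intros\<close>)
    thus ?thesis by simp
  qed
  have "\<exists>Z. Z holomorphic_on H J \<and> (\<forall>s. Re s > 1 \<longrightarrow> Z s = (s - 1) * dirichlet_series \<phi> s)" if "J \<ge> 1" for J
    using that
  proof (induction J rule: nat_induct_at_least)
    \<comment> \<open>For J = 1 the sum over j from 2 is empty, so the series itself may be inserted
      without knowing any holomorphy.\<close>
    case base
    define Z0 where "Z0 = (\<lambda>s. (s - 1) * dirichlet_series \<phi> s)"
    show ?case
      by (rule exI[of _ "continuation_step N \<phi> 1 Z0"])
         (use step_hol[of 1 Z0] continuation_step_eq[OF \<phi> N, of _ 1 Z0] in \<open>auto simp: Z0_def\<close>)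
  next
    case (Suc J)
    then obtain Z where Z: "Z holomorphic_on H J" "\<forall>s. Re s > 1 \<longrightarrow> Z s = (s - 1) * dirichlet_series \<phi> s" by blast
    show ?case
      by (rule exI[of _ "continuation_step N \<phi> (Suc J) Z"])
         (use step_hol[of "Suc J" Z] continuation_step_eq[OF \<phi> N, of _ "Suc J" Z] Z in auto)
  qed
  then obtain ZZ where ZZ: "\<And>J. J \<ge> 1 \<Longrightarrow> ZZ J holomorphic_on H J"
    "\<And>J s. J \<ge> 1 \<Longrightarrow> Re s > 1 \<Longrightarrow> ZZ J s = (s - 1) * dirichlet_series \<phi> s" by metis
  have H_mono: "H J \<subseteq> H J'" if "J \<le> J'" for J J' using that by (auto simp: H_def)
  have ZZ_eq: "ZZ J s = ZZ J' s" if "1 \<le> J" "J \<le> J'" "s \<in> H J" for J J' s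
  proof (rule identity[of "ZZ J" J "ZZ J'" s])
    show "ZZ J holomorphic_on H J" using ZZ that by auto
    show "ZZ J' holomorphic_on H J"
      by (rule holomorphic_on_subset[OF ZZ(1)[of J'] H_mono]) (use that in auto)
  qed (use that ZZ in auto)
  \<comment> \<open>The added 1 keeps Re s > 1 - J strict when Re s is an integer, and J at least
    1.\<close>
  define idx where "idx = (\<lambda>s. nat \<lceil>1 - Re s\<rceil> + 1)"
  define Z where "Z = (\<lambda>s. ZZ (idx s) s)"
  have idx: "s \<in> H (idx s)" "idx s \<ge> 1" for s
  proof -
    have "1 - Re s \<le> real (nat \<lceil>1 - Re s\<rceil>)" by linarith
    thus "s \<in> H (idx s)" by (simp add: H_def idx_def)
  qed (simp add: idx_def)
  have Z_eq: "Z s = ZZ J s" if "s \<in> H J" "J \<ge> 1" for s J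
    unfolding Z_def
  proof (cases "J \<le> idx s")
    case True
    thus "ZZ (idx s) s = ZZ J s" using that by (intro ZZ_eq[symmetric])
  next
    case False
    thus "ZZ (idx s) s = ZZ J s" using that idx[of s] by (intro ZZ_eq) auto
  qed
  have Z_hol: "Z holomorphic_on H J" if "J \<ge> 1" for J
    using ZZ(1)[OF that] Z_eq that by (subst holomorphic_cong[OF refl, of _ _ "ZZ J"]) auto
  have Z_L: "Z s = (s - 1) * dirichlet_series \<phi> s" if "Re s > 1" for s
    using Z_eq[of s 1] ZZ(2)[of 1 s] that by (simp add: H_def)
  have "Z holomorphic_on (\<Union>J\<in>{1..}. H J)"
    by (rule holomorphic_on_UN_open) (use Z_hol H in auto)
  also have "(\<Union>J\<in>{1..}. H J) = UNIV" using idx by fastforce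
  finally have "Z holomorphic_on UNIV" .
  moreover have "Z s = continuation_step N \<phi> J Z s" if "J \<ge> 1" "Re s > 1 - real J" for J s
  proof (rule identity[of Z J "continuation_step N \<phi> J Z" s])
    show "Z holomorphic_on H J" using Z_hol that by auto
    show "continuation_step N \<phi> J Z holomorphic_on H J"
      by (rule step_hol[OF that(1)]) (use Z_hol[of "J - 1"] that in \<open>cases "J = 1"; auto\<close>)
    show "Z s = continuation_step N \<phi> J Z s" if "Re s > 1" for s
      using continuation_step_eq[OF \<phi> N that \<open>J \<ge> 1\<close> Z_L] Z_L[OF that] by simp
  qed (use that in \<open>auto simp: H_def\<close>)
  ultimately show ?thesis using that Z_L by blast
qed

text \<open>The continuation step at s = 1 - i is the recursion for the coefficients of the
  Bernoulli series, so Z(1 - i) are Bernoulli numbers. Residues run over 1, ..., N here and over 0,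
  ..., N - 1 in \<open>gen_bernoulli\<close>; the difference \<phi>(0) t is felt only for k =
  1.\<close>

theorem dirichlet_L_nonpos_int:
  fixes \<phi> :: "int \<Rightarrow> complex"
  assumes \<phi>: "mod_periodic N \<phi>" and N: "N > 0" and k: "k \<ge> 1" "k \<ge> 2 \<or> \<phi> 0 = 0"
  shows "dirichlet_L \<phi> (1 - of_nat k) = - gen_bernoulli k N \<phi> / of_nat k"
proof -
  obtain Z where Z: "Z holomorphic_on UNIV" "\<And>s. Re s > 1 \<Longrightarrow> Z s = (s - 1) * dirichlet_series \<phi> s"
    "\<And>J s. J \<ge> 1 \<Longrightarrow> Re s > 1 - real J \<Longrightarrow> Z s = continuation_step N \<phi> J Z s"
    using entire_continuation[OF \<phi> N] by blast
  define z where "z = (\<lambda>i. Z (1 - of_nat i))"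
  have rec: "of_nat N * z i = (\<Sum>n<N. \<phi> (int (Suc n)) * of_nat (Suc n) ^ i) -
               (\<Sum>j=2..Suc i. fact i / fact (Suc i - j) / fact j * of_nat N ^ j * z (Suc i - j))" for i
  proof -
    have "z i = continuation_step N \<phi> (Suc i) Z (1 - of_nat i)"
      unfolding z_def by (rule Z(3)) auto
    also have "remainder_series N \<phi> (Suc i) (1 - of_nat i) = 0"
      unfolding remainder_series_def by (subst powr_remainder_of_nat) auto
    hence "continuation_step N \<phi> (Suc i) Z (1 - of_nat i) =
       ((\<Sum>n<N. \<phi> (int (Suc n)) * of_nat (Suc n) powr (of_nat i)) -
      (\<Sum>j=2..Suc i. falling (j - 1) (of_nat i) / fact j * of_nat N ^ j * Z (1 - of_nat i + of_nat j - 1))) / of_nat N"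
      by (simp add: continuation_step_def del: of_nat_Suc)
    also have "(\<Sum>n<N. \<phi> (int (Suc n)) * of_nat (Suc n) powr (of_nat i)) = (\<Sum>n<N. \<phi> (int (Suc n)) * of_nat (Suc n) ^ i)"
      by (simp add: powr_nat' del: of_nat_Suc)
    also have "(\<Sum>j=2..Suc i. falling (j - 1) (of_nat i) / fact j * of_nat N ^ j * Z (1 - of_nat i + of_nat j - 1)) =
        (\<Sum>j=2..Suc i. fact i / fact (Suc i - j) / fact j * of_nat N ^ j * z (Suc i - j))"
      by (intro sum.cong refl) (auto simp: falling_of_nat z_def of_nat_diff Suc_diff_le algebra_simps intro!: arg_cong[where f = Z])
    finally show ?thesis using N by simp
  qed
  define F where "F = Abs_fps (\<lambda>i. z i / fact i)"
  let ?S = "\<Sum>r<N. fps_const (\<phi> (int r)) * fps_exp (of_nat r)"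
  let ?S' = "\<Sum>n<N. fps_const (\<phi> (int (Suc n))) * fps_exp (of_nat (Suc n))"
  let ?E = "fps_exp (of_nat N) - 1 :: complex fps"
  have "F * ?E = fps_X * ?S'"
  proof (rule fps_ext)
    fix n
    show "fps_nth (F * ?E) n = fps_nth (fps_X * ?S') n"
    proof (cases n)
      case (Suc i)
      have "fps_nth (?E * F) n = (\<Sum>j=0..Suc i. fps_nth ?E j * fps_nth F (Suc i - j))"
        by (simp add: fps_mult_nth Suc)
      also have "{0..Suc i} = insert 0 (insert 1 {2..Suc i})" by auto
      also have "(\<Sum>j\<in>\<dots>. fps_nth ?E j * fps_nth F (Suc i - j)) =
          of_nat N * z i / fact i + (\<Sum>j=2..Suc i. of_nat N ^ j / fact j * (z (Suc i - j) / fact (Suc i - j)))"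
        by (simp add: F_def)
      also have "\<dots> = (of_nat N * z i + (\<Sum>j=2..Suc i. fact i / fact (Suc i - j) / fact j * of_nat N ^ j * z (Suc i - j))) / fact i"
        by (simp add: add_divide_distrib sum_divide_distrib mult_ac)
      also have "\<dots> = (\<Sum>n<N. \<phi> (int (Suc n)) * of_nat (Suc n) ^ i) / fact i"
        by (subst rec) simp
      also have "\<dots> = fps_nth (fps_X * ?S') n"
        by (simp add: Suc fps_sum_nth sum_divide_distrib del: of_nat_Suc)
      finally show ?thesis by (simp add: mult.commute)
    qed (simp add: fps_mult_nth)
  qed
  also have "?S' = ?S + fps_const (\<phi> 0) * ?E"
  proof -
    have "\<phi> (int N) = \<phi> 0" by (rule mod_periodicD[OF \<phi>]) (simp add: cong_def)
    hence "?S' + fps_const (\<phi> 0) = ?S + fps_const (\<phi> 0) * fps_exp (of_nat N)"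
      using sum.lessThan_Suc_shift[of "\<lambda>r. fps_const (\<phi> (int r)) * fps_exp (of_nat r)" N]
      by (simp add: add.commute)
    thus ?thesis by (simp add: algebra_simps)
  qed
  finally have "(F - fps_const (\<phi> 0) * fps_X) * ?E = fps_X * ?S"
    by (simp add: algebra_simps)
  hence "bernoulli_fps N \<phi> = F - fps_const (\<phi> 0) * fps_X"
    by (intro bernoulli_fps_unique N)
  hence B: "gen_bernoulli k N \<phi> = z k"
    using k by (auto simp: gen_bernoulli_conv_fps F_def)
  show ?thesis
    unfolding dirichlet_L_def
  proof (rule the_equality)
    have "(\<lambda>s. Z s / (s - 1)) holomorphic_on UNIV - {1}"
      using holomorphic_on_subset[OF Z(1)] by (intro holomorphic_intros) auto
    moreover have "connected (UNIV - {1 :: complex})" "open (UNIV - {1 :: complex})"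
      using connected_punctured_universe[of "1 :: complex"] by (auto simp: open_delete Compl_eq_Diff_UNIV)
    moreover have "(1 :: complex) - of_nat k \<noteq> 1" using k by simp
    moreover have "Z z / (z - 1) = (\<Sum>n. \<phi> (int (Suc n)) / of_nat (Suc n) powr z)" if "Re z > 1" for z
      using Z(2)[OF that] that by (auto simp: dirichlet_series_def)
    moreover have "- gen_bernoulli k N \<phi> / of_nat k = Z (1 - of_nat k) / (1 - of_nat k - 1)"
      unfolding B z_def using k by simp
    moreover have "{z. Re z > 1} \<subseteq> UNIV - {1 :: complex}" by auto
    ultimately show "\<exists>U L. open U \<and> connected U \<and> {z. Re z > 1} \<subseteq> U \<and> 1 - of_nat k \<in> U \<and>
     L holomorphic_on U \<and> (\<forall>z. Re z > 1 \<longrightarrow> L z = (\<Sum>n. \<phi> (int (Suc n)) / of_nat (Suc n) powr z)) \<and>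
      - gen_bernoulli k N \<phi> / of_nat k = L (1 - of_nat k)"
      by (intro exI[of _ "UNIV - {1}"] exI[of _ "\<lambda>s. Z s / (s - 1)"]) simp
  next
    fix v assume "\<exists>U L. open U \<and> connected U \<and> {z. Re z > 1} \<subseteq> U \<and> 1 - of_nat k \<in> U \<and>
     L holomorphic_on U \<and> (\<forall>z. Re z > 1 \<longrightarrow> L z = (\<Sum>n. \<phi> (int (Suc n)) / of_nat (Suc n) powr z)) \<and>
      v = L (1 - of_nat k)"
    then obtain U L where UL: "open U" "connected U" "{z. Re z > 1} \<subseteq> U" "1 - of_nat k \<in> U"
      "L holomorphic_on U" "\<And>z. Re z > 1 \<Longrightarrow> L z = dirichlet_series \<phi> z" "v = L (1 - of_nat k)"
      unfolding dirichlet_series_def by blast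
    \<comment> \<open>The domain U may contain 1, where Z / (s - 1) can have a pole; so the
      comparison is made after multiplying by s - 1.\<close>
    have "(1 - of_nat k - 1) * L (1 - of_nat k) - Z (1 - of_nat k) = 0"
    proof (rule analytic_continuation_open[of "{s. Re s > 1}" U "\<lambda>s. (s - 1) * L s - Z s" "\<lambda>_. 0"])
      show "open {s. Re s > 1}" by (intro open_Collect_less continuous_intros)
      have "2 \<in> {s :: complex. Re s > 1}" by simp
      thus "{s :: complex. Re s > 1} \<noteq> {}" by blast
      show "(\<lambda>s. (s - 1) * L s - Z s) holomorphic_on U"
        using UL holomorphic_on_subset[OF Z(1)] by (intro holomorphic_intros) auto
    qed (use UL Z(2) in auto)
    thus "v = - gen_bernoulli k N \<phi> / of_nat k"
      using k UL(7) by (simp add: B z_def field_simps) (metis minus_minus)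
  qed
qed

subsection \<open>Dirichlet characters and Gauss sums\<close>

lemma dirichlet_characterD:
  assumes "dirichlet_character M \<psi>"
  shows "M > 0" "mod_periodic M \<psi>" "\<psi> 1 = 1" "\<psi> (a * b) = \<psi> a * \<psi> b" "\<psi> a = 0 \<longleftrightarrow> \<not> coprime a (int M)"
proof -
  note 1 = assms[unfolded dirichlet_character_def]
  note 2 = conjunct2[OF 1]
  note 3 = conjunct2[OF 2]
  note 4 = conjunct2[OF 3]
  show "M > 0" by (rule conjunct1[OF 1])
  show "mod_periodic M \<psi>" unfolding mod_periodic_def by (rule conjunct1[OF 2])
  show "\<psi> 1 = 1" by (rule conjunct1[OF 3])
  show "\<psi> (a * b) = \<psi> a * \<psi> b" by (rule spec[OF spec[OF conjunct1[OF 4]]])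
  show "\<psi> a = 0 \<longleftrightarrow> \<not> coprime a (int M)" by (rule spec[OF conjunct2[OF 4]])
qed

lemma character_power: "dirichlet_character M \<psi> \<Longrightarrow> \<psi> (a ^ n) = \<psi> a ^ n"
  by (induction n) (simp_all add: dirichlet_characterD)

text \<open>Powers of a value of modulus above 1 would be unbounded, but they are again values of
  \<psi>.\<close>

lemma norm_character_le_1:
  assumes "dirichlet_character M \<psi>"
  shows "norm (\<psi> a) \<le> 1"
proof (rule ccontr)
  assume "\<not> norm (\<psi> a) \<le> 1"
  obtain B where B: "\<And>n. norm (\<psi> n) \<le> B"
    using mod_periodic_bounded[OF dirichlet_characterD(2)[OF assms] dirichlet_characterD(1)[OF assms]] by blast
  obtain n where "B < norm (\<psi> a) ^ n"
    using real_arch_pow[of "norm (\<psi> a)" B] \<open>\<not> norm (\<psi> a) \<le> 1\<close> by auto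
  with B[of "a ^ n"] show False by (simp add: character_power[OF assms] norm_power)
qed

text \<open>Both values have modulus at most 1 and their product is 1, so the inverse is the
  conjugate.\<close>

lemma character_inverse:
  assumes "dirichlet_character M \<psi>" "[a * b = 1] (mod int M)"
  shows "\<psi> a * \<psi> b = 1" "\<psi> b = cnj (\<psi> a)"
proof -
  show 1: "\<psi> a * \<psi> b = 1"
    using mod_periodicD[OF dirichlet_characterD(2)[OF assms(1)] assms(2)] dirichlet_characterD(3,4)[OF assms(1)] by simp
  have "norm (\<psi> a) * norm (\<psi> b) = 1" using 1 by (metis norm_mult norm_one)
  moreover have "norm (\<psi> a) * norm (\<psi> b) \<le> norm (\<psi> a)"
    using norm_character_le_1[OF assms(1)] by (intro mult_left_le) auto
  ultimately have "norm (\<psi> a) = 1" using norm_character_le_1[OF assms(1), of a] by linarith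
  hence "\<psi> a * cnj (\<psi> a) = 1" using complex_norm_square[of "\<psi> a"] by simp
  with 1 show "\<psi> b = cnj (\<psi> a)" by (metis mult_cancel_left mult_zero_left zero_neq_one)
qed

lemma character_minus_1:
  assumes "dirichlet_character M \<psi>"
  shows "\<psi> (- 1) * \<psi> (- 1) = 1" "cnj (\<psi> (- 1)) = \<psi> (- 1)"
proof -
  have "[- 1 * - 1 = 1] (mod int M)" by simp
  from character_inverse[OF assms this] show "\<psi> (- 1) * \<psi> (- 1) = 1" "cnj (\<psi> (- 1)) = \<psi> (- 1)" by simp_all
qed

lemma character_minus: "dirichlet_character M \<psi> \<Longrightarrow> \<psi> (- a) = \<psi> (- 1) * \<psi> a"
  using dirichlet_characterD(4)[of M \<psi> "- 1" a] by simp

lemma character_0: "dirichlet_character M \<psi> \<Longrightarrow> \<psi> 0 = (if M = 1 then 1 else 0)"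
proof (cases "M = 1")
  case True
  assume *: "dirichlet_character M \<psi>"
  have "\<psi> 0 = \<psi> 1" by (rule mod_periodicD[OF dirichlet_characterD(2)[OF *]]) (simp add: True)
  thus ?thesis using True dirichlet_characterD(3)[OF *] by simp
qed (auto simp: dirichlet_characterD(5))

lemma character_mod_1: "dirichlet_character 1 \<psi> \<Longrightarrow> \<psi> = (\<lambda>_. 1)"
  using mod_periodicD[OF dirichlet_characterD(2), of 1 \<psi> _ 1] dirichlet_characterD(3)[of 1 \<psi>] by auto

lemma dirichlet_character_conj: "dirichlet_character M \<psi> \<Longrightarrow> dirichlet_character M (conj_char \<psi>)"
  unfolding dirichlet_character_def conj_char_def by (metis complex_cnj_mult complex_cnj_one complex_cnj_zero_iff)

lemma dirichlet_character_mult: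
  assumes "dirichlet_character M \<phi>" "dirichlet_character N \<psi>"
  shows "dirichlet_character (M * N) (\<lambda>a. \<phi> a * \<psi> a)"
  unfolding dirichlet_character_def
proof (intro conjI allI impI)
  note D = dirichlet_characterD[OF assms(1)] and E = dirichlet_characterD[OF assms(2)]
  show "M * N > 0" using D(1) E(1) by simp
  show "\<phi> 1 * \<psi> 1 = 1" using D(3) E(3) by simp
  fix a b :: int
  show "\<phi> (a * b) * \<psi> (a * b) = \<phi> a * \<psi> a * (\<phi> b * \<psi> b)" by (simp add: D(4) E(4))
  show "\<phi> a * \<psi> a = 0 \<longleftrightarrow> \<not> coprime a (int (M * N))" by (simp add: D(5) E(5))
  assume "[a = b] (mod int (M * N))"
  hence "[a = b] (mod int M)" "[a = b] (mod int N)" by (auto elim: cong_dvd_modulus)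
  thus "\<phi> a * \<psi> a = \<phi> b * \<psi> b" using mod_periodicD[OF D(2)] mod_periodicD[OF E(2)] by metis
qed

lemma coprime_int_iff_primes:
  "coprime a (int M) \<longleftrightarrow> (\<forall>p. prime p \<and> p dvd M \<longrightarrow> \<not> int p dvd a)"
proof (intro iffI allI impI notI)
  fix p assume "coprime a (int M)" "prime p \<and> p dvd M" "int p dvd a"
  hence "is_unit (int p)" by (intro coprime_common_divisor[of a "int M" "int p"]) auto
  thus False using \<open>prime p \<and> p dvd M\<close> by auto
next
  assume *: "\<forall>p. prime p \<and> p dvd M \<longrightarrow> \<not> int p dvd a"
  show "coprime a (int M)"
  proof (rule ccontr)
    assume "\<not> coprime a (int M)"
    hence "nat (gcd a (int M)) \<noteq> 1" by (simp add: coprime_iff_gcd_eq_1)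
    then obtain p where p: "prime p" "p dvd nat (gcd a (int M))" using prime_factor_nat by blast
    have "int p dvd int (nat (gcd a (int M)))" using p(2) by (simp only: int_dvd_int_iff)
    hence "int p dvd gcd a (int M)" by simp
    hence "int p dvd a" "p dvd M" by auto
    thus False using * p(1) by blast
  qed
qed

text \<open>Surjectivity of reduction on unit groups. With t the product of the primes dividing N
  but not x, every prime divisor of N divides exactly one of x and N' t, hence not their
  sum.\<close>

lemma coprime_lift:
  assumes "N > 0" "N' dvd N" "coprime x (int N')"
  obtains y where "[y = x] (mod int N')" "coprime y (int N)"
proof -
  define P where "P = {p. prime p \<and> p dvd N \<and> \<not> int p dvd x}"
  define t where "t = \<Prod>P"
  have fin: "finite P" using assms(1) by (auto simp: P_def intro: finite_subset[OF _ finite_divisors_nat])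
  define y where "y = x + int N' * int t"
  have "coprime y (int N)"
  proof (rule ccontr)
    assume "\<not> coprime y (int N)"
    then obtain p where p: "prime p" "p dvd N" and py: "int p dvd y"
      unfolding coprime_int_iff_primes by blast
    have pp: "prime (int p)" using p(1) by simp
    show False
    proof (cases "int p dvd x")
      case False
      hence "p dvd t" using p fin unfolding t_def by (intro dvd_prodI) (auto simp: P_def)
      hence "int p dvd int N' * int t" by simp
      with py False show False unfolding y_def by (simp add: dvd_add_left_iff)
    next
      case True
      with py have "int p dvd int N' * int t" unfolding y_def by (simp add: dvd_add_right_iff)
      hence "p dvd N' \<or> p dvd t" using pp by (auto simp: prime_dvd_mult_iff)
      moreover have "\<not> p dvd N'"
        using True assms(3) pp by (metis coprime_common_divisor int_dvd_int_iff not_prime_unit)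
      moreover have "\<not> p dvd t"
      proof
        assume "p dvd t"
        then obtain q where "q \<in> P" "p dvd q"
          using p(1) fin unfolding t_def by (auto simp: prime_dvd_prod_iff)
        hence "p = q" using p(1) by (intro primes_dvd_imp_eq) (auto simp: P_def)
        with \<open>q \<in> P\<close> True show False by (simp add: P_def)
      qed
      ultimately show False by blast
    qed
  qed
  moreover have "[y = x] (mod int N')" by (simp add: y_def cong_def)
  ultimately show ?thesis using that by blast
qed

lemma induced_by_refl: "dirichlet_character M \<psi> \<Longrightarrow> induced_by M \<psi> M \<psi>"
  by (simp add: induced_by_def)

lemma conductor_le: "induced_by M \<psi> f \<phi> \<Longrightarrow> conductor M \<psi> \<le> f"
  unfolding conductor_def by (rule Least_le) blast

text \<open>Makes the \<open>THE\<close> of \<open>associated_primitive\<close> meaningful: a class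
  coprime to f has a representative coprime to M.\<close>

lemma induced_by_unique:
  assumes "M > 0" "induced_by M \<psi> f \<phi>" "induced_by M \<psi> f \<phi>'"
  shows "\<phi> = \<phi>'"
proof
  fix a
  have ch: "dirichlet_character f \<phi>" "dirichlet_character f \<phi>'" using assms by (auto simp: induced_by_def)
  show "\<phi> a = \<phi>' a"
  proof (cases "coprime a (int f)")
    case True
    then obtain y where y: "[y = a] (mod int f)" "coprime y (int M)"
      using coprime_lift[of M f a] assms by (auto simp: induced_by_def)
    have "\<phi> y = \<phi> a" "\<phi>' y = \<phi>' a"
      using mod_periodicD[OF dirichlet_characterD(2)[OF ch(1)] y(1)]
        mod_periodicD[OF dirichlet_characterD(2)[OF ch(2)] y(1)] by auto
    thus ?thesis using assms y(2) by (auto simp: induced_by_def)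
  next
    case False
    thus ?thesis using dirichlet_characterD(5)[OF ch(1)] dirichlet_characterD(5)[OF ch(2)] by metis
  qed
qed

text \<open>Primitivity comes from transitivity of induction: a smaller modulus for the associated
  character would induce \<psi> too, against the minimality of its conductor.\<close>

lemma associated_primitive:
  assumes "dirichlet_character M \<psi>"
  shows "induced_by M \<psi> (conductor M \<psi>) (associated_primitive M \<psi>)"
    and "primitive_character (conductor M \<psi>) (associated_primitive M \<psi>)"
    and "\<psi> a = (if coprime a (int M) then associated_primitive M \<psi> a else 0)"
proof -
  define f where "f = conductor M \<psi>"
  have "\<exists>\<phi>. induced_by M \<psi> f \<phi>"
    unfolding f_def conductor_def by (rule LeastI_ex) (use induced_by_refl[OF assms] in blast)
  hence "\<exists>!\<phi>. induced_by M \<psi> f \<phi>"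
    using induced_by_unique[OF dirichlet_characterD(1)[OF assms]] by blast
  hence ind: "induced_by M \<psi> f (associated_primitive M \<psi>)"
    unfolding associated_primitive_def f_def[symmetric] by (rule theI')
  show "induced_by M \<psi> (conductor M \<psi>) (associated_primitive M \<psi>)" using ind by (simp add: f_def)
  have ch: "dirichlet_character f (associated_primitive M \<psi>)" using ind by (simp add: induced_by_def)
  have "f \<le> conductor f (associated_primitive M \<psi>)"
  proof -
    have "\<exists>\<phi>. induced_by f (associated_primitive M \<psi>) (conductor f (associated_primitive M \<psi>)) \<phi>"
      unfolding conductor_def by (rule LeastI_ex) (use induced_by_refl[OF ch] in blast)
    then obtain \<phi> where \<phi>: "induced_by f (associated_primitive M \<psi>) (conductor f (associated_primitive M \<psi>)) \<phi>" by blast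
    have "coprime a (int M) \<Longrightarrow> coprime a (int f)" for a
      using ind by (auto simp: induced_by_def elim: coprime_divisors[rotated 2])
    hence "induced_by M \<psi> (conductor f (associated_primitive M \<psi>)) \<phi>"
      using \<phi> ind by (auto simp: induced_by_def intro: dvd_trans)
    thus ?thesis unfolding f_def by (rule conductor_le)
  qed
  moreover have "conductor f (associated_primitive M \<psi>) \<le> f"
    using conductor_le[OF induced_by_refl[OF ch]] .
  ultimately show "primitive_character (conductor M \<psi>) (associated_primitive M \<psi>)"
    using ch by (simp add: primitive_character_def f_def)
  show "\<psi> a = (if coprime a (int M) then associated_primitive M \<psi> a else 0)"
    using ind dirichlet_characterD(5)[OF assms, of a] by (auto simp: induced_by_def)
qed

text \<open>Were \<theta> trivial on the units congruent to 1 modulo N', it would factor through the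
  units modulo N' and have conductor at most N'.\<close>

lemma primitive_nontrivial_on_kernel:
  assumes prim: "primitive_character N \<theta>" and N': "N' dvd N" "N' < N"
  shows "\<exists>a. coprime a (int N) \<and> [a = 1] (mod int N') \<and> \<theta> a \<noteq> 1"
proof (rule ccontr)
  assume "\<not> ?thesis"
  hence triv: "\<theta> a = 1" if "coprime a (int N)" "[a = 1] (mod int N')" for a using that by blast
  have ch: "dirichlet_character N \<theta>" using prim by (simp add: primitive_character_def)
  note D = dirichlet_characterD[OF ch]
  have "N' > 0" using N' D(1) by (auto intro: Nat.gr0I)
  have eq: "\<theta> y = \<theta> y'" if y: "coprime y (int N)" "coprime y' (int N)" "[y = y'] (mod int N')" for y y'
  proof -
    obtain z where z: "[y' * z = 1] (mod int N)" using y(2) cong_solve_coprime_int by blast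
    hence z': "[y' * z = 1] (mod int N')" using N'(1) by (meson cong_dvd_modulus int_dvd_int_iff)
    have "[y * z = y' * z] (mod int N')" using y(3) by (rule cong_scalar_right)
    hence "[y * z = 1] (mod int N')" using z' cong_trans by blast
    moreover have "coprime (y * z) (int N)"
      using y(1) z by (metis coprime_mult_left_iff coprime_iff_invertible_int mult.commute)
    ultimately have "\<theta> y * \<theta> z = 1" using triv D(4) by metis
    moreover have "\<theta> y' * \<theta> z = 1" using character_inverse(1)[OF ch z] .
    ultimately show ?thesis by (metis mult_cancel_right mult_zero_right zero_neq_one)
  qed
  \<comment> \<open>Any representative coprime to N; by \<open>eq\<close> the value of \<theta>
    there does not depend on the choice.\<close>
  define lift where "lift = (\<lambda>x. SOME y. [y = x] (mod int N') \<and> coprime y (int N))"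
  have lift: "[lift x = x] (mod int N')" "coprime (lift x) (int N)" if "coprime x (int N')" for x
  proof -
    obtain y where "[y = x] (mod int N') \<and> coprime y (int N)"
      using coprime_lift[OF D(1) N'(1) \<open>coprime x (int N')\<close>] by blast
    hence "[lift x = x] (mod int N') \<and> coprime (lift x) (int N)" unfolding lift_def by (rule someI)
    thus "[lift x = x] (mod int N')" "coprime (lift x) (int N)" by auto
  qed
  have cop: "coprime x (int N')" if "coprime x (int N)" for x
    using that N'(1) by (auto elim: coprime_divisors[rotated 2])
  define \<phi> where "\<phi> = (\<lambda>x. if coprime x (int N') then \<theta> (lift x) else 0)"
  have \<phi>: "\<phi> x = \<theta> y" if "coprime y (int N)" "[y = x] (mod int N')" for x y
  proof -
    have "coprime x (int N')" using cop[OF that(1)] that(2) by (simp add: cong_imp_coprime)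
    thus ?thesis unfolding \<phi>_def using lift[of x] that eq[of "lift x" y] cong_trans cong_sym by (metis (full_types))
  qed
  have "dirichlet_character N' \<phi>"
    unfolding dirichlet_character_def
  proof (intro conjI allI impI)
    show "N' > 0" by fact
    show "\<phi> 1 = 1" using \<phi>[of 1 1] D(3) by simp
    fix a b
    show "\<phi> a = 0 \<longleftrightarrow> \<not> coprime a (int N')"
      using lift[of a] D(5) by (auto simp: \<phi>_def)
    show "\<phi> a = \<phi> b" if "[a = b] (mod int N')"
    proof (cases "coprime a (int N')")
      case True
      have "[lift a = b] (mod int N')" using lift[OF True] that cong_trans by blast
      thus ?thesis using \<phi>[of "lift a" a] \<phi>[of "lift a" b] lift[OF True] by simp
    next
      case False
      hence "\<not> coprime b (int N')" using that cong_imp_coprime cong_sym by blast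
      with False show ?thesis by (simp add: \<phi>_def)
    qed
    show "\<phi> (a * b) = \<phi> a * \<phi> b"
    proof (cases "coprime a (int N') \<and> coprime b (int N')")
      case True
      hence "[lift a * lift b = a * b] (mod int N')" "coprime (lift a * lift b) (int N)"
        using lift by (auto intro: cong_mult)
      hence "\<phi> (a * b) = \<theta> (lift a * lift b)" by (intro \<phi>)
      thus ?thesis using True D(4) by (simp add: \<phi>_def)
    qed (auto simp: \<phi>_def)
  qed
  hence "induced_by N \<theta> N' \<phi>"
    unfolding induced_by_def using N'(1) \<phi> by (auto)
  hence "conductor N \<theta> \<le> N'" by (rule conductor_le)
  thus False using prim N'(2) by (simp add: primitive_character_def)
qed

section \<open>Fourier transforms of primitive characters\<close>

lemma gauss_sum_conv_dft: "gauss_sum N \<theta> = dft N \<theta> 1"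
  by (simp add: gauss_sum_def dft_def rt_def ee_def)

text \<open>Scaling the summation variable by a unit a brings out \<theta>(a). For v a unit take its
  inverse; otherwise take a with a v = v modulo N and \<theta>(a) \<noteq> 1, which forces
  0.\<close>

lemma dft_primitive:
  assumes "primitive_character N \<theta>"
  shows "dft N \<theta> v = cnj (\<theta> v) * gauss_sum N \<theta>"
proof -
  have ch: "dirichlet_character N \<theta>" using assms by (simp add: primitive_character_def)
  note D = dirichlet_characterD[OF ch]
  have reindex: "dft N \<theta> v = \<theta> a * dft N \<theta> (a * v)" if "coprime a (int N)" for a v
  proof -
    have "mod_periodic N (\<lambda>x. \<theta> x * rt N (x * v))"
      using mod_periodic_rt[OF D(1), of v] by (intro mod_periodic_mult D) (simp add: mult.commute)
    from sum_residues_mult[OF this D(1) that]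
    show ?thesis by (simp add: dft_def D sum_distrib_left mult_ac)
  qed
  show ?thesis
  proof (cases "coprime v (int N)")
    case True
    then obtain w where w: "[v * w = 1] (mod int N)" using cong_solve_coprime_int by blast
    hence "coprime w (int N)" by (metis coprime_iff_invertible_int mult.commute)
    hence "dft N \<theta> v = \<theta> w * dft N \<theta> (w * v)" by (rule reindex)
    also have "dft N \<theta> (w * v) = dft N \<theta> 1"
      by (rule mod_periodicD[OF mod_periodic_dft[OF D(1)]]) (use w in \<open>simp add: mult.commute\<close>)
    also have "\<theta> w = cnj (\<theta> v)" by (rule character_inverse(2)[OF ch w])
    finally show ?thesis by (simp add: gauss_sum_conv_dft)
  next
    case False
    define d where "d = gcd v (int N)"
    have "d \<ge> 0" "d \<noteq> 0" "d \<noteq> 1"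
      using False D(1) by (auto simp: d_def coprime_iff_gcd_eq_1)
    hence "d > 1" by linarith
    have d: "d > 1" "d dvd v" "d dvd int N"
      using \<open>d > 1\<close> by (auto simp: d_def)
    \<comment> \<open>For a v = v modulo N it suffices that a = 1 modulo N / gcd(v, N).\<close>
    define N' where "N' = N div nat d"
    have N: "N = N' * nat d" using d by (simp add: N'_def int_dvd_int_iff[symmetric] nat_dvd_iff)
    have "N' < N" using N D(1) d(1) by (auto intro: Nat.gr0I)
    then obtain a where a: "coprime a (int N)" "[a = 1] (mod int N')" "\<theta> a \<noteq> 1"
      using primitive_nontrivial_on_kernel[OF assms, of N'] N by auto
    have "int N dvd (a - 1) * v"
    proof -
      have "int N' dvd a - 1" using a(2) by (simp add: cong_iff_dvd_diff)
      hence "int N' * d dvd (a - 1) * v" using d(2) by (rule mult_dvd_mono)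
      thus ?thesis using N d(1) by simp
    qed
    hence "[a * v = v] (mod int N)" by (simp add: cong_iff_dvd_diff left_diff_distrib)
    hence "dft N \<theta> (a * v) = dft N \<theta> v" by (rule mod_periodicD[OF mod_periodic_dft[OF D(1)]])
    with reindex[OF a(1), of v] have "dft N \<theta> v = \<theta> a * dft N \<theta> v" by simp
    hence "dft N \<theta> v = 0" using a(3) by (metis mult_cancel_right1)
    thus ?thesis using False D(5) by simp
  qed
qed

text \<open>Fourier inversion for \<theta> at 1, after inserting
  \<open>dft_primitive\<close>.\<close>

lemma gauss_sum_mult_conj:
  assumes "primitive_character N \<theta>"
  shows "gauss_sum N \<theta> * gauss_sum N (conj_char \<theta>) = \<theta> (- 1) * of_nat N"
proof -
  have ch: "dirichlet_character N \<theta>" using assms by (simp add: primitive_character_def)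
  note D = dirichlet_characterD[OF ch]
  have "(\<Sum>b<N. dft N \<theta> (- int b) * rt N (int b * 1)) = of_nat N * \<theta> 1"
    by (rule dft_inverse[OF D(1,2)])
  moreover have "dft N \<theta> (- b) = \<theta> (- 1) * conj_char \<theta> b * gauss_sum N \<theta>" for b
    using character_minus[OF ch, of b] character_minus_1[OF ch]
    by (simp add: dft_primitive[OF assms] conj_char_def)
  hence "(\<Sum>b<N. dft N \<theta> (- int b) * rt N (int b * 1)) =
           \<theta> (- 1) * (gauss_sum N \<theta> * gauss_sum N (conj_char \<theta>))"
    unfolding gauss_sum_conv_dft[of N "conj_char \<theta>"] dft_def[of N "conj_char \<theta>"] sum_distrib_left
    by (intro sum.cong refl) (simp add: mult_ac)
  ultimately have "\<theta> (- 1) * (gauss_sum N \<theta> * gauss_sum N (conj_char \<theta>)) = of_nat N"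
    using D(3) by simp
  hence "\<theta> (- 1) * \<theta> (- 1) * (gauss_sum N \<theta> * gauss_sum N (conj_char \<theta>)) = \<theta> (- 1) * of_nat N"
    by (simp add: mult.assoc)
  thus ?thesis using character_minus_1[OF ch] by simp
qed

lemma gauss_sum_nonzero:
  assumes "primitive_character N \<theta>"
  shows "gauss_sum N \<theta> \<noteq> 0" "gauss_sum N (conj_char \<theta>) \<noteq> 0"
proof -
  have ch: "dirichlet_character N \<theta>" using assms by (simp add: primitive_character_def)
  have "\<theta> (- 1) \<noteq> 0" using character_minus_1(1)[OF ch] by auto
  hence "gauss_sum N \<theta> * gauss_sum N (conj_char \<theta>) \<noteq> 0"
    using dirichlet_characterD(1)[OF ch] by (simp add: gauss_sum_mult_conj[OF assms])
  thus "gauss_sum N \<theta> \<noteq> 0" "gauss_sum N (conj_char \<theta>) \<noteq> 0" by auto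
qed

text \<open>With residues written as l N + r, the sum over l is a full sum of L-th roots of unity
  and vanishes unless L divides y.\<close>

lemma dft_mult_period:
  assumes "mod_periodic N \<phi>" "N > 0" "L > 0"
  shows "dft (L * N) \<phi> y = (if int L dvd y then of_nat L * dft N \<phi> (y div int L) else 0)"
proof -
  have "dft (L * N) \<phi> y = (\<Sum>l<L. \<Sum>r<N. \<phi> (int (l * N + r)) * rt (L * N) (int (l * N + r) * y))"
    unfolding dft_def by (rule sum_lessThan_mult)
  also have "\<dots> = (\<Sum>l<L. \<Sum>r<N. rt L (y * int l) * (\<phi> (int r) * rt (L * N) (int r * y)))"
  proof (intro sum.cong refl)
    fix l r
    have "\<phi> (int (l * N + r)) = \<phi> (int r)"
      by (rule mod_periodicD[OF assms(1)]) (simp add: cong_iff_dvd_diff)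
    moreover have "int (l * N + r) * y = int N * (y * int l) + int r * y" by (simp add: algebra_simps)
    hence "rt (L * N) (int (l * N + r) * y) = rt (L * N) (int N * (y * int l)) * rt (L * N) (int r * y)"
      by (simp only: rt_add)
    moreover have "rt (L * N) (int N * (y * int l)) = rt L (y * int l)"
      using rt_mult_cancel[OF assms(2), of L "y * int l"] by (simp only: mult.commute)
    ultimately show "\<phi> (int (l * N + r)) * rt (L * N) (int (l * N + r) * y) =
        rt L (y * int l) * (\<phi> (int r) * rt (L * N) (int r * y))"
      by (simp only: mult_ac)
  qed
  also have "\<dots> = (\<Sum>l<L. rt L (y * int l)) * (\<Sum>r<N. \<phi> (int r) * rt (L * N) (int r * y))"
    by (simp add: sum_product)
  also have "\<dots> = (if int L dvd y then of_nat L * dft N \<phi> (y div int L) else 0)"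
  proof (cases "int L dvd y")
    case True
    then obtain z where z: "y = int L * z" by blast
    have "rt (L * N) (int r * y) = rt N (int r * z)" for r
      using rt_mult_cancel[OF assms(3), of N "int r * z"] by (simp add: z mult_ac)
    thus ?thesis using z assms by (simp add: sum_rt dft_def)
  qed (use assms in \<open>simp add: sum_rt\<close>)
  finally show ?thesis .
qed

text \<open>
  \<open>fourier_bernoulli k M X\<close> stands for a multiple of the regularised series \<open>\<Sum>n\<noteq>0. X n / n ^ k\<close>,
  so it depends neither on the choice of the period \<open>M\<close> nor on convergence.
\<close>

definition fourier_bernoulli :: "nat \<Rightarrow> nat \<Rightarrow> (int \<Rightarrow> complex) \<Rightarrow> complex" where
  "fourier_bernoulli k M X = gen_bernoulli k M (\<lambda>v. dft M X (- v)) / of_nat M ^ k"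

text \<open>The transform is multiplied by L and stretched to the multiples of L; the factor L^k
  produced by \<open>gen_bernoulli_scale\<close> cancels against the denominator.\<close>

lemma fourier_bernoulli_period:
  assumes "mod_periodic M X" "M > 0" "L > 0"
  shows "fourier_bernoulli k (L * M) X = fourier_bernoulli k M X"
proof -
  have "(\<lambda>v. dft (L * M) X (- v)) = (\<lambda>v. of_nat L * (if int L dvd v then dft M X (- (v div int L)) else 0))"
    using assms by (auto simp: dft_mult_period div_minus_right dvd_neg_div)
  thus ?thesis using gen_bernoulli_scale[OF assms(2,3), of k "\<lambda>v. dft M X (- v)"] assms
    by (simp add: fourier_bernoulli_def power_mult_distrib)
qed

text \<open>Formally the sum of Y(n) / (L n)^k.\<close>

lemma fourier_bernoulli_multiples:
  assumes "mod_periodic M Y" "M > 0" "L > 0"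
  shows "fourier_bernoulli k (L * M) (\<lambda>a. if int L dvd a then Y (a div int L) else 0) =
           fourier_bernoulli k M Y / of_nat L ^ k"
proof -
  have "dft (L * M) (\<lambda>a. if int L dvd a then Y (a div int L) else 0) v = dft M Y v" for v
  proof -
    have "dft (L * M) (\<lambda>a. if int L dvd a then Y (a div int L) else 0) v =
            dft (M * L) (\<lambda>a. if int L dvd a then Y (a div int L) else 0) v"
      by (simp only: mult.commute)
    also have "\<dots> = (\<Sum>l<M. \<Sum>r<L. (if int L dvd int (l * L + r) then Y (int (l * L + r) div int L) else 0) * rt (M * L) (int (l * L + r) * v))"
      unfolding dft_def by (rule sum_lessThan_mult)
    also have "\<dots> = (\<Sum>l<M. \<Sum>r<L. if r = 0 then Y (int l) * rt (M * L) (int (l * L) * v) else 0)"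
    proof (intro sum.cong refl)
      fix l r assume r: "r \<in> {..<L}"
      have "int L dvd int (l * L + r) \<longleftrightarrow> L dvd l * L + r" by (simp only: int_dvd_int_iff)
      also have "\<dots> \<longleftrightarrow> r = 0" using r by (auto simp: dvd_add_right_iff dest: nat_dvd_not_less)
      finally show "(if int L dvd int (l * L + r) then Y (int (l * L + r) div int L) else 0) * rt (M * L) (int (l * L + r) * v) =
            (if r = 0 then Y (int l) * rt (M * L) (int (l * L) * v) else 0)"
        using assms(3) by auto
    qed
    also have "\<dots> = (\<Sum>l<M. Y (int l) * rt (M * L) (int (l * L) * v))"
      using assms by (simp add: sum.delta)
    also have "\<dots> = dft M Y v"
      unfolding dft_def
    proof (intro sum.cong refl)
      fix l
      show "Y (int l) * rt (M * L) (int (l * L) * v) = Y (int l) * rt M (int l * v)"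
        using rt_mult_cancel[OF assms(3), of M "int l * v"] by (simp add: mult_ac)
    qed
    finally show ?thesis .
  qed
  moreover have "gen_bernoulli k (L * M) (\<lambda>v. dft M Y (- v)) = gen_bernoulli k M (\<lambda>v. dft M Y (- v))"
    by (intro gen_bernoulli_period assms mod_periodic_uminus mod_periodic_dft)
  ultimately show ?thesis by (simp add: fourier_bernoulli_def power_mult_distrib field_simps)
qed

lemma fourier_bernoulli_diff:
  assumes "M > 0"
  shows "fourier_bernoulli k M (\<lambda>a. X a - Y a) = fourier_bernoulli k M X - fourier_bernoulli k M Y"
proof -
  have "dft M (\<lambda>a. X a - Y a) v = dft M X v - dft M Y v" for v
    by (simp add: dft_def left_diff_distrib sum_subtractf)
  thus ?thesis using gen_bernoulli_diff[OF assms] by (simp add: fourier_bernoulli_def diff_divide_distrib)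
qed

lemma fourier_bernoulli_cmult:
  assumes "M > 0"
  shows "fourier_bernoulli k M (\<lambda>a. c * X a) = c * fourier_bernoulli k M X"
proof -
  have "dft M (\<lambda>a. c * X a) v = c * dft M X v" for v
    by (simp add: dft_def sum_distrib_left mult_ac)
  thus ?thesis using gen_bernoulli_cmult[OF assms] by (simp add: fourier_bernoulli_def)
qed

text \<open>The transform of a primitive character is a multiple of its conjugate, whence the Gauss
  sum and the conjugated Bernoulli number in \<open>S_const\<close>.\<close>

lemma fourier_bernoulli_primitive:
  assumes "primitive_character f \<theta>"
  shows "fourier_bernoulli k f \<theta> = \<theta> (- 1) * gauss_sum f \<theta> * cnj (gen_bernoulli k f \<theta>) / of_nat f ^ k"
proof -
  have ch: "dirichlet_character f \<theta>" using assms by (simp add: primitive_character_def)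
  have "(\<lambda>v. dft f \<theta> (- v)) = (\<lambda>v. \<theta> (- 1) * gauss_sum f \<theta> * cnj (\<theta> v))"
  proof
    fix v
    have "cnj (\<theta> (- v)) = \<theta> (- 1) * cnj (\<theta> v)"
      using character_minus[OF ch, of v] character_minus_1(2)[OF ch] by simp
    thus "dft f \<theta> (- v) = \<theta> (- 1) * gauss_sum f \<theta> * cnj (\<theta> v)"
      by (simp add: dft_primitive[OF assms])
  qed
  thus ?thesis
    by (simp add: fourier_bernoulli_def gen_bernoulli_cmult gen_bernoulli_cnj dirichlet_characterD(1)[OF ch])
qed

text \<open>Euler factors are removed one prime at a time: the terms at multiples of p contribute
  \<theta>(p) / p^k times the whole.\<close>

lemma fourier_bernoulli_remove_primes:
  assumes ch: "dirichlet_character f \<theta>" and M: "f dvd M" "M > 0"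
    and P: "finite P" "\<And>p. p \<in> P \<Longrightarrow> prime p \<and> p dvd M"
  shows "fourier_bernoulli k M (\<lambda>a. if \<forall>p\<in>P. \<not> int p dvd a then \<theta> a else 0) =
           (\<Prod>p\<in>P. 1 - \<theta> (int p) / of_nat p ^ k) * fourier_bernoulli k M \<theta>"
  using P
proof (induction P rule: finite_induct)
  case (insert p P)
  note D = dirichlet_characterD[OF ch]
  define X where "X = (\<lambda>a. if \<forall>q\<in>P. \<not> int q dvd a then \<theta> a else 0)"
  define Z where "Z = (\<lambda>a. if int p dvd a then \<theta> (int p) * X (a div int p) else 0)"
  have p: "prime p" "p dvd M" "p > 0" using insert.prems by (auto intro: prime_gt_0_nat)
  have X_per: "mod_periodic M X"
    unfolding mod_periodic_def
  proof (intro allI impI)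
    fix a b assume ab: "[a = b] (mod int M)"
    have "int q dvd a \<longleftrightarrow> int q dvd b" if "q \<in> P" for q
    proof -
      have "[a = b] (mod int q)" using ab insert.prems that by (meson cong_dvd_modulus int_dvd_int_iff insertCI)
      thus ?thesis by (rule cong_dvd_iff)
    qed
    moreover have "\<theta> a = \<theta> b" using mod_periodicD[OF mod_periodic_dvd[OF D(2) M(1)] ab] .
    ultimately show "X a = X b" by (simp add: X_def)
  qed
  \<comment> \<open>Multiplication by p does not affect divisibility by the other primes of
    P.\<close>
  have Z_eq: "Z a = (if int p dvd a then X a else 0)" for a
  proof (cases "int p dvd a")
    case True
    then obtain b where b: "a = int p * b" by blast
    have "int q dvd a \<longleftrightarrow> int q dvd b" if "q \<in> P" for q
    proof -
      have "prime q" "q \<noteq> p" using insert that by auto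
      hence "coprime (int q) (int p)" using p(1) by (simp add: primes_coprime)
      thus ?thesis unfolding b by (rule coprime_dvd_mult_right_iff)
    qed
    thus ?thesis using p(3) by (simp add: Z_def X_def b D(4))
  qed (simp add: Z_def)
  have Z_per: "mod_periodic M Z"
    unfolding mod_periodic_def
  proof (intro allI impI)
    fix a b assume ab: "[a = b] (mod int M)"
    have "int p dvd a \<longleftrightarrow> int p dvd b"
      using cong_dvd_modulus[OF ab, of "int p"] p(2) by (intro cong_dvd_iff) simp
    thus "Z a = Z b" using mod_periodicD[OF X_per ab] by (simp add: Z_eq)
  qed
  have "(\<lambda>a. if \<forall>q\<in>insert p P. \<not> int q dvd a then \<theta> a else 0) = (\<lambda>a. X a - Z a)"
    by (auto simp: fun_eq_iff Z_eq X_def)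
  hence "fourier_bernoulli k M (\<lambda>a. if \<forall>q\<in>insert p P. \<not> int q dvd a then \<theta> a else 0) =
           fourier_bernoulli k M X - fourier_bernoulli k M Z"
    using fourier_bernoulli_diff[OF M(2)] by simp
  \<comment> \<open>Dilating a function of period M by p gives the period p M, the one
    \<open>fourier_bernoulli_multiples\<close> expects.\<close>
  also have "fourier_bernoulli k M Z = fourier_bernoulli k (p * M) Z"
    by (rule fourier_bernoulli_period[OF Z_per M(2) p(3), symmetric])
  also have "\<dots> = fourier_bernoulli k M (\<lambda>a. \<theta> (int p) * X a) / of_nat p ^ k"
    unfolding Z_def using X_per
    by (intro fourier_bernoulli_multiples[OF _ M(2) p(3)]) (auto simp: mod_periodic_def)
  also have "\<dots> = \<theta> (int p) * fourier_bernoulli k M X / of_nat p ^ k"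
    by (simp add: fourier_bernoulli_cmult[OF M(2)])
  also have "fourier_bernoulli k M X = (\<Prod>p\<in>P. 1 - \<theta> (int p) / of_nat p ^ k) * fourier_bernoulli k M \<theta>"
    unfolding X_def using insert by auto
  finally show ?case using insert.hyps by (simp add: algebra_simps)
qed simp

text \<open>Removing the primes dividing M from the primitive character gives the Euler product of
  \<open>S_const\<close>, and passing between M and f is a change of period. Thus the constant term
  can be read off from \<psi> itself.\<close>

lemma S_const_conv_fourier_bernoulli:
  assumes "dirichlet_character M \<psi>"
  shows "S_const k M \<psi> = of_nat M ^ k * \<psi> (- 1) * fourier_bernoulli k M \<psi> / of_nat k"
proof -
  define f \<phi> where "f = conductor M \<psi>" and "\<phi> = associated_primitive M \<psi>"
  note A = associated_primitive[OF assms, folded f_def \<phi>_def]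
  have M: "M > 0" by (rule dirichlet_characterD(1)[OF assms])
  have f: "f dvd M" "dirichlet_character f \<phi>" using A(1) by (auto simp: induced_by_def)
  have f0: "f > 0" by (rule dirichlet_characterD(1)[OF f(2)])
  obtain L where L: "M = L * f" using f(1) by (metis dvd_div_mult_self)
  have "L > 0" using L M by (auto intro: Nat.gr0I)
  define P where "P = {p. prime p \<and> p dvd M}"
  have fin: "finite P" using M by (auto simp: P_def intro: finite_subset[OF _ finite_divisors_nat])
  have "coprime a (int M) \<longleftrightarrow> (\<forall>p\<in>P. \<not> int p dvd a)" for a
    unfolding coprime_int_iff_primes P_def by blast
  hence "\<psi> = (\<lambda>a. if \<forall>p\<in>P. \<not> int p dvd a then \<phi> a else 0)"
    using A(3) by (auto simp: fun_eq_iff)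
  hence "fourier_bernoulli k M \<psi> = (\<Prod>p\<in>P. 1 - \<phi> (int p) / of_nat p ^ k) * fourier_bernoulli k M \<phi>"
    using fourier_bernoulli_remove_primes[OF f(2,1) M fin, of k] by (simp add: P_def)
  also have "fourier_bernoulli k M \<phi> = fourier_bernoulli k f \<phi>"
    unfolding L by (intro fourier_bernoulli_period dirichlet_characterD[OF f(2)] \<open>L > 0\<close>)
  also have "\<dots> = \<phi> (- 1) * gauss_sum f \<phi> * cnj (gen_bernoulli k f \<phi>) / of_nat f ^ k"
    by (rule fourier_bernoulli_primitive[OF A(2)])
  finally have H: "fourier_bernoulli k M \<psi> = (\<Prod>p\<in>P. 1 - \<phi> (int p) / of_nat p ^ k) *
       (\<phi> (- 1) * gauss_sum f \<phi> * cnj (gen_bernoulli k f \<phi>) / of_nat f ^ k)" .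
  have "\<psi> (- 1) = \<phi> (- 1)" using A(3)[of "- 1"] by simp
  hence sq: "\<psi> (- 1) * \<phi> (- 1) = 1" using character_minus_1[OF f(2)] by simp
  have "of_nat M ^ k * \<psi> (- 1) * fourier_bernoulli k M \<psi> / of_nat k =
     (\<psi> (- 1) * \<phi> (- 1)) * ((of_nat M / of_nat f) ^ k * gauss_sum f \<phi> * (cnj (gen_bernoulli k f \<phi>) / of_nat k) *
         (\<Prod>p\<in>P. 1 - \<phi> (int p) / of_nat p ^ k))"
    unfolding H by (simp add: power_divide mult_ac)
  also have "\<dots> = S_const k M \<psi>"
    unfolding sq by (simp add: S_const_def Let_def f_def \<phi>_def P_def)
  finally show ?thesis ..
qed

section \<open>Divisor sums, gcd arithmetic and the constant term\<close>

text \<open>The double series collected by the product of its two variables; the divisor d is the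
  weighted one.\<close>

lemma eis_series_has_sum_divisors:
  fixes \<Phi> :: "int \<Rightarrow> int \<Rightarrow> complex" and M1 M2 :: nat
  assumes \<Phi>: "biperiodic M1 M2 \<Phi>" and M: "M1 > 0" "M2 > 0" and \<tau>: "Im \<tau> > 0"
  shows "((\<lambda>n. (\<Sum>d | d dvd n. (\<Phi> (int d) (int (n div d)) + (- 1) ^ k * \<Phi> (- int d) (- int (n div d))) * of_nat d ^ (k - 1)) *
             ee (of_nat n * \<tau> / of_nat M2)) has_sum eis_series k M2 \<tau> \<Phi>) {1..}"
proof -
  define f where "f = (\<lambda>(m, n). (\<Phi> (int n) (int m) + (- 1) ^ k * \<Phi> (- int n) (- int m)) * of_nat n ^ (k - 1) *
     ee (of_nat (m * n) * \<tau> / of_nat M2))"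
  obtain B where "B > 0" and B: "\<And>n m. norm (\<Phi> n m) \<le> B"
    using biperiodic_bounded[OF \<Phi> M] by blast
  have "norm (\<Phi> n m + (- 1) ^ k * \<Phi> (- n) (- m)) \<le> B + B" for n m
    using B[of n m] B[of "- n" "- m"] by (intro norm_triangle_le) (simp add: norm_mult norm_power)
  from double_series_weighted_summable[OF \<tau> M(2) this, of "\<lambda>n m. n" "\<lambda>n m. m" "k - 1"]
  have "(\<lambda>x. norm (f x)) summable_on ({1..} \<times> {1..})"
    by (simp add: f_def case_prod_unfold)
  hence "f summable_on ({1..} \<times> {1..})" by (rule abs_summable_summable)
  hence f: "(f has_sum eis_series k M2 \<tau> \<Phi>) ({1..} \<times> {1..})"
    unfolding eis_series_def f_def by (rule has_sum_infsum)
  also have "?this \<longleftrightarrow> ((\<lambda>(n, d). f (n div d, d)) has_sum eis_series k M2 \<tau> \<Phi>) (Sigma {1..} (\<lambda>n. {d. d dvd n}))"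
    by (rule has_sum_reindex_bij_witness[of _ "\<lambda>(n, d). (n div d, d)" "\<lambda>(m, n). (m * n, n)"])
       (auto simp: Suc_le_eq dvd_imp_le intro!: Nat.gr0I elim!: dvdE)
  finally have "((\<lambda>n. \<Sum>d | d dvd n. f (n div d, d)) has_sum eis_series k M2 \<tau> \<Phi>) {1..}"
    by (rule has_sum_SigmaD) (auto intro!: has_sum_finiteI finite_divisors_nat)
  also have "?this \<longleftrightarrow> ?thesis"
  proof (rule has_sum_cong)
    fix n :: nat
    show "(\<Sum>d | d dvd n. f (n div d, d)) = (\<Sum>d | d dvd n. (\<Phi> (int d) (int (n div d)) + (- 1) ^ k * \<Phi> (- int d) (- int (n div d))) * of_nat d ^ (k - 1)) *
             ee (of_nat n * \<tau> / of_nat M2)"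
      unfolding sum_distrib_right f_def by (intro sum.cong refl) (simp only: prod.case mem_Collect_eq dvd_div_mult_self)
  qed
  finally show ?thesis .
qed

text \<open>Here h = gcd(N, C/g), so that N (C/g') = (N g/g') (C/g) is the least common multiple of
  N and C/g.\<close>

lemma gcd_mult_quotients:
  fixes N g C :: nat
  assumes "N > 0" "g > 0" "C > 0" "g dvd C"
  defines "g' \<equiv> gcd (N * g) C"
  obtains h where "g' = g * h" "h > 0" "C div g = (C div g') * h" "N = (N * g div g') * h"
    "N * (C div g') = (N * g div g') * (C div g)" "coprime (N * g div g') (C div g')"
    "C div g' > 0" "N * g div g' > 0"
proof -
  have "g dvd g'" using assms by (simp add: g'_def)
  then obtain h where h: "g' = g * h" by blast
  have "g' > 0" using assms by (simp add: g'_def)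
  hence h0: "h > 0" using h by (auto intro: Nat.gr0I)
  obtain c where c: "C = g' * c" unfolding g'_def by (metis gcd_dvd2 dvdE)
  obtain r where r: "N * g = g' * r" unfolding g'_def by (metis gcd_dvd1 dvdE)
  have quot: "C div g' = c" "N * g div g' = r" using c r \<open>g' > 0\<close> by auto
  have "C div g = c * h" using c h assms(2) by (simp add: mult_ac)
  moreover have "N = r * h" using r h assms(2) by (simp add: mult_ac)
  moreover have "coprime (N * g div g') (C div g')"
    unfolding g'_def using assms by (intro div_gcd_coprime) auto
  moreover have "c > 0" "r > 0" using c r assms(1,2,3) by (auto intro: Nat.gr0I)
  moreover have "N * c = r * (C div g)"
    using \<open>C div g = c * h\<close> \<open>N = r * h\<close> by simp
  ultimately show ?thesis using that[of h] h h0 unfolding quot by blast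
qed

text \<open>Source of the case distinction in T_k. A nonzero value forces C/g1 to divide a, and N1
  g/g1 to be coprime to its multiple N1, hence 1; then C/g = (C/g1) N1, so C/g1 divides N2, to which
  a is coprime. This leaves C/g1 = 1.\<close>

lemma character_times_dft:
  fixes \<alpha> :: int and N1 N2 g C :: nat
  assumes prim: "primitive_character N1 \<theta>1" and ch: "dirichlet_character N2 \<theta>2"
    and g: "g > 0" "C > 0" "g dvd C" and \<alpha>: "coprime \<alpha> (int (C div g))" and dvd: "C div g dvd N1 * N2"
  defines "g1 \<equiv> gcd (N1 * g) C"
  shows "\<theta>2 a * dft (N1 * (C div g1)) \<theta>1 (\<alpha> * int (N1 * g div g1) * a) =
           (if C div g = N1 then gauss_sum N1 \<theta>1 * conj_char \<theta>1 \<alpha> * (conj_char \<theta>1 a * \<theta>2 a) else 0)"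
proof -
  have ch1: "dirichlet_character N1 \<theta>1" using prim by (simp add: primitive_character_def)
  note D1 = dirichlet_characterD[OF ch1] and D2 = dirichlet_characterD[OF ch]
  define c1 r1 where "c1 = C div g1" and "r1 = N1 * g div g1"
  obtain h where h: "h > 0" "C div g = c1 * h" "N1 = r1 * h" "N1 * c1 = r1 * (C div g)" "coprime r1 c1" "c1 > 0" "r1 > 0"
    using gcd_mult_quotients[OF D1(1) g] unfolding c1_def r1_def g1_def by metis
  have "coprime \<alpha> (int c1)" using \<alpha> h(2) by simp
  have dft_eq: "dft (N1 * c1) \<theta>1 y = (if int c1 dvd y then of_nat c1 * cnj (\<theta>1 (y div int c1)) * gauss_sum N1 \<theta>1 else 0)" for y
    using dft_mult_period[OF D1(2,1) h(6), of y] by (simp add: mult.commute[of N1] dft_primitive[OF prim])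
  show ?thesis
  proof (cases "C div g = N1")
    case True
    have "N1 * g = C" using True g(3) by (metis dvd_div_mult_self)
    hence "g1 = C" by (simp add: g1_def)
    hence "c1 = 1" using g by (simp add: c1_def)
    moreover have "r1 = 1" using True h(3) h(2) \<open>c1 = 1\<close> D1(1) by simp
    ultimately show ?thesis
      using True unfolding c1_def[symmetric] r1_def[symmetric]
      by (simp add: dft_primitive[OF prim] D1(4) conj_char_def)
  next
    case False
    have "\<theta>2 a * dft (N1 * c1) \<theta>1 (\<alpha> * int r1 * a) = 0"
    proof (rule ccontr)
      assume *: "\<theta>2 a * dft (N1 * c1) \<theta>1 (\<alpha> * int r1 * a) \<noteq> 0"
      hence "int c1 dvd \<alpha> * int r1 * a" by (auto simp: dft_eq split: if_splits)
      moreover have "coprime (int c1) (\<alpha> * int r1)"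
        using \<open>coprime \<alpha> (int c1)\<close> h(5) by (simp add: coprime_commute)
      ultimately have "int c1 dvd a" by (simp add: coprime_dvd_mult_right_iff)
      then obtain b where b: "a = int c1 * b" by blast
      have "(\<alpha> * int r1 * a) div int c1 = \<alpha> * int r1 * b" using h(6) by (simp add: b)
      hence "\<theta>1 (\<alpha> * int r1 * b) \<noteq> 0" using * by (auto simp: dft_eq split: if_splits)
      hence "coprime (int r1) (int N1)" using D1(5) by (simp add: D1(4))
      hence "coprime r1 N1" by simp
      moreover have "r1 dvd N1" using h(3) by simp
      ultimately have "r1 = 1" using coprime_absorb_left[of r1 N1] by simp
      hence "C div g = c1 * N1" using h(2,3) by simp
      hence "c1 * N1 dvd N2 * N1" using dvd by (simp add: mult.commute)
      hence "c1 dvd N2" using D1(1) by simp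
      moreover have "coprime a (int N2)" using * D2(5) by auto
      ultimately have "coprime a (int c1)" by (auto elim: coprime_divisors[rotated 2])
      hence "c1 = 1" using coprime_absorb_right[OF \<open>int c1 dvd a\<close>] by simp
      with \<open>C div g = c1 * N1\<close> False show False by simp
    qed
    thus ?thesis using False by (simp add: c1_def r1_def)
  qed
qed

lemma ee_powi: "ee x powi n = ee (of_int n * x)"
proof (cases "n \<ge> 0")
  case True
  then obtain m where "n = int m" by (metis nonneg_int_cases)
  thus ?thesis by (simp add: ee_power)
next
  case False
  then obtain m where m: "n = - int m" by (metis int_cases4 order_refl not_le_imp_less nat_0_le neg_0_le_iff_le minus_minus linear)
  thus ?thesis by (simp add: power_int_minus ee_power ee_minus)
qed

lemma zeta_root_powi: "zeta_root n powi x = rt n x"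
  using ee_powi[of "1 / of_nat n" x] by (simp add: rt_def zeta_root_def ee_def)

lemma qpow_conv_ee: "qpow \<tau> x = ee (\<tau> * of_real x)"
  by (simp add: qpow_def ee_def mult_ac)

text \<open>Summing over s2 forces s1 = \<alpha> y modulo c, because u inverts \<alpha>; what
  remains is c times the bilinear character.\<close>

lemma rt_bilinear_expansion:
  assumes "c > 0" and u: "[\<alpha> * u = 1] (mod int c)"
  shows "of_nat c * rt c (\<alpha> * x * y) =
           (\<Sum>s1<c. \<Sum>s2<c. rt c (int s1 * x) * rt c (int s2 * y) * rt c (- (u * int s1 * int s2)))"
proof -
  define s where "s = nat ((\<alpha> * y) mod int c)"
  have s: "int s = (\<alpha> * y) mod int c" "s < c" using assms(1) by (auto simp: s_def nat_less_iff)
  have iff: "int c dvd y - u * int s1 \<longleftrightarrow> s1 = s" if "s1 < c" for s1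
  proof -
    have "[\<alpha> * (u * t) = t] (mod int c)" for t
      using cong_scalar_right[OF u, of t] by (simp add: mult.assoc)
    hence inv: "[u * (\<alpha> * t) = t] (mod int c)" "[\<alpha> * (u * t) = t] (mod int c)" for t
      by (simp_all add: mult.left_commute)
    have "int c dvd y - u * int s1 \<longleftrightarrow> [y = u * int s1] (mod int c)" by (simp add: cong_iff_dvd_diff)
    also have "\<dots> \<longleftrightarrow> [\<alpha> * y = int s1] (mod int c)"
    proof
      assume "[y = u * int s1] (mod int c)"
      from cong_scalar_left[OF this, of \<alpha>] show "[\<alpha> * y = int s1] (mod int c)" using inv(2) cong_trans by blast
    next
      assume "[\<alpha> * y = int s1] (mod int c)"
      from cong_scalar_left[OF this, of u] show "[y = u * int s1] (mod int c)" using inv(1) cong_trans cong_sym by blast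
    qed
    also have "\<dots> \<longleftrightarrow> int s = int s1 mod int c" by (simp add: cong_def s)
    also have "\<dots> \<longleftrightarrow> s1 = s" using that by (auto simp flip: of_nat_mod)
    finally show ?thesis .
  qed
  have "(\<Sum>s1<c. \<Sum>s2<c. rt c (int s1 * x) * rt c (int s2 * y) * rt c (- (u * int s1 * int s2))) =
        (\<Sum>s1<c. rt c (int s1 * x) * (\<Sum>s2<c. rt c ((y - u * int s1) * int s2)))"
    unfolding sum_distrib_left mult.assoc rt_add[symmetric]
    by (intro sum.cong refl arg_cong2[where f = "(*)"] arg_cong[where f = "rt c"]) (auto simp: algebra_simps)
  also have "\<dots> = (\<Sum>s1<c. if s1 = s then of_nat c * rt c (int s * x) else 0)"
    using iff by (intro sum.cong refl) (auto simp: sum_rt[OF assms(1)])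
  also have "\<dots> = of_nat c * rt c (int s * x)"
    using s(2) by (simp add: sum.delta)
  also have "rt c (int s * x) = rt c (\<alpha> * x * y)"
  proof (rule rt_cong)
    have "[int s * x = \<alpha> * y * x] (mod int c)" unfolding s by (intro cong_mult) (simp_all add: cong_def)
    thus "[int s * x = \<alpha> * x * y] (mod int c)" by (simp add: mult_ac)
  qed (use assms in auto)
  finally show ?thesis ..
qed

lemma sum_int_residues:
  fixes f :: "int \<Rightarrow> complex"
  shows "(\<Sum>s | s \<in> {0..<int c} \<and> P s. f s) = (\<Sum>s<c. if P (int s) then f (int s) else 0)"
proof -
  have "(\<Sum>s | s \<in> {0..<int c} \<and> P s. f s) = (\<Sum>s\<in>{0..<int c}. if P s then f s else 0)"
    by (subst sum.inter_filter[symmetric]) (auto intro!: sum.cong)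
  also have "\<dots> = (\<Sum>s<c. if P (int s) then f (int s) else 0)"
    by (rule sum.reindex_bij_witness[of _ int nat]) auto
  finally show ?thesis .
qed

lemma sum_int_divisors:
  fixes f :: "int \<Rightarrow> complex"
  assumes "n > 0"
  shows "(\<Sum>m | m dvd int n. f m) = (\<Sum>d | d dvd n. f (int d) + f (- int d))"
proof -
  have fin: "finite {d. d dvd n}" using assms by (rule finite_divisors_nat)
  have "{m. m dvd int n} = int ` {d. d dvd n} \<union> (\<lambda>d. - int d) ` {d. d dvd n}"
  proof (intro equalityI subsetI)
    fix m assume m: "m \<in> {m. m dvd int n}"
    hence "nat \<bar>m\<bar> dvd n" by (simp add: nat_abs_dvd_iff)
    moreover have "m = int (nat \<bar>m\<bar>) \<or> m = - int (nat \<bar>m\<bar>)" by auto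
    ultimately show "m \<in> int ` {d. d dvd n} \<union> (\<lambda>d. - int d) ` {d. d dvd n}" by blast
  qed (auto simp: int_dvd_int_iff)
  moreover have "int ` {d. d dvd n} \<inter> (\<lambda>d. - int d) ` {d. d dvd n} = {}"
    using assms by (auto elim: dvdE)
  ultimately have "(\<Sum>m | m dvd int n. f m) = sum f (int ` {d. d dvd n}) + sum f ((\<lambda>d. - int d) ` {d. d dvd n})"
    using fin by (simp add: sum.union_disjoint)
  thus ?thesis by (simp add: sum.reindex inj_on_def sum.distrib)
qed

subsection \<open>Expansion at a cusp\<close>

text \<open>The hypotheses are symmetric in the indices 1 and 2 (see \<open>swap\<close>), so a fact
  about one index gives the other by interpretation. Of the matrix only A and C enter here.\<close>

locale cusp_expansion =
  fixes k N1 N2 e C :: nat and A u :: int and \<chi>1 \<chi>2 :: "int \<Rightarrow> complex"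
  assumes k: "k \<ge> 1"
    and prim1: "primitive_character N1 \<chi>1" and prim2: "primitive_character N2 \<chi>2"
    and parity: "\<chi>1 (- 1) * \<chi>2 (- 1) = (- 1) ^ k"
    and nontrivial: "\<not> (k = 2 \<and> \<chi>1 = (\<lambda>_. 1) \<and> \<chi>2 = (\<lambda>_. 1))"
    and e: "e \<ge> 1" and C: "C > 0" and C_dvd: "C dvd e * N1 * N2"
    and u: "[A * int (e div gcd e C) * u = 1] (mod int (C div gcd e C))"
begin

definition "g = gcd e C"
definition "g1 = gcd (N1 * g) C"
definition "g2 = gcd (N2 * g) C"
definition "c = C div g"
definition "c1 = C div g1"
definition "c2 = C div g2"
definition "r1 = N1 * g div g1"
definition "r2 = N2 * g div g2"
text \<open>M1 and M2 are the least common multiples of N1 and N2 with c: common periods of the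
  characters and of the twist modulo c.\<close>

definition "M1 = N1 * c1"
definition "M2 = N2 * c2"
text \<open>The fraction e A / C in lowest terms is \<alpha> / c.\<close>

definition "\<alpha> = A * int (e div g)"

lemma ch1: "dirichlet_character N1 \<chi>1" and ch2: "dirichlet_character N2 \<chi>2"
  using prim1 prim2 by (auto simp: primitive_character_def)

lemmas D1 = dirichlet_characterD[OF ch1] and D2 = dirichlet_characterD[OF ch2]

lemma g: "g > 0" "C > 0" "g dvd C"
  using C by (auto simp: g_def)

lemma quotients1: "M1 = r1 * c" "coprime r1 c1" "c1 > 0" "r1 > 0" "r1 * g1 = N1 * g" "c1 dvd c"
  using gcd_mult_quotients[OF D1(1) g] unfolding M1_def c1_def r1_def g1_def c_def
  by (metis, metis, metis, metis, metis gcd_dvd1 dvd_div_mult_self, metis dvd_triv_left)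

lemma swap: "cusp_expansion k N2 N1 e C A u \<chi>2 \<chi>1"
proof
  show "\<not> (k = 2 \<and> \<chi>2 = (\<lambda>_. 1) \<and> \<chi>1 = (\<lambda>_. 1))" using nontrivial by blast
qed (use k prim1 prim2 parity e C C_dvd u in \<open>auto simp: mult_ac\<close>)

lemma quotients2: "M2 = r2 * c" "coprime r2 c2" "c2 > 0" "r2 > 0" "r2 * g2 = N2 * g" "c2 dvd c"
proof -
  interpret S: cusp_expansion k N2 N1 e C A u \<chi>2 \<chi>1 by (rule swap)
  show "M2 = r2 * c" "coprime r2 c2" "c2 > 0" "r2 > 0" "r2 * g2 = N2 * g" "c2 dvd c"
    using S.quotients1 unfolding S.M1_def S.r1_def S.c1_def S.g1_def M2_def r2_def c2_def g2_def by auto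
qed

lemma g1_c1: "g1 * c1 = C" and g2_c2: "g2 * c2 = C" and g_c: "g * c = C"
  using g by (auto simp: g1_def c1_def g2_def c2_def c_def)

lemma positive: "c > 0" "M1 > 0" "M2 > 0" "g1 > 0" "g2 > 0"
  using g_c g1_c1 g2_c2 C quotients1 quotients2 D1(1) D2(1) by (auto simp: M1_def M2_def intro: Nat.gr0I)

lemma \<alpha>_u: "[\<alpha> * u = 1] (mod int c)"
  using u by (simp add: \<alpha>_def c_def g_def)

lemma coprime_\<alpha>: "coprime \<alpha> (int c)"
  using \<alpha>_u coprime_iff_invertible_int by blast

text \<open>The factor e/g is coprime to C/g and so drops out of the divisibility of e N1 N2 by
  C.\<close>

lemma c_dvd: "c dvd N1 * N2"
proof -
  have "coprime (e div g) c" unfolding g_def c_def using e by (intro div_gcd_coprime) auto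
  moreover have "g * c dvd g * ((e div g) * (N1 * N2))"
  proof -
    have "g * ((e div g) * (N1 * N2)) = (g * (e div g)) * (N1 * N2)" by (simp only: mult.assoc)
    also have "g * (e div g) = e" by (simp add: g_def)
    finally have eq: "g * ((e div g) * (N1 * N2)) = e * (N1 * N2)" .
    show ?thesis unfolding eq g_c using C_dvd by (simp add: mult.assoc)
  qed
  hence "c dvd (e div g) * (N1 * N2)" using g(1) by simp
  ultimately show ?thesis by (simp add: coprime_commute coprime_dvd_mult_right_iff)
qed

definition "\<Phi> = (\<lambda>n m. \<chi>1 n * \<chi>2 m * rt c (\<alpha> * n * m))"

lemma biperiodic_\<Phi>: "biperiodic M1 M2 \<Phi>"
  unfolding biperiodic_def
proof (intro conjI allI)
  fix m
  show "mod_periodic M1 (\<lambda>n. \<Phi> n m)"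
    unfolding mod_periodic_def
  proof (intro allI impI)
    fix a b assume ab: "[a = b] (mod int M1)"
    have "\<chi>1 a = \<chi>1 b"
      by (rule mod_periodicD[OF mod_periodic_dvd[OF D1(2)] ab]) (simp add: M1_def)
    moreover have "rt c ((\<alpha> * m) * a) = rt c ((\<alpha> * m) * b)"
      by (rule mod_periodicD[OF mod_periodic_dvd[OF mod_periodic_rt[OF positive(1)]] ab]) (simp add: quotients1(1))
    ultimately show "\<Phi> a m = \<Phi> b m" by (simp add: \<Phi>_def mult_ac)
  qed
next
  fix n
  show "mod_periodic M2 (\<Phi> n)"
    unfolding mod_periodic_def
  proof (intro allI impI)
    fix a b assume ab: "[a = b] (mod int M2)"
    have "\<chi>2 a = \<chi>2 b"
      by (rule mod_periodicD[OF mod_periodic_dvd[OF D2(2)] ab]) (simp add: M2_def)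
    moreover have "rt c ((\<alpha> * n) * a) = rt c ((\<alpha> * n) * b)"
      by (rule mod_periodicD[OF mod_periodic_dvd[OF mod_periodic_rt[OF positive(1)]] ab]) (simp add: quotients2(1))
    ultimately show "\<Phi> n a = \<Phi> n b" by (simp add: \<Phi>_def)
  qed
qed

lemma \<Phi>_minus: "\<Phi> (- n) (- m) = (- 1) ^ k * \<Phi> n m"
proof -
  have "\<chi>1 (- n) * \<chi>2 (- m) = (\<chi>1 (- 1) * \<chi>2 (- 1)) * (\<chi>1 n * \<chi>2 m)"
    by (simp only: character_minus[OF ch1, of n] character_minus[OF ch2, of m] mult_ac)
  thus ?thesis by (simp add: \<Phi>_def parity)
qed

text \<open>The sum is a multiple of \<chi>1(0) times the conjugate of \<chi>2(0), nonzero only for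
  two trivial characters, which are excluded in weight 2.\<close>

lemma sum_\<Phi>_0:
  assumes "k = 2"
  shows "(\<Sum>a<M2. \<Phi> 0 (int a)) = 0"
proof -
  have "(\<Sum>a<M2. \<Phi> 0 (int a)) = \<chi>1 0 * dft (c2 * N2) \<chi>2 0"
    by (simp add: \<Phi>_def dft_def M2_def sum_distrib_left mult.commute)
  also have "dft (c2 * N2) \<chi>2 0 = of_nat c2 * (cnj (\<chi>2 0) * gauss_sum N2 \<chi>2)"
    by (simp add: dft_mult_period[OF D2(2,1) quotients2(3)] dft_primitive[OF prim2])
  also have "\<chi>1 0 * (of_nat c2 * (cnj (\<chi>2 0) * gauss_sum N2 \<chi>2)) = 0"
    using nontrivial assms character_mod_1[of \<chi>1] character_mod_1[of \<chi>2] ch1 ch2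
    by (auto simp: character_0[OF ch1] character_0[OF ch2])
  finally show ?thesis .
qed

text \<open>The summation conditions of \<open>c_coeff\<close> become extension by zero, the shape
  in which \<open>dft_chi1\<close> and \<open>dft_chi2\<close> produce them.\<close>

definition "S1 s m = (if int c1 dvd m - int r1 * s then conj_char \<chi>1 ((m - int r1 * s) div int c1) else 0)"
definition "S2 s m = (if int c2 dvd m - int r2 * s then conj_char \<chi>2 ((m - int r2 * s) div int c2) else 0)"

text \<open>The coefficient c(n, m) as a function of m (first argument) and n/m (second), in which
  form it is biperiodic.\<close>

definition "cc = (\<lambda>n m. \<Sum>s1<c. S1 (int s1) m * (\<Sum>s2<c. S2 (int s2) n * rt c (- (u * int s1 * int s2))))"

lemma c_coeff_eq: "c_coeff \<chi>1 N1 \<chi>2 N2 e C u n m = cc m (int n div m)"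
proof -
  have cong_iff: "[a = b] (mod x) \<longleftrightarrow> x dvd b - a" for a b x :: int
    by (simp add: cong_iff_dvd_diff dvd_diff_commute)
  show ?thesis
    unfolding c_coeff_def Let_def g_def[symmetric] g1_def[symmetric] g2_def[symmetric] c_def[symmetric]
      c1_def[symmetric] c2_def[symmetric] r1_def[symmetric] r2_def[symmetric] sum_int_residues zeta_root_powi cong_iff
      cc_def S1_def S2_def
    by (intro sum.cong refl) (auto intro!: sum.cong)
qed

lemma dft_chi1: "dft M1 \<chi>1 (int r1 * s - m) = of_nat c1 * gauss_sum N1 \<chi>1 * \<chi>1 (- 1) * S1 s m"
proof -
  have dvd: "int c1 dvd int r1 * s - m \<longleftrightarrow> int c1 dvd m - int r1 * s" by (rule dvd_diff_commute)
  have "cnj (\<chi>1 ((int r1 * s - m) div int c1)) = \<chi>1 (- 1) * conj_char \<chi>1 ((m - int r1 * s) div int c1)"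
    if "int c1 dvd m - int r1 * s"
  proof -
    have "(int r1 * s - m) div int c1 = - ((m - int r1 * s) div int c1)"
      using dvd_neg_div[OF that] by simp
    thus ?thesis
      using character_minus[OF ch1, of "(m - int r1 * s) div int c1"] character_minus_1(2)[OF ch1]
      by (simp add: conj_char_def)
  qed
  thus ?thesis
    by (auto simp: M1_def mult.commute[of N1] dft_mult_period[OF D1(2,1) quotients1(3)] dft_primitive[OF prim1] S1_def dvd)
qed

lemma dft_chi2: "dft M2 \<chi>2 (int r2 * s - m) = of_nat c2 * gauss_sum N2 \<chi>2 * \<chi>2 (- 1) * S2 s m"
proof -
  interpret S: cusp_expansion k N2 N1 e C A u \<chi>2 \<chi>1 by (rule swap)
  show ?thesis
    using S.dft_chi1[of s m]
    unfolding S.S1_def S.M1_def S.r1_def S.c1_def S.g1_def S2_def M2_def r2_def c2_def g2_def .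
qed

definition "G1 = gauss_sum N1 (conj_char \<chi>1)"
definition "G2 = gauss_sum N2 (conj_char \<chi>2)"

lemma G: "G1 \<noteq> 0" "G2 \<noteq> 0" "gauss_sum N1 \<chi>1 = \<chi>1 (- 1) * of_nat N1 / G1" "gauss_sum N2 \<chi>2 = \<chi>2 (- 1) * of_nat N2 / G2"
  using gauss_sum_nonzero[OF prim1] gauss_sum_nonzero[OF prim2] gauss_sum_mult_conj[OF prim1] gauss_sum_mult_conj[OF prim2]
  by (auto simp: G1_def G2_def eq_divide_eq)

text \<open>M1 M2 / (G1 G2) divided by c M1: the first collects the two character transforms, the
  second the expansion of the twist and the 1/M1 of \<open>dft2\<close>.\<close>

definition "K = of_nat r2 / (G1 * G2)"

text \<open>
  Expanding the twist \<open>rt c (\<alpha> * x * y)\<close> in additive characters (a finite Gaussian is its own Fourier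
  transform) decouples the two variables.
\<close>

lemma dft2_\<Phi>: "dft2 M1 M2 \<Phi> n m = K * cc n m"
proof -
  define T where "T = (\<lambda>s1 s2. rt c (- (u * int s1 * int s2)))"
  have T_app: "rt c (- (u * int s1 * int s2)) = T s1 s2" for s1 s2 by (simp add: T_def)
  \<comment> \<open>The expansion of the twist uses c-th roots of unity, the transforms M1-th and
    M2-th ones; converting between them is where r1 s1 and r2 s2 in c(n, m) come from.\<close>
  have rtc: "rt c (int s * x) = rt M1 (int r1 * int s * x)" "rt c (int s * x) = rt M2 (int r2 * int s * x)" for s x
    using rt_mult_cancel[OF quotients1(4), of c "int s * x"] rt_mult_cancel[OF quotients2(4), of c "int s * x"]
    by (simp_all add: quotients1(1) quotients2(1) mult.assoc)
  have "of_nat c * of_nat M1 * dft2 M1 M2 \<Phi> n m =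
          (\<Sum>a<M2. \<Sum>x<M1. \<chi>1 (int x) * \<chi>2 (int a) * (of_nat c * rt c (\<alpha> * int x * int a)) * rt M1 (- int x * m) * rt M2 (- int a * n))"
  proof -
    have "of_nat c * of_nat M1 * dft2 M1 M2 \<Phi> n m =
            of_nat c * (\<Sum>a<M2. dft M1 (\<lambda>x. \<Phi> x (int a)) (- m) * rt M2 (- int a * n))"
      using positive(2) by (simp add: dft2_def)
    also have "\<dots> = (\<Sum>a<M2. \<Sum>x<M1. \<chi>1 (int x) * \<chi>2 (int a) * (of_nat c * rt c (\<alpha> * int x * int a)) * rt M1 (- int x * m) * rt M2 (- int a * n))"
      unfolding dft_def \<Phi>_def sum_distrib_left sum_distrib_right
      by (intro sum.cong refl) (simp add: mult_ac)
    finally show ?thesis .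
  qed
  also have "\<dots> = (\<Sum>a<M2. \<Sum>x<M1. \<Sum>s1<c. \<Sum>s2<c. T s1 s2 * (\<chi>1 (int x) * rt M1 (int x * (int r1 * int s1 - m))) *
                    (\<chi>2 (int a) * rt M2 (int a * (int r2 * int s2 - n))))"
  proof (intro sum.cong refl)
    fix a x
    have eq: "\<chi>1 (int x) * \<chi>2 (int a) * (rt c (int s1 * int x) * rt c (int s2 * int a) * T s1 s2) * rt M1 (- int x * m) * rt M2 (- int a * n)
            = T s1 s2 * (\<chi>1 (int x) * rt M1 (int x * (int r1 * int s1 - m))) * (\<chi>2 (int a) * rt M2 (int a * (int r2 * int s2 - n)))" for s1 s2
    proof -
      have "rt M1 (int x * (int r1 * int s1 - m)) = rt c (int s1 * int x) * rt M1 (- int x * m)"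
        "rt M2 (int a * (int r2 * int s2 - n)) = rt c (int s2 * int a) * rt M2 (- int a * n)"
        unfolding rtc(1)[of s1 "int x"] rtc(2)[of s2 "int a"] rt_add[symmetric] by (simp_all add: algebra_simps)
      thus ?thesis by (simp only: mult_ac)
    qed
    show "\<chi>1 (int x) * \<chi>2 (int a) * (of_nat c * rt c (\<alpha> * int x * int a)) * rt M1 (- int x * m) * rt M2 (- int a * n) =
          (\<Sum>s1<c. \<Sum>s2<c. T s1 s2 * (\<chi>1 (int x) * rt M1 (int x * (int r1 * int s1 - m))) *
                    (\<chi>2 (int a) * rt M2 (int a * (int r2 * int s2 - n))))"
      unfolding rt_bilinear_expansion[OF positive(1) \<alpha>_u] T_app sum_distrib_left sum_distrib_right
      by (intro sum.cong refl eq)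
  qed
  also have "\<dots> = (\<Sum>s1<c. \<Sum>s2<c. \<Sum>a<M2. \<Sum>x<M1. T s1 s2 * (\<chi>1 (int x) * rt M1 (int x * (int r1 * int s1 - m))) *
                    (\<chi>2 (int a) * rt M2 (int a * (int r2 * int s2 - n))))"
    by (simp only: sum.swap[of _ "{..<c}" "{..<M1}"] sum.swap[of _ "{..<c}" "{..<M2}"])
  also have "\<dots> = (\<Sum>s1<c. \<Sum>s2<c. T s1 s2 * dft M1 \<chi>1 (int r1 * int s1 - m) * dft M2 \<chi>2 (int r2 * int s2 - n))"
    unfolding dft_def sum_distrib_left sum_distrib_right by (intro sum.cong refl)
  also have "\<dots> = of_nat c1 * gauss_sum N1 \<chi>1 * \<chi>1 (- 1) * (of_nat c2 * gauss_sum N2 \<chi>2 * \<chi>2 (- 1)) * cc n m"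
    unfolding dft_chi1 dft_chi2 cc_def T_def sum_distrib_left by (intro sum.cong refl) (simp add: mult_ac)
  also have "\<dots> = of_nat c1 * of_nat c2 * (\<chi>1 (- 1) * \<chi>1 (- 1)) * (\<chi>2 (- 1) * \<chi>2 (- 1)) * of_nat N1 * of_nat N2 / (G1 * G2) * cc n m"
    unfolding G(3,4) by (simp add: mult_ac)
  also have "\<dots> = of_nat M1 * of_nat M2 / (G1 * G2) * cc n m"
    unfolding character_minus_1(1)[OF ch1] character_minus_1(1)[OF ch2] by (simp add: M1_def M2_def mult_ac)
  also have "\<dots> = of_nat c * of_nat M1 * (K * cc n m)"
    by (simp add: K_def quotients2(1))
  finally show ?thesis using positive by simp
qed

lemma K_nonzero: "K \<noteq> 0"
  using G quotients2(4) by (simp add: K_def)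

lemma cc_eq: "cc n m = dft2 M1 M2 \<Phi> n m / K"
  using K_nonzero by (simp add: dft2_\<Phi>)

text \<open>Read off from the Fourier transform; the defining sum of \<open>cc\<close> does not show
  it.\<close>

lemma biperiodic_cc: "biperiodic M2 M1 cc"
  unfolding biperiodic_def
proof (intro conjI allI)
  fix m
  show "mod_periodic M2 (\<lambda>n. cc n m)"
    unfolding cc_eq dft2_def mod_periodic_def
    using mod_periodicD[OF mod_periodic_rt[OF positive(3), of "- int _"]]
    by (auto intro!: sum.cong arg_cong2[where f = "(/)"] arg_cong2[where f = "(*)"])
next
  fix n
  have "mod_periodic M1 (\<lambda>m. dft M1 (\<lambda>x. \<Phi> x (int a)) (- m))" for a
    by (intro mod_periodic_uminus mod_periodic_dft positive)
  thus "mod_periodic M1 (cc n)"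
    unfolding cc_eq dft2_def mod_periodic_def
    by (auto intro!: sum.cong arg_cong2[where f = "(/)"] arg_cong2[where f = "(*)"])
qed

text \<open>On each axis one character is evaluated at 0, which gives 1 for modulus 1 and 0
  otherwise: these are the Kronecker deltas of c_0.\<close>

lemma eis_const_\<Phi>: "eis_const k M1 M2 \<Phi> = 2 * eisenstein_const k \<chi>1 N1 \<chi>2 N2"
proof -
  have L: "- gen_bernoulli k (c' * N) \<psi> / of_nat k = dirichlet_L \<psi> (1 - of_nat k)"
    if "dirichlet_character N \<psi>" "c' > 0" "k \<ge> 2 \<or> N \<noteq> 1" for N c' \<psi>
    using that k dirichlet_L_nonpos_int[of N \<psi> k] gen_bernoulli_period[of N c' \<psi> k]
    by (auto simp: dirichlet_characterD character_0)
  have B1: "gen_bernoulli j M1 (\<lambda>n. \<Phi> n 0) = (if N2 = 1 then gen_bernoulli j (c1 * N1) \<chi>1 else 0)" for j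
    using gen_bernoulli_cmult[OF positive(2), of j 0 \<chi>1]
    by (simp add: \<Phi>_def character_0[OF ch2] M1_def mult.commute)
  have B2: "gen_bernoulli j M2 (\<Phi> 0) = (if N1 = 1 then gen_bernoulli j (c2 * N2) \<chi>2 else 0)" for j
    using gen_bernoulli_cmult[OF positive(3), of j 0 \<chi>2]
    by (simp add: \<Phi>_def [abs_def] character_0[OF ch1] M2_def mult.commute)
  show ?thesis
  proof (cases "k = 1")
    case True
    \<comment> \<open>Parity excludes two trivial characters in weight 1, so the L-value at 0 is
      only wanted for a character vanishing at 0.\<close>
    have "\<not> (N1 = 1 \<and> N2 = 1)"
      using parity True character_mod_1[of \<chi>1] character_mod_1[of \<chi>2] ch1 ch2 by auto
    thus ?thesis
      using L[OF ch1 quotients1(3)] L[OF ch2 quotients2(3)] True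
      unfolding eis_const_def B1 B2 eisenstein_const_def by auto
  next
    case False
    thus ?thesis
      using L[OF ch1 quotients1(3)] k unfolding eis_const_def B1 eisenstein_const_def by auto
  qed
qed

text \<open>At m = 0 the transform in x is evaluated at 0, so \<open>cc\<close> reduces to the
  transform in a of the sum of \<Phi>(x, a) over x, which \<open>character_times_dft\<close> finds
  to be 0 or a multiple of conj(\<chi>1) \<chi>2.\<close>

lemma gen_bernoulli_cc: "- gen_bernoulli k M2 (\<lambda>n. cc n 0) / of_nat k = T_const k \<chi>1 N1 \<chi>2 N2 e A C"
proof -
  define \<psi> where "\<psi> = (\<lambda>a. conj_char \<chi>1 a * \<chi>2 a)"
  have ch\<psi>: "dirichlet_character (N1 * N2) \<psi>" unfolding \<psi>_def
    by (intro dirichlet_character_mult dirichlet_character_conj ch1 ch2)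
  have sign: "\<psi> (- 1) = (- 1) ^ k"
    using parity character_minus_1(2)[OF ch1] by (simp add: \<psi>_def conj_char_def)
  have conj_minus: "conj_char \<chi>1 (- A * int (e div g)) = \<chi>1 (- 1) * conj_char \<chi>1 \<alpha>"
    using character_minus[OF ch1, of \<alpha>] character_minus_1(2)[OF ch1] by (simp add: conj_char_def \<alpha>_def)
  have X: "(\<Sum>x<M1. \<Phi> (int x) a) = (if c = N1 then gauss_sum N1 \<chi>1 * conj_char \<chi>1 \<alpha> * \<psi> a else 0)" for a
  proof -
    have "rt c (\<alpha> * int x * a) = rt M1 (int x * (\<alpha> * int r1 * a))" for x
      using rt_mult_cancel[OF quotients1(4), of c "\<alpha> * int x * a"] by (simp add: quotients1(1) mult_ac)
    hence "(\<Sum>x<M1. \<Phi> (int x) a) = \<chi>2 a * dft M1 \<chi>1 (\<alpha> * int r1 * a)"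
      by (simp add: \<Phi>_def dft_def sum_distrib_left mult_ac)
    also have "\<dots> = (if c = N1 then gauss_sum N1 \<chi>1 * conj_char \<chi>1 \<alpha> * \<psi> a else 0)"
      unfolding M1_def c1_def r1_def g1_def \<psi>_def c_def
      using character_times_dft[OF prim1 ch2 g, of \<alpha> a] coprime_\<alpha> c_dvd unfolding c_def by simp
    finally show ?thesis .
  qed
  have "cc n 0 = 1 / (K * of_nat M1) * dft M2 (\<lambda>a. \<Sum>x<M1. \<Phi> (int x) a) (- n)" for n
    by (simp add: cc_eq dft2_def dft_def[of M1] dft_def[of M2])
  hence "gen_bernoulli k M2 (\<lambda>n. cc n 0) =
           1 / (K * of_nat M1) * (of_nat M2 ^ k * fourier_bernoulli k M2 (\<lambda>a. \<Sum>x<M1. \<Phi> (int x) a))"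
    using gen_bernoulli_cmult[OF positive(3), of k "1 / (K * of_nat M1)"] positive(3)
    by (simp add: fourier_bernoulli_def)
  also have "fourier_bernoulli k M2 (\<lambda>a. \<Sum>x<M1. \<Phi> (int x) a) =
               (if c = N1 then gauss_sum N1 \<chi>1 * conj_char \<chi>1 \<alpha> * fourier_bernoulli k M2 \<psi> else 0)"
    unfolding X using fourier_bernoulli_cmult[OF positive(3), of k 0 \<psi>] fourier_bernoulli_cmult[OF positive(3), of k _ \<psi>]
    by simp
  finally have B: "gen_bernoulli k M2 (\<lambda>n. cc n 0) = 1 / (K * of_nat M1) * (of_nat M2 ^ k *
      (if c = N1 then gauss_sum N1 \<chi>1 * conj_char \<chi>1 \<alpha> * fourier_bernoulli k M2 \<psi> else 0))" .
  show ?thesis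
  proof (cases "c = N1")
    case False
    thus ?thesis unfolding B by (simp add: T_const_def Let_def c_def g_def)
  next
    case True
    \<comment> \<open>Here h = g2/g; together with c = N1 it gives N1 N2 = h M2, the discrepancy
      between the modulus in S_k and the period M2.\<close>
    obtain h where h: "g2 = g * h" "h > 0" "N2 = r2 * h"
      using gcd_mult_quotients[OF D2(1) g] unfolding r2_def g2_def by metis
    have per: "mod_periodic M2 \<psi>"
    proof -
      have "N1 dvd M2" using quotients2(1) True by simp
      moreover have "N2 dvd M2" by (simp add: M2_def)
      ultimately show ?thesis unfolding \<psi>_def
        by (intro mod_periodic_mult mod_periodic_dvd[OF D2(2)] mod_periodic_dvd[OF dirichlet_characterD(2)[OF dirichlet_character_conj[OF ch1]]])
    qed
    have M2h: "h * M2 = N1 * N2" 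
    proof -
      have "h * M2 = N1 * (r2 * h)" using quotients2(1) True by simp
      thus ?thesis by (simp only: h(3)[symmetric])
    qed
    have fb: "fourier_bernoulli k (N1 * N2) \<psi> = fourier_bernoulli k M2 \<psi>"
      using fourier_bernoulli_period[OF per positive(3) h(2), of k] by (simp add: M2h)
    have of_nat: "of_nat (N1 * N2) = (of_nat h * of_nat M2 :: complex)" by (simp flip: M2h)
    have S: "S_const k (N1 * N2) \<psi> = (of_nat h * of_nat M2) ^ k * (- 1) ^ k * fourier_bernoulli k M2 \<psi> / of_nat k"
      unfolding S_const_conv_fourier_bernoulli[OF ch\<psi>] sign fb of_nat ..
    have "c1 = 1" "M1 = N1" "r1 = 1"
    proof -
      have "N1 * g = C" using True g_c by (simp add: mult.commute)
      hence "g1 = C" by (simp add: g1_def)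
      thus "c1 = 1" "M1 = N1" "r1 = 1" using C \<open>N1 * g = C\<close> by (simp_all add: c1_def M1_def r1_def)
    qed
    obtain j where j: "k = Suc j" using k by (cases k) auto
    have gg: "of_nat g2 / of_nat g = (of_nat h :: complex)" using h g(1) by simp
    have sq: "(- 1 :: complex) ^ j * (- 1) ^ j = 1" by (simp flip: power_mult_distrib)
    have "T_const k \<chi>1 N1 \<chi>2 N2 e A C = (- 1) ^ (k - 1) * (G2 / (of_nat N2 * of_nat h ^ (k - 1))) *
            (\<chi>1 (- 1) * conj_char \<chi>1 \<alpha>) * S_const k (N1 * N2) \<psi>"
      using True unfolding T_const_def Let_def g_def[symmetric] g2_def[symmetric] c_def[symmetric] conj_minus gg
        \<psi>_def G2_def by simp
    also have "\<dots> = - ((- 1) ^ j * (- 1) ^ j) * (\<chi>1 (- 1) * conj_char \<chi>1 \<alpha>) * (of_nat M2 ^ k * fourier_bernoulli k M2 \<psi> / of_nat k) * (G2 / of_nat r2)"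

    proof -
      have cancel: "s * (G / (R * H)) * w * (H * X * (- s) * F / y) = - (s * s) * w * (X * F / y) * (G / R)"
        if "H \<noteq> 0" for s G R H w X F y :: complex
        using that by (simp add: divide_inverse mult_ac)
      have "of_nat N2 = (of_nat r2 * of_nat h :: complex)" using h(3) by (metis of_nat_mult)
      \<comment> \<open>The power of h in T_k and the factor h of N2 make up the h^k coming from
        S_k.\<close>
      hence e1: "of_nat N2 * of_nat h ^ j = (of_nat r2 * of_nat h ^ k :: complex)"
        by (simp add: j mult_ac)
      have e2: "(of_nat h * of_nat M2) ^ k * (- 1) ^ k = (of_nat h ^ k * of_nat M2 ^ k * (- ((- 1) ^ j)) :: complex)"
        by (simp add: j power_mult_distrib)
      have "k - 1 = j" using j by simp
      show ?thesis
        unfolding S \<open>k - 1 = j\<close> e1 e2 by (rule cancel) (use h(2) in auto)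
    qed
    also have "\<dots> = - gen_bernoulli k M2 (\<lambda>n. cc n 0) / of_nat k"
      unfolding sq B K_def G(3) \<open>M1 = N1\<close> using True G(1,2) D1(1) quotients2(4) by (simp add: mult_ac)
    finally show ?thesis ..
  qed
qed

text \<open>The axis n = 0, present in weight 1 only, is the axis m = 0 after exchanging the indices
  1 and 2.\<close>

lemma eis_const_cc:
  "eis_const k M2 M1 cc =
     (if k > 1 then T_const k \<chi>1 N1 \<chi>2 N2 e A C
      else T_const 1 \<chi>1 N1 \<chi>2 N2 e A C + T_const 1 \<chi>2 N2 \<chi>1 N1 e A C)"
proof -
  interpret S: cusp_expansion k N2 N1 e C A u \<chi>2 \<chi>1 by (rule swap)
  have "S.M2 = M1"
    by (simp add: S.M2_def S.c2_def S.g2_def M1_def c1_def g1_def)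
  moreover have "S.S1 = S2" "S.S2 = S1"
    by (simp_all add: fun_eq_iff S.S1_def S.S2_def S1_def S2_def S.r1_def S.r2_def S.c1_def S.c2_def S.g1_def S.g2_def
          r1_def r2_def c1_def c2_def g1_def g2_def)
  hence "S.cc n m = cc m n" for n m
    unfolding S.cc_def cc_def sum_distrib_left by (subst sum.swap) (intro sum.cong refl, simp add: mult_ac)
  ultimately have "- gen_bernoulli k M1 (cc 0) / of_nat k = T_const k \<chi>2 N2 \<chi>1 N1 e A C"
    using S.gen_bernoulli_cc by simp
  thus ?thesis
    using k gen_bernoulli_cc unfolding eis_const_def by (cases "k = 1") auto
qed

end

context cusp_expansion
begin

lemma eis_series_cc: "eis_series k M1 \<sigma> (dft2 M1 M2 \<Phi>) = K * eis_series k M1 \<sigma> cc"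
  unfolding eis_series_def infsum_cmult_right'[symmetric] dft2_\<Phi>
  by (intro infsum_cong) (auto simp: algebra_simps)

lemma eis_const_dft2: "eis_const k M2 M1 (dft2 M1 M2 \<Phi>) = K * eis_const k M2 M1 cc"
proof -
  have "dft2 M1 M2 \<Phi> 0 = (\<lambda>m. K * cc 0 m)" "(\<lambda>n. dft2 M1 M2 \<Phi> n 0) = (\<lambda>n. K * cc n 0)"
    by (auto simp: dft2_\<Phi>)
  thus ?thesis
    using gen_bernoulli_cmult[OF positive(3), of k K "\<lambda>n. cc n 0"] gen_bernoulli_cmult[OF positive(2), of 1 K "cc 0"]
    by (simp add: eis_const_def algebra_simps)
qed

text \<open>Makes the exponent \<open>g1 * g2 div C\<close> exact. Both N1 g N2 g and N1 g C are
  divisible by C, hence so is N1 g g2.\<close>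

lemma C_dvd_g1_g2: "C dvd g1 * g2"
proof -
  have "C dvd (N1 * g) * (N2 * g)"
  proof -
    have "g * c dvd (N1 * N2 * g) * g" using c_dvd by (simp add: mult.commute mult_dvd_mono)
    moreover have "(N1 * g) * (N2 * g) = (N1 * N2 * g) * g" by (simp only: mult_ac)
    ultimately show ?thesis by (simp only: g_c)
  qed
  hence "C dvd N1 * g * g2"
    unfolding g2_def gcd_mult_distrib_nat by simp
  moreover have "g1 * g2 = gcd (N1 * g * g2) (C * g2)"
    by (simp add: g1_def gcd_mult_distrib_nat mult.commute)
  ultimately show ?thesis by simp
qed

text \<open>For n = d (n/d) the twist is e(\<alpha> n / c) for every divisor d, so it amounts to a
  shift of the argument by \<alpha> / c. The 2 counts both signs.\<close>

lemma eisenstein_F_eq: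
  assumes \<sigma>: "Im \<sigma> > 0" and t: "t = of_int \<alpha> / of_nat c + (- 1 / \<sigma>) / of_nat M2"
  shows "2 * eisenstein_F k \<chi>1 N1 \<chi>2 N2 t = eis_const k M1 M2 \<Phi> + eis_series k M2 (- 1 / \<sigma>) \<Phi>"
proof -
  have \<sigma>': "Im (- 1 / \<sigma>) > 0" by (rule Im_neg_inverse_pos[OF \<sigma>])
  have "((\<lambda>n. 2 * (sigma_char (k - 1) \<chi>1 \<chi>2 n * qpow t (real n))) has_sum eis_series k M2 (- 1 / \<sigma>) \<Phi>) {1..}"
  proof (rule has_sum_cong[THEN iffD1, OF _ eis_series_has_sum_divisors[OF biperiodic_\<Phi> positive(2,3) \<sigma>', of k]])
    fix n :: nat assume "n \<in> {1..}"
    have "(\<Phi> (int d) (int (n div d)) + (- 1) ^ k * \<Phi> (- int d) (- int (n div d))) * of_nat d ^ (k - 1) * ee (of_nat n * (- 1 / \<sigma>) / of_nat M2)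
           = 2 * (of_nat d ^ (k - 1) * \<chi>1 (int d) * \<chi>2 (int (n div d)) * qpow t (real n))" if "d dvd n" for d
    proof -
      have "int d * int (n div d) = int n" using that by (simp flip: of_nat_mult)
      hence "rt c (\<alpha> * int d * int (n div d)) = rt c (\<alpha> * int n)" by (simp add: mult.assoc)
      moreover have "rt c (\<alpha> * int n) * ee (of_nat n * (- 1 / \<sigma>) / of_nat M2) = qpow t (real n)"
        unfolding rt_def qpow_conv_ee ee_add[symmetric] t by (simp add: algebra_simps)
      ultimately have q: "rt c (\<alpha> * int d * int (n div d)) * ee (of_nat n * (- 1 / \<sigma>) / of_nat M2) = qpow t (real n)"
        by (simp only:)
      have "(- 1 :: complex) ^ k * (- 1) ^ k = 1" by (simp flip: power_mult_distrib)
      hence dbl: "\<Phi> (int d) (int (n div d)) + (- 1) ^ k * \<Phi> (- int d) (- int (n div d)) = 2 * \<Phi> (int d) (int (n div d))"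
        unfolding \<Phi>_minus mult.assoc[symmetric] by simp
      show ?thesis
        unfolding dbl unfolding \<Phi>_def q[symmetric] by (simp only: mult_ac)
    qed
    thus "(\<Sum>d | d dvd n. (\<Phi> (int d) (int (n div d)) + (- 1) ^ k * \<Phi> (- int d) (- int (n div d))) * of_nat d ^ (k - 1)) *
             ee (of_nat n * (- 1 / \<sigma>) / of_nat M2) = 2 * (sigma_char (k - 1) \<chi>1 \<chi>2 n * qpow t (real n))"
      unfolding sigma_char_def sum_distrib_left sum_distrib_right by (intro sum.cong refl) auto
  qed
  hence "(\<Sum>\<^sub>\<infinity>n\<in>{1..}. 2 * (sigma_char (k - 1) \<chi>1 \<chi>2 n * qpow t (real n))) = eis_series k M2 (- 1 / \<sigma>) \<Phi>"
    by (rule infsumI)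
  thus ?thesis
    unfolding infsum_cmult_right' eisenstein_F_def eis_const_\<Phi> by (simp add: algebra_simps)
qed

lemma a_coeff_0: "a_coeff k \<chi>1 N1 \<chi>2 N2 e A C A' u 0 = eis_const k M2 M1 cc"
  by (simp add: a_coeff_def Let_def eis_const_cc)

text \<open>A negative divisor -d has weight sgn(-d) (-d)^(k-1) = (-1)^k d^(k-1), the sign of the
  reflected term in \<open>eis_series\<close>.\<close>

lemma a_coeff_pos:
  assumes "n > 0"
  shows "a_coeff k \<chi>1 N1 \<chi>2 N2 e A C A' u n = rt (e * N1 * N2) (A' * int (g1 * g2 div C) * int n) *
     (\<Sum>d | d dvd n. (cc (int d) (int (n div d)) + (- 1) ^ k * cc (- int d) (- int (n div d))) * of_nat d ^ (k - 1))"
proof -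
  have "(\<Sum>m | m dvd int n. of_int (sgn m * m ^ (k - 1)) * c_coeff \<chi>1 N1 \<chi>2 N2 e C u n m) =
        (\<Sum>d | d dvd n. (cc (int d) (int (n div d)) + (- 1) ^ k * cc (- int d) (- int (n div d))) * of_nat d ^ (k - 1))"
    unfolding sum_int_divisors[OF assms] c_coeff_eq
  proof (intro sum.cong refl)
    fix d assume "d \<in> {d. d dvd n}"
    hence d: "d dvd n" "d > 0" using assms by (auto intro: Nat.gr0I)
    have "int n div - int d = - int (n div d)"
      using d by (simp add: div_minus_right zdiv_int dvd_neg_div flip: of_nat_mod)
    moreover have "int n div int d = int (n div d)" by (simp add: zdiv_int)
    moreover have "(of_int (sgn (- int d) * (- int d) ^ (k - 1)) :: complex) = (- 1) ^ k * of_nat d ^ (k - 1)"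
      using d k by (cases k) (simp_all add: power_minus[of "of_nat d"])
    moreover have "(of_int (sgn (int d) * int d ^ (k - 1)) :: complex) = of_nat d ^ (k - 1)" using d by simp
    ultimately show "of_int (sgn (int d) * int d ^ (k - 1)) * cc (int d) (int n div int d) +
          of_int (sgn (- int d) * (- int d) ^ (k - 1)) * cc (- int d) (int n div - int d) =
          (cc (int d) (int (n div d)) + (- 1) ^ k * cc (- int d) (- int (n div d))) * of_nat d ^ (k - 1)"
      by (simp only:) (simp add: algebra_simps)
  qed
  thus ?thesis
    using assms unfolding a_coeff_def Let_def g_def[symmetric] g1_def[symmetric] g2_def[symmetric] zeta_root_powi by simp
qed

theorem expansion_has_sum:
  fixes B D A' :: int and \<tau> :: complex
  defines "N \<equiv> e * N1 * N2"
  assumes det: "A * D - B * int C = 1" and B: "int N dvd B" and A': "[A * A' = 1] (mod int N)" and \<tau>: "Im \<tau> > 0"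
  shows "((\<lambda>n. a_coeff k \<chi>1 N1 \<chi>2 N2 e A C A' u n * qpow \<tau> (real (g1 * g2 * n) / real N)) has_sum
           (z_const k \<chi>1 N1 \<chi>2 N2 e C * slash k (eisenstein_Fe k \<chi>1 N1 \<chi>2 N2 e) A B (int C) D \<tau>)) UNIV"
    and "z_const k \<chi>1 N1 \<chi>2 N2 e C \<noteq> 0"
proof -
  define w where "w = of_nat C * \<tau> + of_int D"
  \<comment> \<open>Chosen so that -1 / (\<sigma> M2) = -e / (C w) for \<sigma> = w / x.\<close>
  define x :: complex where "x = of_nat (N2 * e) / of_nat g2"
  define \<sigma> where "\<sigma> = w / x"
  have N: "N > 0" using e D1(1) D2(1) by (simp add: N_def)
  have Im_w: "Im w > 0" using \<tau> C by (simp add: w_def)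
  hence w: "w \<noteq> 0" by auto
  have x: "x \<noteq> 0" using e D2(1) positive(5) by (simp add: x_def)
  have \<sigma>: "Im \<sigma> > 0"
  proof -
    have Im_scale: "Im (z * of_real r) = Im z * r" for z r by simp
    have "\<sigma> = w * of_real (real g2 / real (N2 * e))" by (simp add: \<sigma>_def x_def)
    hence "Im \<sigma> = Im w * (real g2 / real (N2 * e))" by (simp only: Im_scale)
    thus ?thesis using Im_w positive(5) e D2(1) by (auto intro!: mult_pos_pos divide_pos_pos)
  qed
  have c12: "of_nat c1 = (of_nat C / of_nat g1 :: complex)" "of_nat c2 = (of_nat C / of_nat g2 :: complex)"
  proof -
    have "of_nat g1 * of_nat c1 = (of_nat C :: complex)" "of_nat g2 * of_nat c2 = (of_nat C :: complex)"
      by (simp_all only: of_nat_mult[symmetric] g1_c1 g2_c2)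
    thus "of_nat c1 = (of_nat C / of_nat g1 :: complex)" "of_nat c2 = (of_nat C / of_nat g2 :: complex)"
      using positive(4,5) by (simp_all add: eq_divide_eq mult.commute)
  qed
  define q where "q = g1 * g2 div C"
  have q: "of_nat g1 * of_nat g2 = (of_nat C * of_nat q :: complex)"
  proof -
    have "g1 * g2 = C * q" using C_dvd_g1_g2 by (simp add: q_def)
    thus ?thesis by (metis of_nat_mult)
  qed
  have exponent: "of_nat n * \<sigma> / of_nat M1 = of_nat n * of_nat g1 * of_nat g2 * \<tau> / of_nat N + of_int (D * int q * int n) / of_nat N" for n
  proof -
    have "of_nat n * \<sigma> / of_nat M1 = of_nat n * w * (of_nat g1 * of_nat g2) / (of_nat N * of_nat C)"
      by (simp add: \<sigma>_def x_def M1_def N_def c12 mult_ac)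
    also have "\<dots> = of_nat n * of_nat g1 * of_nat g2 * \<tau> / of_nat N + of_nat n * of_int D * (of_nat g1 * of_nat g2) / (of_nat N * of_nat C)"
      using C by (simp add: w_def distrib_left distrib_right add_divide_distrib)
    also have "of_nat n * of_int D * (of_nat g1 * of_nat g2) / (of_nat N * of_nat C) = (of_int (D * int q * int n) / of_nat N :: complex)"
      unfolding q using C by (simp add: mult_ac)
    finally show ?thesis .
  qed
  \<comment> \<open>Modulo N the determinant reads A D = 1 because N divides B; so D can be traded
    for the inverse of A in the root of unity.\<close>
  have "[D = A'] (mod int N)"
  proof -
    have "A * D = 1 + B * int C" using det by simp
    moreover have "[B * int C = 0] (mod int N)" using B by (simp add: cong_0_iff)
    ultimately have "[A * D = 1 + 0] (mod int N)" by (simp only: cong_add_lcancel)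
    hence 1: "[(A * D) * A' = 1 * A'] (mod int N)" by (intro cong_scalar_right) simp
    have "[(A * A') * D = 1 * D] (mod int N)" using A' by (rule cong_scalar_right)
    thus ?thesis using 1 by (metis cong_sym cong_trans mult.assoc mult.commute mult_1)
  qed
  note cong_D = this
  have rt_D: "rt N (A' * int q * int n) = ee (of_int (D * int q * int n) / of_nat N)" for n
    unfolding rt_def[symmetric]
    by (intro rt_cong N cong_scalar_right) (rule cong_sym[OF cong_D])
  let ?t = "\<lambda>n. a_coeff k \<chi>1 N1 \<chi>2 N2 e A C A' u n * qpow \<tau> (real (g1 * g2 * n) / real N)"
  have "(?t has_sum eis_series k M1 \<sigma> cc) {1..}"
  proof (rule has_sum_cong[THEN iffD1, OF _ eis_series_has_sum_divisors[OF biperiodic_cc positive(3,2) \<sigma>, of k]])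
    fix n :: nat assume n: "n \<in> {1..}"
    have "ee (of_nat n * \<sigma> / of_nat M1) = rt N (A' * int q * int n) * qpow \<tau> (real (g1 * g2 * n) / real N)"
      unfolding exponent rt_D qpow_conv_ee ee_add[symmetric] by (simp add: mult_ac add.commute)
    thus "(\<Sum>d | d dvd n. (cc (int d) (int (n div d)) + (- 1) ^ k * cc (- int d) (- int (n div d))) * of_nat d ^ (k - 1)) *
        ee (of_nat n * \<sigma> / of_nat M1) = ?t n"
      using n by (simp add: a_coeff_pos N_def q_def)
  qed
  moreover have "?t 0 = eis_const k M2 M1 cc" by (simp add: a_coeff_0 qpow_def)
  moreover have "UNIV = insert 0 {1 :: nat..}" by auto
  ultimately have sum: "(?t has_sum (eis_const k M2 M1 cc + eis_series k M1 \<sigma> cc)) UNIV"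
    using has_sum_insert[of 0 "{1..}" ?t] by simp
  have "of_nat e * ((of_int A * \<tau> + of_int B) / w) = of_int \<alpha> / of_nat c + (- 1 / \<sigma>) / of_nat M2"
  proof -
    have "of_nat e = (of_nat g * of_nat (e div g) :: complex)" "of_nat C = (of_nat g * of_nat c :: complex)"
      using g_c by (simp_all add: g_def flip: of_nat_mult)
    hence 1: "of_int \<alpha> / of_nat c = (of_int A * of_nat e / of_nat C :: complex)"
      using g(1) by (simp add: \<alpha>_def)
    have 2: "(- 1 / \<sigma>) / of_nat M2 = - (of_nat e / (w * of_nat C))"
      using positive(5) D2(1) by (simp add: \<sigma>_def x_def M2_def c12)
    have "of_int (A * D - B * int C) = (1 :: complex)" using det by simp
    hence "of_int A * of_int D - of_int B * of_nat C = (1 :: complex)" by simp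
    hence "(of_int A * \<tau> + of_int B) * of_nat C = of_int A * w - 1"
      by (simp add: w_def algebra_simps)
    hence "(of_int A * \<tau> + of_int B) / w = (of_int A * w - 1) / (w * of_nat C)"
      using C w by (simp add: divide_simps)
    also have "\<dots> = of_int A / of_nat C - 1 / (w * of_nat C)"
      using w by (simp add: diff_divide_distrib)
    finally have 3: "(of_int A * \<tau> + of_int B) / w = of_int A / of_nat C - 1 / (w * of_nat C)" .
    show ?thesis unfolding 1 2 3 by (simp add: right_diff_distrib mult.commute)
  qed
  from eisenstein_F_eq[OF \<sigma> this]
  have "2 * eisenstein_Fe k \<chi>1 N1 \<chi>2 N2 e ((of_int A * \<tau> + of_int B) / w) =
          eis_const k M1 M2 \<Phi> + eis_series k M2 (- 1 / \<sigma>) \<Phi>"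
    by (simp add: eisenstein_Fe_def)
  also have "\<dots> = \<sigma> ^ k * (eis_const k M2 M1 (dft2 M1 M2 \<Phi>) + eis_series k M1 \<sigma> (dft2 M1 M2 \<Phi>))"
    by (rule eis_inversion[OF \<sigma> positive(2,3) biperiodic_\<Phi> k]) (simp_all add: \<Phi>_minus sum_\<Phi>_0)
  finally have "2 * eisenstein_Fe k \<chi>1 N1 \<chi>2 N2 e ((of_int A * \<tau> + of_int B) / w) =
     (w / x) ^ k * (K * eis_const k M2 M1 cc + K * eis_series k M1 \<sigma> cc)"
    unfolding eis_const_dft2 eis_series_cc \<sigma>_def[symmetric] .
  moreover have "X = s * K / 2 * (a + b)" if "2 * X = s * (K * a + K * b)" for X s a b :: complex
  proof -
    have "X = (2 * X) / 2" by simp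
    thus ?thesis unfolding that by (simp add: distrib_left add_divide_distrib mult.assoc)
  qed
  ultimately have F: "eisenstein_Fe k \<chi>1 N1 \<chi>2 N2 e ((of_int A * \<tau> + of_int B) / w) =
     (w / x) ^ k * K / 2 * (eis_const k M2 M1 cc + eis_series k M1 \<sigma> cc)"
    by blast
  obtain j where j: "k = Suc j" using k by (cases k) auto
  have z: "z_const k \<chi>1 N1 \<chi>2 N2 e C = 2 * x ^ j * (of_nat e / of_nat g) * G1 * G2"
    unfolding z_const_def Let_def g_def[symmetric] g2_def[symmetric] x_def G1_def G2_def by (simp add: j)
  show "z_const k \<chi>1 N1 \<chi>2 N2 e C \<noteq> 0" unfolding z using x e g(1) G by simp
  have r2: "of_nat r2 = (of_nat N2 * of_nat g / of_nat g2 :: complex)"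
    using quotients2(5) positive(5) by (simp add: eq_divide_eq flip: of_nat_mult)
  \<comment> \<open>Since x = N2 e/g2 and r2 = N2 g/g2, the quotient x/r2 is e/g: the origin of that
    factor in z_k.\<close>
  have xK: "x * (2 / K) = 2 * (of_nat e / of_nat g) * G1 * G2"
    using g(1) G D2(1) positive(5) by (simp add: K_def r2 x_def)
  have "z_const k \<chi>1 N1 \<chi>2 N2 e C = x ^ k * (2 / K)"
  proof -
    have "x ^ k * (2 / K) = x ^ j * (x * (2 / K))" by (simp add: j)
    thus ?thesis unfolding xK z by simp
  qed
  moreover have "slash k (eisenstein_Fe k \<chi>1 N1 \<chi>2 N2 e) A B (int C) D \<tau> =
      w powi (- int k) * ((w / x) ^ k * K / 2 * (eis_const k M2 M1 cc + eis_series k M1 \<sigma> cc))"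
    unfolding slash_def F[symmetric] by (simp add: w_def)
  ultimately have "z_const k \<chi>1 N1 \<chi>2 N2 e C * slash k (eisenstein_Fe k \<chi>1 N1 \<chi>2 N2 e) A B (int C) D \<tau> =
      eis_const k M2 M1 cc + eis_series k M1 \<sigma> cc"
    using w x K_nonzero by (simp add: power_int_minus power_divide)
  thus "(?t has_sum (z_const k \<chi>1 N1 \<chi>2 N2 e C * slash k (eisenstein_Fe k \<chi>1 N1 \<chi>2 N2 e) A B (int C) D \<tau>)) UNIV"
    using sum by simp
qed

end

theorem theorem2p3:
  fixes k N1 N2 e N C g g1 g2 :: nat
    and A B D A' u :: int
    and \<chi>1 \<chi>2 :: "int \<Rightarrow> complex"
    and \<tau> :: complex
  assumes "k \<ge> 1"
    and "primitive_character N1 \<chi>1" and "primitive_character N2 \<chi>2"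
    and "\<chi>1 (-1) * \<chi>2 (-1) = (-1) ^ k"
    and "\<not> (k = 2 \<and> \<chi>1 = (\<lambda>_. 1) \<and> \<chi>2 = (\<lambda>_. 1))"
    and "e \<ge> 1" and "N = e * N1 * N2"
    and "A * D - B * int C = 1"
    and "C dvd N" and "C > 0" and "int N dvd B"
    and "g = gcd e C" and "g1 = gcd (N1 * g) C" and "g2 = gcd (N2 * g) C"
    and "[A * A' = 1] (mod int N)"
    and "[A * int (e div g) * u = 1] (mod int (C div g))"
    and "Im \<tau> > 0"
  shows "(\<lambda>n. a_coeff k \<chi>1 N1 \<chi>2 N2 e A C A' u n * qpow \<tau> (real (g1 * g2 * n) / real N)) summable_on UNIV
       \<and> slash k (eisenstein_Fe k \<chi>1 N1 \<chi>2 N2 e) A B (int C) D \<tau> =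
           1 / z_const k \<chi>1 N1 \<chi>2 N2 e C *
           (\<Sum>\<^sub>\<infinity>n. a_coeff k \<chi>1 N1 \<chi>2 N2 e A C A' u n * qpow \<tau> (real (g1 * g2 * n) / real N))"
proof -
  interpret E: cusp_expansion k N1 N2 e C A u \<chi>1 \<chi>2
    by unfold_locales (use assms in auto)
  have g_eq: "E.g = g" "E.g1 = g1" "E.g2 = g2"
    by (simp_all add: E.g_def E.g1_def E.g2_def assms(12-14))
  have "((\<lambda>n. a_coeff k \<chi>1 N1 \<chi>2 N2 e A C A' u n * qpow \<tau> (real (g1 * g2 * n) / real N)) has_sum
           (z_const k \<chi>1 N1 \<chi>2 N2 e C * slash k (eisenstein_Fe k \<chi>1 N1 \<chi>2 N2 e) A B (int C) D \<tau>)) UNIV"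
    and "z_const k \<chi>1 N1 \<chi>2 N2 e C \<noteq> 0"
    using E.expansion_has_sum[of D B A' \<tau>] assms unfolding g_eq by auto
  thus ?thesis by (auto simp: summable_on_def infsumI)
qed

end
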